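(* Let $\alpha\ge -\tfrac12$, $1<p<\infty$, and let $\phi:\mathbb{R}^+\to\mathbb{R}^+$ be a positive measurable function such that $\phi$ is almost decreasing and $r\mapsto r^{d_\alpha/p}\phi(r)$ is almost increasing. Then there is a constant $C>0$ such that for all $f\in L^{p,\phi}(\mathbb{R},d\mu_\alpha)$, $$\|M^\alpha f\|_{L^{p,\phi}(\mathbb{R},d\mu_\alpha)}\le C\,\|f\|_{L^{p,\phi}(\mathbb{R},d\mu_\alpha)}.$$
   Context: Notation: $\mathbb{R}^+=(0,\infty)$; $\alpha\ge-\frac12$ is a fixed real number; $d_\alpha=2\alpha+2$; $d\mu_\alpha(x)=A_\alpha|x|^{2\alpha+1}dx$ on $\mathbb{R}$ with $A_\alpha=(2^{\alpha+1}\Gamma(\alpha+1))^{-1}$; $B(0,r)=(-r,r)$. Dunkl translation: for $x,y\in\mathbb{R}$ and $\theta\in[0,\pi]$ put $(x,y)_\theta=\sqrt{x^2+y^2-2xy\cos\theta}$. For a function $g$ on $\mathbb{R}$ (continuous, or locally integrable with respect to $\mu_\alpha$, in which case the formula is understood for almost every $y$), $$\tau_x^\alpha g(y)=\frac{c_\alpha}{2}\int_0^\pi\Big\{g((x,y)_\theta)+g(-(x,y)_\theta)+\frac{x+y}{(x,y)_\theta}\big[g((x,y)_\theta)-g(-(x,y)_\theta)\big]\Big\}(1-\cos\theta)\sin^{2\alpha}\theta\,d\theta,$$ with $c_\alpha=\big(\int_0^\pi\sin^{2\alpha}\theta\,d\theta\big)^{-1}=\frac{\Gamma(\alpha+1)}{\sqrt\pi\,\Gamma(\alpha+1/2)}$;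 for $\alpha=-\frac12$ it is the ordinary translation $\tau_x^\alpha g(y)=g(x+y)$. The notation $\tau_x^\alpha|f|^p(y)$ means $(\tau_x^\alpha(|f|^p))(y)$. Generalized Dunkl-type Morrey space: for $1\le p<\infty$ and $\phi:\mathbb{R}^+\to\mathbb{R}^+$, $L^{p,\phi}(\mathbb{R},d\mu_\alpha)$ is the set of locally $p$-integrable $f$ on $\mathbb{R}$ with $$\|f\|_{L^{p,\phi}(\mathbb{R},d\mu_\alpha)}=\sup_{r>0,\,x\in\mathbb{R}}\frac1{\phi(r)}\Big(\frac1{r^{d_\alpha}}\int_{B(0,r)}\tau_x^\alpha|f|^p(y)\,d\mu_\alpha(y)\Big)^{1/p}<\infty.$$ Dunkl-type Hardy–Littlewood maximal operator: $M^\alpha f(x)=\sup_{r>0}\frac1{\mu_\alpha(B(0,r))}\int_{B(0,r)}\tau_x^\alpha|f|(y)\,d\mu_\alpha(y)$. A function $\theta:(0,\infty)\to(0,\infty)$ is almost increasing (resp. almost decreasing) if there is $C>0$ with $\theta(r)\le C\theta(s)$ (resp. $\theta(r)\ge C\theta(s)$) for all $r\le s$. *)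

theory Defs
  imports "HOL-Analysis.Analysis"
begin

definition d_dim :: "real \<Rightarrow> real" where
  "d_dim \<alpha> = 2 * \<alpha> + 2"

(* All measurability below is Lebesgue measurability. For alpha = -1/2 the density is constant
   except at the point 0, where Isabelle's 0 powr 0 = 0 applies; this is a null set. *)
definition dunkl_measure :: "real \<Rightarrow> real measure" where
  "dunkl_measure \<alpha> =
     density lebesgue
       (\<lambda>x. ennreal (1 / (2 powr (\<alpha> + 1) * Gamma (\<alpha> + 1)) * \<bar>x\<bar> powr (2 * \<alpha> + 1)))"

definition c_dunkl :: "real \<Rightarrow> real" where
  "c_dunkl \<alpha> = inverse (LINT \<theta>:{0..pi}|lebesgue. sin \<theta> powr (2 * \<alpha>))"

definition dunkl_dist :: "real \<Rightarrow> real \<Rightarrow> real \<Rightarrow> real" where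
  "dunkl_dist x y \<theta> = sqrt (x\<^sup>2 + y\<^sup>2 - 2 * x * y * cos \<theta>)"

(* The kernel is signed: the translate of a nonnegative function can take negative values, so
   this is a Bochner integral. For locally integrable g it converges for almost every y.
   The quotient (x + y) / dunkl_dist x y \<theta> has a vanishing denominator only for \<theta> in a null set,
   unless x = y = 0, where the convention 0 / 0 = 0 yields g 0. *)
definition dunkl_translation :: "real \<Rightarrow> real \<Rightarrow> (real \<Rightarrow> real) \<Rightarrow> real \<Rightarrow> real" where
  "dunkl_translation \<alpha> x g y =
     (if \<alpha> = - 1 / 2 then g (x + y)
      else c_dunkl \<alpha> / 2 *
        (LINT \<theta>:{0..pi}|lebesgue.
           (g (dunkl_dist x y \<theta>) + g (- dunkl_dist x y \<theta>)
             + (x + y) / dunkl_dist x y \<theta>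
                 * (g (dunkl_dist x y \<theta>) - g (- dunkl_dist x y \<theta>)))
           * (1 - cos \<theta>) * sin \<theta> powr (2 * \<alpha>)))"

definition locally_p_integrable ::
    "real \<Rightarrow> real \<Rightarrow> (real \<Rightarrow> 'a::real_normed_vector) \<Rightarrow> bool" where
  "locally_p_integrable \<alpha> p f \<longleftrightarrow>
     f \<in> borel_measurable (dunkl_measure \<alpha>) \<and>
     (\<forall>K. compact K \<longrightarrow> set_integrable (dunkl_measure \<alpha>) K (\<lambda>x. norm (f x) powr p))"

(* Only meaningful for locally p-integrable f (see morrey_space): then all the integrals over
   {-r<..<r} exist and are nonnegative, since the translate of the indicator function of a
   symmetric interval is nonnegative. *)
definition morrey_norm ::
    "real \<Rightarrow> real \<Rightarrow> (real \<Rightarrow> real) \<Rightarrow> (real \<Rightarrow> 'a::real_normed_vector) \<Rightarrow> ennreal" where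
  "morrey_norm \<alpha> p \<phi> f =
     (SUP r\<in>{0<..}. SUP x.
        ennreal (1 / \<phi> r *
          (1 / r powr d_dim \<alpha> *
            (LINT y:{-r<..<r}|dunkl_measure \<alpha>.
               dunkl_translation \<alpha> x (\<lambda>z. norm (f z) powr p) y)) powr (1 / p)))"

definition morrey_space ::
    "real \<Rightarrow> real \<Rightarrow> (real \<Rightarrow> real) \<Rightarrow> (real \<Rightarrow> 'a::real_normed_vector) set" where
  "morrey_space \<alpha> p \<phi> = {f. locally_p_integrable \<alpha> p f \<and> morrey_norm \<alpha> p \<phi> f < \<infinity>}"

(* The supremum may be infinite at some points, hence the values in ennreal. The averages are
   nonnegative for locally integrable f, for the same reason as in morrey_norm. *)
definition dunkl_maximal ::
    "real \<Rightarrow> (real \<Rightarrow> 'a::real_normed_vector) \<Rightarrow> real \<Rightarrow> ennreal" where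
  "dunkl_maximal \<alpha> f x =
     (SUP r\<in>{0<..}.
        ennreal (1 / measure (dunkl_measure \<alpha>) {-r<..<r} *
          (LINT y:{-r<..<r}|dunkl_measure \<alpha>.
             dunkl_translation \<alpha> x (\<lambda>z. norm (f z)) y)))"

definition almost_increasing :: "(real \<Rightarrow> real) \<Rightarrow> bool" where
  "almost_increasing \<theta> \<longleftrightarrow> (\<exists>C>0. \<forall>r s. 0 < r \<and> r \<le> s \<longrightarrow> \<theta> r \<le> C * \<theta> s)"

definition almost_decreasing :: "(real \<Rightarrow> real) \<Rightarrow> bool" where
  "almost_decreasing \<theta> \<longleftrightarrow> (\<exists>C>0. \<forall>r s. 0 < r \<and> r \<le> s \<longrightarrow> \<theta> r \<ge> C * \<theta> s)"

end

theory Submission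
  imports Defs
begin

text \<open>
  The translate of a nonnegative function need not be nonnegative, so the Morrey norm and the maximal
  function are first rewritten in terms of positive kernels.  Translation by \<open>x\<close> has translation by
  \<open>- x\<close> as its adjoint: the integral of the translate of \<open>g\<close> over \<open>(-r, r)\<close> equals the integral of
  \<open>g\<close> against \<open>interval_kernel \<alpha> r x\<close>, the translate by \<open>- x\<close> of the indicator of \<open>(-r, r)\<close>
  (\<open>dunkl_adjoint\<close>), and this kernel is nonnegative because the indicator is even.  Adjointness is
  read off from Roesler's product formula.  Substituting the distance \<open>z\<close> for the angle in the
  definition of the translation produces a kernel \<open>W x y z\<close> with \<open>W (- x) z y = W x y z\<close> whose
  absolute value has a bounded integral in \<open>z\<close>, so that Fubini's theorem applies.
  
  Put \<open>m = max \<bar>x\<bar> r\<close>.  The kernel \<open>interval_kernel \<alpha> r x\<close> vanishes unless \<open>\<bar>\<bar>x\<bar> - \<bar>z\<bar>\<bar> < r\<close> and is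
  at most a constant times \<open>(r / m) powr (2 * \<alpha> + 1)\<close>; for radius \<open>2 * r\<close> it is at least a constant
  times the same power on \<open>(x - r, x + r)\<close>.  This power times the gauge
  \<open>V x r = r * m powr (2 * \<alpha> + 1)\<close>, which has the size of the measure of \<open>(x - r, x + r)\<close>, is exactly
  \<open>r powr d_dim \<alpha>\<close>.  Hence the Dunkl-type Morrey norm is comparable with the norm built from averages
  over the intervals \<open>(x - r, x + r)\<close>, and the Dunkl maximal function of \<open>f\<close> is at most a constant
  times the centred Hardy-Littlewood maximal function of \<open>norm (f z) + norm (f (- z))\<close>.
  
  For the Hardy-Littlewood function of a doubling measure the Morrey bound is classical.  On a ball
  \<open>B\<close> of radius \<open>r\<close>, radii up to \<open>r\<close> see only the values in the ball with twice the radius, for which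
  the \<open>L\<^sup>p\<close> bound suffices; an average over a radius \<open>s > r\<close> is at most a constant times \<open>\<phi> s\<close>, hence
  times \<open>\<phi> r\<close> because \<open>\<phi>\<close> is almost decreasing.  The \<open>L\<^sup>p\<close> bound follows from the weak-type
  inequality, a consequence of Vitali's covering lemma, by integrating over levels.
  
  Two devices take care of measurability.  Lebesgue measurable functions are replaced by Borel
  representatives, and suprema over all radii are reduced to suprema over rational radii.
\<close>


section \<open>Maximal functions and Morrey bounds for a doubling gauge\<close>

lemma powr_add_le:
  fixes a b p :: real
  assumes "0 \<le> a" "0 \<le> b" "0 < p"
  shows "(a + b) powr p \<le> 2 powr p * (a powr p + b powr p)"
proof -
  have "(a + b) powr p \<le> (2 * max a b) powr p"
    using assms by (intro powr_mono2) auto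
  also have "\<dots> = 2 powr p * max a b powr p" using assms by (subst powr_mult) auto
  also have "max a b powr p \<le> a powr p + b powr p" by (auto simp: max_def)
  finally show ?thesis by simp
qed

text \<open>
  This expresses a power as an integral over levels, which converts bounds on the measure of
  superlevel sets into bounds on \<open>L\<^sup>p\<close> integrals.
\<close>

lemma nn_integral_powr_layer:
  fixes q c :: real
  assumes "q > 0" "c \<ge> 0"
  shows "(\<integral>\<^sup>+t\<in>{0<..<c}. ennreal (t powr (q - 1)) \<partial>lborel) = ennreal (c powr q / q)"
proof -
  have "((\<lambda>t. t powr (q - 1)) has_integral (c powr (q - 1 + 1) / (q - 1 + 1))) {0..c}"
    using assms by (intro has_integral_powr_from_0) auto
  then have "((\<lambda>t. indicator {0..c} t * t powr (q - 1)) has_integral (c powr q / q)) UNIV"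
    by (subst (asm) has_integral_restrict_UNIV[symmetric])
       (auto elim!: has_integral_eq[rotated] simp: indicator_def)
  then have "(\<integral>\<^sup>+ t. ennreal (indicator {0..c} t * t powr (q - 1)) \<partial>lborel) = ennreal (c powr q / q)"
    by (intro nn_integral_has_integral_lborel) auto
  also have "(\<integral>\<^sup>+ t. ennreal (indicator {0..c} t * t powr (q - 1)) \<partial>lborel) =
     (\<integral>\<^sup>+t\<in>{0<..<c}. ennreal (t powr (q - 1)) \<partial>lborel)"
    using AE_lborel_singleton[of 0] AE_lborel_singleton[of c]
    by (intro nn_integral_cong_AE, eventually_elim) (auto simp: indicator_def)
  finally show ?thesis .
qed

text \<open>
  Countably many radii keep suprema of averages Borel measurable.
\<close>

definition rational_radii :: "real set" where
  "rational_radii = {s \<in> \<rat>. 0 < s}"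

lemma countable_rational_radii: "countable rational_radii" "rational_radii \<subseteq> {0<..}"
  unfolding rational_radii_def by (auto intro: countable_subset[OF _ countable_rat])

text \<open>
  A gauge \<open>V x r\<close> stands in for the measure of the ball of radius \<open>r\<close> about \<open>x\<close>.  It bounds that
  measure from above and is itself doubling; the factor 5 is the dilation in Vitali's covering lemma.
  An explicit gauge replaces the computation of measures of balls.
\<close>

locale doubling_gauge = sigma_finite_measure \<nu>
  for \<nu> :: "'a::euclidean_space measure" +
  fixes V :: "'a \<Rightarrow> real \<Rightarrow> real" and A :: real
  assumes sets_gauge [measurable_cong, simp]: "sets \<nu> = sets borel"
    and A_pos: "0 < A"
    and V_pos: "0 < r \<Longrightarrow> 0 < V x r"
    and V_mono: "0 < r \<Longrightarrow> r \<le> s \<Longrightarrow> V x r \<le> V x s"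
    and V_doubling: "0 < r \<Longrightarrow> V x (5 * r) \<le> A * V x r"
    and emeasure_ball_le: "0 < r \<Longrightarrow> emeasure \<nu> (ball x r) \<le> ennreal (A * V x r)"
    and V_measurable [measurable]: "(\<lambda>x. V x r) \<in> borel_measurable borel"
begin

lemma space_gauge [simp]: "space \<nu> = UNIV"
  using sets_eq_imp_space_eq[OF sets_gauge] by simp

lemma ball_borel [measurable, simp]: "ball x s \<in> sets borel" for x :: 'a
  by auto

lemma measurable_gauge [simp]: "measurable \<nu> N = measurable borel N"
  by (rule measurable_cong_sets) auto

definition gauge_average :: "('a \<Rightarrow> real) \<Rightarrow> real \<Rightarrow> 'a \<Rightarrow> ennreal" where
  "gauge_average f s x = (\<integral>\<^sup>+z\<in>ball x s. ennreal (f z) \<partial>\<nu>) / ennreal (V x s)"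

text \<open>
  The set \<open>S\<close> of admissible radii is a parameter since both the full operator and its truncation to
  small radii occur.
\<close>

definition gauge_maximal :: "real set \<Rightarrow> ('a \<Rightarrow> real) \<Rightarrow> 'a \<Rightarrow> ennreal" where
  "gauge_maximal S f x = (SUP s\<in>S. gauge_average f s x)"

lemma gauge_average_measurable [measurable]:
  assumes [measurable]: "f \<in> borel_measurable borel"
  shows "gauge_average f s \<in> borel_measurable borel"
proof -
  have "indicator (ball x s) z = (if dist x z < s then 1 else 0 :: ennreal)" for x z :: 'a
    by (auto simp: indicator_def)
  then show ?thesis
    unfolding gauge_average_def[abs_def] by simp
qed

lemma gauge_maximal_measurable [measurable]:
  assumes "countable S" and [measurable]: "f \<in> borel_measurable borel"
  shows "gauge_maximal S f \<in> borel_measurable borel"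
  unfolding gauge_maximal_def[abs_def] using assms(1) by (intro borel_measurable_SUP) auto

lemma lt_gauge_average_imp:
  assumes "0 < s" "0 < \<kappa>" "ennreal \<kappa> < gauge_average f s x"
  shows "ennreal (\<kappa> * V x s) \<le> (\<integral>\<^sup>+z\<in>ball x s. ennreal (f z) \<partial>\<nu>)"
proof -
  have V: "0 < V x s" by (rule V_pos) fact
  have "ennreal \<kappa> * ennreal (V x s) \<le> gauge_average f s x * ennreal (V x s)"
    using assms(3) by (intro mult_right_mono) auto
  also have "\<dots> = (\<integral>\<^sup>+z\<in>ball x s. ennreal (f z) \<partial>\<nu>)"
    unfolding gauge_average_def using V by (simp add: ennreal_divide_times divide_ennreal)
  finally show ?thesis using V assms by (simp add: ennreal_mult)
qed

text \<open>
  Each point of the superlevel set is the centre of a ball on which the integral of \<open>f\<close> exceeds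
  \<open>\<kappa> * V x s\<close>.  Vitali's lemma selects disjoint balls among these whose fivefold dilations still cover
  the set; doubling compares the dilations with the selected balls, and the integrals over disjoint
  balls add up to at most the integral of \<open>f\<close>.  The radii are bounded because Vitali's lemma requires it.
\<close>

lemma weak_type:
  assumes S: "countable S" "S \<subseteq> {0<..R}" and f [measurable]: "f \<in> borel_measurable borel"
    and \<kappa>: "0 < \<kappa>"
  shows "ennreal \<kappa> * emeasure \<nu> {x. ennreal \<kappa> < gauge_maximal S f x} \<le> ennreal (A * A) * (\<integral>\<^sup>+ z. ennreal (f z) \<partial>\<nu>)"
proof -
  define E where "E = {x. ennreal \<kappa> < gauge_maximal S f x}"
  have "\<exists>s\<in>S. ennreal \<kappa> < gauge_average f s x" if "x \<in> E" for x
    using that unfolding E_def gauge_maximal_def by (auto simp: less_SUP_iff)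
  then obtain \<rho> where \<rho>: "\<And>x. x \<in> E \<Longrightarrow> \<rho> x \<in> S" "\<And>x. x \<in> E \<Longrightarrow> ennreal \<kappa> < gauge_average f (\<rho> x) x"
    by metis
  have \<rho>0: "0 < \<rho> x" "\<rho> x \<le> R" if "x \<in> E" for x
    using \<rho>(1)[OF that] S(2) by auto
  have "E \<subseteq> (\<Union>i\<in>E. ball (id i) (\<rho> i))" using \<rho>0 by auto
  then obtain C where C: "countable C" "C \<subseteq> E"
     "pairwise (\<lambda>i j. disjnt (ball (id i) (\<rho> i)) (ball (id j) (\<rho> j))) C"
     "E \<subseteq> (\<Union>i\<in>C. ball (id i) (5 * \<rho> i))"
    by (rule Vitali_covering_lemma_balls[where S=E and K=E and a=id and r=\<rho> and B=R]) (use \<rho>0 in blast)+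
  \<comment> \<open>The selected countable family is numbered by natural numbers, padded with empty sets.\<close>
  define I where "I = to_nat_on C ` C"
  define c where "c = from_nat_into C"
  have c: "c n \<in> C" if "n \<in> I" for n
    using that C(1) unfolding I_def c_def by auto
  have c_inj: "c m \<noteq> c n" if "m \<in> I" "n \<in> I" "m \<noteq> n" for m n
    using that C(1) unfolding I_def c_def by auto
  have c_onto: "\<exists>n\<in>I. c n = i" if "i \<in> C" for i
    using that C(1) unfolding I_def c_def by auto
  define X where "X n = (if n \<in> I then ball (c n) (\<rho> (c n)) else {})" for n
  define Y where "Y n = (if n \<in> I then ball (c n) (5 * \<rho> (c n)) else {})" for n
  have XY [measurable, simp]: "X n \<in> sets borel" "Y n \<in> sets borel" for n
    unfolding X_def Y_def by auto
  have disj: "disjoint_family X"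
    unfolding disjoint_family_on_def
  proof (intro ballI impI)
    fix m n :: nat assume "m \<noteq> n"
    show "X m \<inter> X n = {}"
    proof (cases "m \<in> I \<and> n \<in> I")
      case True
      with C(3) c c_inj[of m n] \<open>m \<noteq> n\<close> show ?thesis
        unfolding pairwise_def disjnt_def X_def by fastforce
    qed (auto simp: X_def)
  qed
  have cov: "E \<subseteq> (\<Union>n. Y n)"
  proof
    fix x assume "x \<in> E"
    with C(4) obtain i where i: "i \<in> C" "x \<in> ball i (5 * \<rho> i)" by auto
    from c_onto[OF i(1)] obtain n where "n \<in> I" "c n = i" by auto
    with i show "x \<in> (\<Union>n. Y n)" by (auto simp: Y_def)
  qed
  have step: "ennreal \<kappa> * emeasure \<nu> (Y n) \<le> ennreal (A * A) * emeasure (density \<nu> (\<lambda>z. ennreal (f z))) (X n)" for n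
  proof (cases "n \<in> I")
    case True
    define x where "x = c n"
    have x: "x \<in> E" using c[OF True] C(2) by (auto simp: x_def)
    note r = \<rho>0[OF x]
    have V: "0 < V x (\<rho> x)" "0 < V x (5 * \<rho> x)" using r by (auto intro!: V_pos)
    have "ennreal \<kappa> * emeasure \<nu> (Y n) \<le> ennreal \<kappa> * ennreal (A * V x (5 * \<rho> x))"
      using True r emeasure_ball_le[of "5 * \<rho> x" x] by (intro mult_left_mono) (auto simp: Y_def x_def)
    also have "\<dots> \<le> ennreal \<kappa> * ennreal (A * (A * V x (\<rho> x)))"
      using V_doubling[of "\<rho> x" x] r A_pos by (intro mult_left_mono ennreal_leI) auto
    also have "\<dots> = ennreal (A * A) * ennreal (\<kappa> * V x (\<rho> x))"
      using V \<kappa> A_pos by (simp add: ennreal_mult[symmetric] algebra_simps)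
    also have "\<dots> \<le> ennreal (A * A) * (\<integral>\<^sup>+z\<in>ball x (\<rho> x). ennreal (f z) \<partial>\<nu>)"
      using lt_gauge_average_imp[OF r(1) \<kappa> \<rho>(2)[OF x]] by (intro mult_left_mono) auto
    also have "(\<integral>\<^sup>+z\<in>ball x (\<rho> x). ennreal (f z) \<partial>\<nu>) = emeasure (density \<nu> (\<lambda>z. ennreal (f z))) (X n)"
      using True by (subst emeasure_density) (auto simp: X_def x_def)
    finally show ?thesis .
  qed (simp add: Y_def)
  have "ennreal \<kappa> * emeasure \<nu> E \<le> ennreal \<kappa> * emeasure \<nu> (\<Union>n. Y n)"
    by (intro mult_left_mono emeasure_mono cov sets.countable_UN) auto
  also have "\<dots> \<le> ennreal \<kappa> * (\<Sum>n. emeasure \<nu> (Y n))"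
    by (intro mult_left_mono emeasure_subadditive_countably) auto
  also have "\<dots> = (\<Sum>n. ennreal \<kappa> * emeasure \<nu> (Y n))"
    by simp
  also have "\<dots> \<le> (\<Sum>n. ennreal (A * A) * emeasure (density \<nu> (\<lambda>z. ennreal (f z))) (X n))"
    by (intro suminf_le step) auto
  also have "\<dots> = ennreal (A * A) * (\<Sum>n. emeasure (density \<nu> (\<lambda>z. ennreal (f z))) (X n))"
    by simp
  also have "(\<Sum>n. emeasure (density \<nu> (\<lambda>z. ennreal (f z))) (X n)) = emeasure (density \<nu> (\<lambda>z. ennreal (f z))) (\<Union>n. X n)"
    using disj by (intro suminf_emeasure) auto
  also have "\<dots> \<le> emeasure (density \<nu> (\<lambda>z. ennreal (f z))) UNIV"
    by (intro emeasure_mono) auto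
  also have "\<dots> = (\<integral>\<^sup>+ z. ennreal (f z) \<partial>\<nu>)"
    by (subst emeasure_density) auto
  finally show ?thesis unfolding E_def by (simp add: mult_left_mono)
qed

text \<open>
  The weak-type inequality holds at every level, so the set where the value is infinite has measure at
  most a fixed finite number divided by an arbitrarily large one.
\<close>

lemma gauge_maximal_finite_AE:
  assumes S: "countable S" "S \<subseteq> {0<..R}" and f [measurable]: "f \<in> borel_measurable borel"
    and fin: "(\<integral>\<^sup>+ z. ennreal (f z) \<partial>\<nu>) < \<infinity>"
  shows "AE x in \<nu>. gauge_maximal S f x < \<infinity>"
proof -
  note [measurable] = gauge_maximal_measurable[OF S(1) f]
  define E where "E = {x. gauge_maximal S f x = \<infinity>}"
  have E [measurable]: "E \<in> sets \<nu>" unfolding E_def by measurable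
  define c where "c = ennreal (A * A) * (\<integral>\<^sup>+ z. ennreal (f z) \<partial>\<nu>)"
  have c: "c < \<infinity>" using fin by (simp add: c_def ennreal_mult_less_top)
  have le: "ennreal \<kappa> * emeasure \<nu> E \<le> c" if "0 < \<kappa>" for \<kappa>
  proof -
    have "emeasure \<nu> E \<le> emeasure \<nu> {x. ennreal \<kappa> < gauge_maximal S f x}"
      unfolding E_def by (intro emeasure_mono) auto
    with weak_type[OF S f that] show ?thesis
      unfolding c_def by (meson mult_left_mono order_trans zero_le)
  qed
  have "emeasure \<nu> E = 0"
  proof (rule ccontr)
    assume ne: "emeasure \<nu> E \<noteq> 0"
    have "emeasure \<nu> E \<le> c" using le[of 1] by simp
    with c have "emeasure \<nu> E < \<infinity>" by auto
    then obtain m where m: "emeasure \<nu> E = ennreal m" "m \<ge> 0" by (cases "emeasure \<nu> E") auto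
    obtain d where d: "c = ennreal d" "d \<ge> 0" using c by (cases c) auto
    have "m > 0" using ne m by (cases "m = 0") auto
    have "ennreal ((d + 1) / m) * ennreal m \<le> ennreal d"
      using le[of "(d+1)/m"] m d \<open>m > 0\<close> by auto
    then have "d + 1 \<le> d" using \<open>m > 0\<close> d by (simp add: ennreal_mult[symmetric])
    then show False by simp
  qed
  then have "E \<in> null_sets \<nu>" using E by auto
  then show ?thesis
    by (rule AE_I') (auto simp: E_def less_top[symmetric])
qed

text \<open>
  The part of \<open>f\<close> below \<open>\<kappa> / (2 * A)\<close> contributes at most \<open>\<kappa> / 2\<close> to every average, so only the part
  above that level is responsible for the maximal function exceeding \<open>\<kappa>\<close>.
\<close>

lemma weak_type_truncated:
  assumes S: "countable S" "S \<subseteq> {0<..R}" and f [measurable]: "f \<in> borel_measurable borel"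
    and f0: "\<And>x. 0 \<le> f x" and \<kappa>: "0 < \<kappa>"
  shows "ennreal \<kappa> * emeasure \<nu> {x. ennreal \<kappa> < gauge_maximal S f x}
    \<le> ennreal (2 * A * A) * (\<integral>\<^sup>+ z. ennreal (f z) * indicator {0<..<2 * A * f z} \<kappa> \<partial>\<nu>)"
proof -
  define g where "g z = f z * indicator {0<..<2 * A * f z} \<kappa>" for z
  have g_eq: "g z = (if \<kappa> < 2 * A * f z then f z else 0)" for z
    using \<kappa> by (auto simp: g_def indicator_def)
  have [measurable]: "g \<in> borel_measurable borel" unfolding g_eq[abs_def] by measurable
  have fg: "f z \<le> g z + \<kappa> / (2 * A)" for z
    using A_pos \<kappa> f0 by (auto simp: g_eq field_simps)
  have g0: "g z \<ge> 0" for z using f0 by (simp add: g_def)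
  have gauge_average: "gauge_average f s x \<le> gauge_average g s x + ennreal (\<kappa> / 2)" if s: "0 < s" for s x
  proof -
    have V: "0 < V x s" using s by (rule V_pos)
    have "(\<integral>\<^sup>+z\<in>ball x s. ennreal (f z) \<partial>\<nu>)
       \<le> (\<integral>\<^sup>+ z. ennreal (g z) * indicator (ball x s) z + ennreal (\<kappa> / (2 * A)) * indicator (ball x s) z \<partial>\<nu>)"
      using fg A_pos \<kappa> g0 by (intro nn_integral_mono)
        (auto simp: indicator_def ennreal_plus[symmetric] simp del: ennreal_plus intro!: ennreal_leI)
    also have "\<dots> = (\<integral>\<^sup>+z\<in>ball x s. ennreal (g z) \<partial>\<nu>) + ennreal (\<kappa> / (2 * A)) * emeasure \<nu> (ball x s)"
      by (subst nn_integral_add) (auto simp: nn_integral_cmult_indicator)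
    also have "\<dots> \<le> (\<integral>\<^sup>+z\<in>ball x s. ennreal (g z) \<partial>\<nu>) + ennreal (\<kappa> / (2 * A)) * ennreal (A * V x s)"
      by (intro add_left_mono mult_left_mono emeasure_ball_le s) auto
    also have "ennreal (\<kappa> / (2 * A)) * ennreal (A * V x s) = ennreal (\<kappa> / 2 * V x s)"
      using A_pos V \<kappa> by (simp add: ennreal_mult[symmetric])
    finally have "gauge_average f s x \<le> ((\<integral>\<^sup>+z\<in>ball x s. ennreal (g z) \<partial>\<nu>) + ennreal (\<kappa> / 2 * V x s)) / ennreal (V x s)"
      unfolding gauge_average_def by (rule divide_right_mono_ennreal)
    also have "\<dots> = gauge_average g s x + ennreal (\<kappa> / 2 * V x s) / ennreal (V x s)"
      unfolding gauge_average_def by (simp add: divide_ennreal_def distrib_right)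
    also have "ennreal (\<kappa> / 2 * V x s) / ennreal (V x s) = ennreal (\<kappa> / 2)"
      using V \<kappa> by (simp add: divide_ennreal)
    finally show ?thesis .
  qed
  have "gauge_maximal S f x \<le> gauge_maximal S g x + ennreal (\<kappa> / 2)" for x
    unfolding gauge_maximal_def
  proof (rule SUP_least)
    fix s assume s: "s \<in> S"
    then have "gauge_average f s x \<le> gauge_average g s x + ennreal (\<kappa> / 2)" using S(2) by (intro gauge_average) auto
    also have "\<dots> \<le> (SUP s\<in>S. gauge_average g s x) + ennreal (\<kappa> / 2)"
      using s by (intro add_right_mono SUP_upper)
    finally show "gauge_average f s x \<le> (SUP s\<in>S. gauge_average g s x) + ennreal (\<kappa> / 2)" .
  qed
  note le = this
  have sub: "{x. ennreal \<kappa> < gauge_maximal S f x} \<subseteq> {x. ennreal (\<kappa> / 2) < gauge_maximal S g x}"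
  proof (intro subsetI CollectI, rule ccontr)
    fix x assume l: "x \<in> {x. ennreal \<kappa> < gauge_maximal S f x}"
      and "\<not> ennreal (\<kappa> / 2) < gauge_maximal S g x"
    with le[of x] have "gauge_maximal S f x \<le> ennreal (\<kappa> / 2) + ennreal (\<kappa> / 2)"
      by (meson add_right_mono leI order_trans)
    also have "\<dots> = ennreal \<kappa>" using \<kappa> by (simp add: ennreal_plus[symmetric] del: ennreal_plus)
    finally show False using l by simp
  qed
  note [measurable] = gauge_maximal_measurable[OF S(1) \<open>g \<in> borel_measurable borel\<close>]
  have "ennreal \<kappa> * emeasure \<nu> {x. ennreal \<kappa> < gauge_maximal S f x}
      \<le> ennreal \<kappa> * emeasure \<nu> {x. ennreal (\<kappa> / 2) < gauge_maximal S g x}"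
    by (intro mult_left_mono emeasure_mono sub) auto
  also have "\<dots> = 2 * (ennreal (\<kappa> / 2) * emeasure \<nu> {x. ennreal (\<kappa> / 2) < gauge_maximal S g x})"
    using \<kappa> by (simp add: mult.assoc[symmetric] ennreal_mult''[symmetric]
        flip: ennreal_numeral)
  also have "\<dots> \<le> 2 * (ennreal (A * A) * (\<integral>\<^sup>+ z. ennreal (g z) \<partial>\<nu>))"
    using S \<kappa> by (intro mult_left_mono weak_type[where R = R]) auto
  also have "\<dots> = ennreal (2 * A * A) * (\<integral>\<^sup>+ z. ennreal (g z) \<partial>\<nu>)"
    using A_pos by (simp add: ennreal_mult ac_simps)
  also have "(\<integral>\<^sup>+ z. ennreal (g z) \<partial>\<nu>) = (\<integral>\<^sup>+ z. ennreal (f z) * indicator {0<..<2 * A * f z} \<kappa> \<partial>\<nu>)"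
    by (intro nn_integral_cong) (auto simp: g_def indicator_def)
  finally show ?thesis .
qed

text \<open>
  The factor \<open>2 * A * A\<close> is the constant of the truncated weak-type inequality; the remaining factors
  come from integrating \<open>p * t powr (p - 2)\<close> up to \<open>2 * A * f x\<close>.
\<close>

definition strong_type_const :: "real \<Rightarrow> real" where
  "strong_type_const p = p * (2 * A * A) * ((2 * A) powr (p - 1) / (p - 1))"

text \<open>
  The truncated weak-type inequality is multiplied by \<open>p * t powr (p - 2)\<close> and integrated over all
  levels \<open>t\<close>.  On the left this gives the integral of the \<open>p\<close>-th power; on the right Tonelli's theorem
  leaves \<open>f x\<close> times the integral of \<open>t powr (p - 2)\<close> over \<open>t < 2 * A * f x\<close>, which converges at 0
  because \<open>p > 1\<close>.  Working with \<open>enn2real\<close> is harmless: it sends infinite values to 0 and therefore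
  only shrinks superlevel sets.
\<close>

lemma strong_type:
  assumes S: "countable S" "S \<subseteq> {0<..R}" and f [measurable]: "f \<in> borel_measurable borel"
    and f0: "\<And>x. 0 \<le> f x" and p: "1 < p"
  shows "(\<integral>\<^sup>+ x. ennreal (enn2real (gauge_maximal S f x) powr p) \<partial>\<nu>)
    \<le> ennreal (strong_type_const p) * (\<integral>\<^sup>+ x. ennreal (f x powr p) \<partial>\<nu>)"
proof -
  note [measurable] = gauge_maximal_measurable[OF S(1) f]
  interpret lp: pair_sigma_finite \<nu> "lborel :: real measure" ..
  define h where "h x = enn2real (gauge_maximal S f x)" for x
  have [measurable]: "h \<in> borel_measurable borel" unfolding h_def[abs_def] by measurable
  have h0: "h x \<ge> 0" for x by (simp add: h_def)
  have ind: "indicator {0<..<c} t = (if 0 < t \<and> t < c then 1 else 0 :: ennreal)" for c t :: real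
    by (auto simp: indicator_def)
  have "(\<integral>\<^sup>+ x. ennreal (h x powr p) \<partial>\<nu>) =
     (\<integral>\<^sup>+ x. (\<integral>\<^sup>+ t. ennreal p * (ennreal (t powr (p - 1)) * indicator {0<..<h x} t) \<partial>lborel) \<partial>\<nu>)"
    using p h0 by (intro nn_integral_cong)
      (subst nn_integral_cmult, auto simp: nn_integral_powr_layer ennreal_mult[symmetric])
  also have "\<dots> = (\<integral>\<^sup>+ t. (\<integral>\<^sup>+ x. ennreal p * (ennreal (t powr (p - 1)) * indicator {0<..<h x} t) \<partial>\<nu>) \<partial>lborel)"
    unfolding ind by (intro lp.Fubini'[symmetric]) measurable
  also have "\<dots> \<le> (\<integral>\<^sup>+ t. (\<integral>\<^sup>+ x. ennreal p * ennreal (2 * A * A) * (ennreal (f x) * (ennreal (t powr (p - 1 - 1)) * indicator {0<..<2 * A * f x} t)) \<partial>\<nu>) \<partial>lborel)"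
  proof (rule nn_integral_mono)
    fix t :: real
    show "(\<integral>\<^sup>+ x. ennreal p * (ennreal (t powr (p - 1)) * indicator {0<..<h x} t) \<partial>\<nu>)
       \<le> (\<integral>\<^sup>+ x. ennreal p * ennreal (2 * A * A) * (ennreal (f x) * (ennreal (t powr (p - 1 - 1)) * indicator {0<..<2 * A * f x} t)) \<partial>\<nu>)"
    proof (cases "t > 0")
      case True
      \<comment> \<open>One power of the level is spent on the weak-type inequality.\<close>
      have t_pow: "t powr (p - 1) = t powr (p - 1 - 1) * t"
        using True powr_add[of t "p - 1 - 1" 1] by simp
      have "(\<integral>\<^sup>+ x. ennreal p * (ennreal (t powr (p - 1)) * indicator {0<..<h x} t) \<partial>\<nu>)
         = ennreal p * ennreal (t powr (p - 1)) * (\<integral>\<^sup>+ x. indicator {x. t < h x} x \<partial>\<nu>)"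
        by (subst nn_integral_cmult[symmetric]) (auto simp: True mult.assoc indicator_def intro!: nn_integral_cong)
      also have "(\<integral>\<^sup>+ x. indicator {x. t < h x} x \<partial>\<nu>) = emeasure \<nu> {x. t < h x}" by simp
      also have "\<dots> \<le> emeasure \<nu> {x. ennreal t < gauge_maximal S f x}"
      proof (intro emeasure_mono subsetI)
        fix x assume "x \<in> {x. t < h x}"
        then have "t < enn2real (gauge_maximal S f x)" by (simp add: h_def)
        then show "x \<in> {x. ennreal t < gauge_maximal S f x}" using True
          by (cases "gauge_maximal S f x") (auto simp: ennreal_less_iff)
      qed measurable
      finally have "(\<integral>\<^sup>+ x. ennreal p * (ennreal (t powr (p - 1)) * indicator {0<..<h x} t) \<partial>\<nu>)
         \<le> ennreal p * ennreal (t powr (p - 1)) * emeasure \<nu> {x. ennreal t < gauge_maximal S f x}"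
        by (simp add: mult_left_mono)
      also have "\<dots> = ennreal p * ennreal (t powr (p - 1 - 1)) * (ennreal t * emeasure \<nu> {x. ennreal t < gauge_maximal S f x})"
        using True unfolding t_pow by (simp add: ennreal_mult ac_simps)
      also have "\<dots> \<le> ennreal p * ennreal (t powr (p - 1 - 1)) * (ennreal (2 * A * A) * (\<integral>\<^sup>+ z. ennreal (f z) * indicator {0<..<2 * A * f z} t \<partial>\<nu>))"
        by (intro mult_left_mono weak_type_truncated[OF S f f0 True]) auto
      also have "\<dots> = (ennreal p * ennreal (2 * A * A) * ennreal (t powr (p - 1 - 1))) * (\<integral>\<^sup>+ z. ennreal (f z) * indicator {0<..<2 * A * f z} t \<partial>\<nu>)"
        by (simp add: ac_simps)
      also have "\<dots> = (\<integral>\<^sup>+ x. ennreal p * ennreal (2 * A * A) * (ennreal (f x) * (ennreal (t powr (p - 1 - 1)) * indicator {0<..<2 * A * f x} t)) \<partial>\<nu>)"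
        unfolding ind by (subst nn_integral_cmult[symmetric], simp) (auto intro!: nn_integral_cong simp: ac_simps)
      finally show ?thesis .
    qed simp
  qed
  also have "\<dots> = (\<integral>\<^sup>+ x. (\<integral>\<^sup>+ t. ennreal p * ennreal (2 * A * A) * (ennreal (f x) * (ennreal (t powr (p - 1 - 1)) * indicator {0<..<2 * A * f x} t)) \<partial>lborel) \<partial>\<nu>)"
    unfolding ind by (intro lp.Fubini') measurable
  also have "\<dots> = (\<integral>\<^sup>+ x. ennreal (strong_type_const p) * ennreal (f x powr p) \<partial>\<nu>)"
  proof (intro nn_integral_cong)
    fix x
    have "(\<integral>\<^sup>+ t. ennreal p * ennreal (2 * A * A) * (ennreal (f x) * (ennreal (t powr (p - 1 - 1)) * indicator {0<..<2 * A * f x} t)) \<partial>lborel)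
      = ennreal p * ennreal (2 * A * A) * ennreal (f x) * (\<integral>\<^sup>+t\<in>{0<..<2 * A * f x}. ennreal (t powr (p - 1 - 1)) \<partial>lborel)"
      by (subst nn_integral_cmult[symmetric]) (auto simp: mult.assoc)
    also have "\<dots> = ennreal p * ennreal (2 * A * A) * ennreal (f x) * ennreal ((2 * A * f x) powr (p - 1) / (p - 1))"
      using p f0[of x] A_pos by (subst nn_integral_powr_layer) auto
    also have "\<dots> = ennreal (p * (2 * A * A) * (f x * ((2 * A * f x) powr (p - 1) / (p - 1))))"
      using p f0[of x] A_pos by (simp add: ennreal_mult[symmetric] mult.assoc)
    also have "p * (2 * A * A) * (f x * ((2 * A * f x) powr (p - 1) / (p - 1))) = strong_type_const p * f x powr p"
    proof (cases "f x = 0")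
      case False
      then have "f x powr p = f x * f x powr (p - 1)"
        using f0[of x] powr_add[of "f x" 1 "p - 1"] by simp
      moreover have "(2 * A * f x) powr (p - 1) = (2 * A) powr (p - 1) * f x powr (p - 1)"
        using f0[of x] A_pos by (subst powr_mult[symmetric]) auto
      ultimately show ?thesis by (simp add: strong_type_const_def)
    qed simp
    finally show "(\<integral>\<^sup>+ t. ennreal p * ennreal (2 * A * A) * (ennreal (f x) * (ennreal (t powr (p - 1 - 1)) * indicator {0<..<2 * A * f x} t)) \<partial>lborel)
      = ennreal (strong_type_const p) * ennreal (f x powr p)"
      by (simp only: ennreal_mult''[OF powr_ge_zero])
  qed
  also have "\<dots> = ennreal (strong_type_const p) * (\<integral>\<^sup>+ x. ennreal (f x powr p) \<partial>\<nu>)"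
    by (rule nn_integral_cmult) measurable
  finally show ?thesis by (simp add: h_def)
qed

text \<open>
  A form of Hoelder's inequality on a ball, obtained from the pointwise estimate
  \<open>f z \<le> t + t powr (1 - p) * f z powr p\<close>, in which the first term dominates where \<open>f z \<le> t\<close> and the
  second one elsewhere.  The level \<open>t\<close> is the size of the \<open>p\<close>-mean, so the estimate loses only a
  constant.
\<close>

lemma integral_ball_le_of_powr:
  assumes f [measurable]: "f \<in> borel_measurable borel" and f0: "\<And>x. 0 \<le> f x" and p: "1 < p"
    and t: "0 < t" and r: "0 < r"
    and I: "(\<integral>\<^sup>+z\<in>ball x r. ennreal (f z powr p) \<partial>\<nu>) \<le> ennreal (V x r * t powr p)"
  shows "(\<integral>\<^sup>+z\<in>ball x r. ennreal (f z) \<partial>\<nu>) \<le> ennreal ((A + 1) * t * V x r)"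
proof -
  have V: "0 < V x r" using r by (rule V_pos)
  have le: "f z \<le> t + t powr (1 - p) * f z powr p" for z
  proof (cases "f z \<le> t")
    case False
    with t have fz: "0 < f z" by simp
    have "f z = f z powr (1 - p) * f z powr p" using fz powr_add[of "f z" "1 - p" p] by simp
    also have "\<dots> \<le> t powr (1 - p) * f z powr p"
      using False t p by (intro mult_right_mono powr_mono2') auto
    finally show ?thesis using t by simp
  qed (use t in \<open>simp add: add_increasing2\<close>)
  have "(\<integral>\<^sup>+z\<in>ball x r. ennreal (f z) \<partial>\<nu>)
    \<le> (\<integral>\<^sup>+ z. ennreal t * indicator (ball x r) z + ennreal (t powr (1 - p)) * (ennreal (f z powr p) * indicator (ball x r) z) \<partial>\<nu>)"
    using le t by (intro nn_integral_mono)
        (auto simp: indicator_def ennreal_plus[symmetric] ennreal_mult[symmetric] simp del: ennreal_plus intro!: ennreal_leI)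
  also have "\<dots> = ennreal t * emeasure \<nu> (ball x r) + ennreal (t powr (1 - p)) * (\<integral>\<^sup>+z\<in>ball x r. ennreal (f z powr p) \<partial>\<nu>)"
    by (subst nn_integral_add) (auto simp: nn_integral_cmult_indicator nn_integral_cmult)
  also have "\<dots> \<le> ennreal t * ennreal (A * V x r) + ennreal (t powr (1 - p)) * ennreal (V x r * t powr p)"
    by (intro add_mono mult_left_mono emeasure_ball_le r I) auto
  also have "\<dots> = ennreal (t * (A * V x r) + t powr (1 - p) * (V x r * t powr p))"
    using t V A_pos by (simp add: ennreal_mult[symmetric] ennreal_plus[symmetric] del: ennreal_plus)
  also have "t powr (1 - p) * (V x r * t powr p) = V x r * t"
    using t powr_add[of t "1 - p" p] by simp
  finally show ?thesis by (simp add: algebra_simps)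
qed

text \<open>
  The two summands belong to radii below and above the radius of the ball on which the maximal function
  is estimated.
\<close>

definition morrey_const :: "real \<Rightarrow> real \<Rightarrow> real" where
  "morrey_const p B = 2 powr p * (strong_type_const p * A * B powr p + ((A + 1) * B) powr p * A)"

lemma morrey_const_pos: "1 < p \<Longrightarrow> 0 < B \<Longrightarrow> 0 < morrey_const p B"
  using A_pos unfolding morrey_const_def strong_type_const_def
  by (auto intro!: mult_pos_pos add_pos_pos divide_pos_pos)

text \<open>
  Inside \<open>ball x0 r\<close> the averages over radii \<open>s \<le> r\<close> only involve \<open>f\<close> on the ball of radius \<open>2 * r\<close>,
  where the strong-type inequality applies to the restriction \<open>g\<close> of \<open>f\<close>.  An average over a
  radius \<open>s > r\<close> is at most a constant times \<open>D * \<phi> s\<close> by the hypothesis at radius \<open>s\<close>, and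
  \<open>\<phi> s \<le> B * \<phi> r\<close>; this gives the constant bound \<open>\<tau>\<close>.
\<close>

theorem morrey_bound:
  assumes f [measurable]: "f \<in> borel_measurable borel" and f0: "\<And>x. 0 \<le> f x" and p: "1 < p"
    and B: "0 < B" and D: "0 < D"
    and \<phi>0: "\<And>r. 0 < r \<Longrightarrow> 0 < \<phi> r"
    and \<phi>: "\<And>r s. 0 < r \<Longrightarrow> r \<le> s \<Longrightarrow> \<phi> s \<le> B * \<phi> r"
    and I: "\<And>x r. 0 < r \<Longrightarrow> (\<integral>\<^sup>+z\<in>ball x r. ennreal (f z powr p) \<partial>\<nu>) \<le> ennreal (V x r * (D * \<phi> r) powr p)"
    and r: "0 < r"
  shows "AE x in \<nu>. x \<in> ball x0 r \<longrightarrow> gauge_maximal rational_radii f x < \<infinity>"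
    and "(\<integral>\<^sup>+x\<in>ball x0 r. ennreal (enn2real (gauge_maximal rational_radii f x) powr p) \<partial>\<nu>)
       \<le> ennreal (morrey_const p B * V x0 r * (D * \<phi> r) powr p)"
proof -
  define S where "S = rational_radii"
  define S' where "S' = {s \<in> S. s \<le> r}"
  have S: "countable S" "S \<subseteq> {0<..}"
    unfolding S_def by (rule countable_rational_radii)+
  have S': "countable S'" "S' \<subseteq> {0<..r}"
    using S unfolding S'_def by (auto intro: countable_subset[OF _ S(1)])
  define g where "g z = f z * indicator (ball x0 (2 * r)) z" for z
  have g [measurable]: "g \<in> borel_measurable borel" unfolding g_def[abs_def] by measurable
  have g0: "g z \<ge> 0" for z using f0 by (simp add: g_def)
  note [measurable] = gauge_maximal_measurable[OF S(1) f] gauge_maximal_measurable[OF S'(1) g]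
  define \<tau> where "\<tau> = (A + 1) * B * (D * \<phi> r)"
  have \<tau>0: "\<tau> > 0" using A_pos B D \<phi>0 r by (simp add: \<tau>_def)
  have g_int: "(\<integral>\<^sup>+ z. ennreal (g z) \<partial>\<nu>) < \<infinity>"
  proof -
    have "(\<integral>\<^sup>+ z. ennreal (g z) \<partial>\<nu>) = (\<integral>\<^sup>+z\<in>ball x0 (2 * r). ennreal (f z) \<partial>\<nu>)"
      by (intro nn_integral_cong) (auto simp: g_def indicator_def)
    also have "\<dots> \<le> ennreal ((A + 1) * (D * \<phi> (2 * r)) * V x0 (2 * r))"
      using r D \<phi>0[of "2 * r"] by (intro integral_ball_le_of_powr[OF f f0 p] I) auto
    also have "\<dots> < \<infinity>" by simp
    finally show ?thesis .
  qed
  have fin: "AE x in \<nu>. gauge_maximal S' g x < \<infinity>"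
    by (rule gauge_maximal_finite_AE[OF S' g g_int])
  have loc: "gauge_maximal S f x \<le> gauge_maximal S' g x + ennreal \<tau>" if x: "x \<in> ball x0 r" for x
  proof (subst gauge_maximal_def, rule SUP_least)
    fix s assume s: "s \<in> S"
    then have s0: "0 < s" using S by auto
    show "gauge_average f s x \<le> gauge_maximal S' g x + ennreal \<tau>"
    proof (cases "s \<le> r")
      case True
      have "z \<in> ball x0 (2 * r)" if "z \<in> ball x s" for z
        using that x True dist_triangle[of x0 z x] by auto
      then have "gauge_average f s x = gauge_average g s x"
        unfolding gauge_average_def g_def by (intro arg_cong2[where f = "(/)"] refl nn_integral_cong) (auto simp: indicator_def)
      also have "\<dots> \<le> gauge_maximal S' g x"
        unfolding gauge_maximal_def using s True by (intro SUP_upper) (auto simp: S'_def)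
      finally show ?thesis by (simp add: add_increasing2)
    next
      case False
      have V: "0 < V x s" using s0 by (rule V_pos)
      have "gauge_average f s x \<le> ennreal ((A + 1) * (D * \<phi> s) * V x s) / ennreal (V x s)"
        unfolding gauge_average_def using s0 D \<phi>0 by (intro divide_right_mono_ennreal integral_ball_le_of_powr[OF f f0 p] I) auto
      also have "\<dots> = ennreal ((A + 1) * (D * \<phi> s))"
        using V A_pos D \<phi>0[OF s0] by (simp add: divide_ennreal)
      also have "\<dots> \<le> ennreal \<tau>"
        unfolding \<tau>_def using \<phi>[of r s] False r A_pos D B
        by (intro ennreal_leI) (simp add: mult.assoc mult_le_cancel_left_pos mult.left_commute[of B])
      finally show ?thesis by (simp add: add_increasing)
    qed
  qed
  show "AE x in \<nu>. x \<in> ball x0 r \<longrightarrow> gauge_maximal rational_radii f x < \<infinity>"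
    using fin
  proof eventually_elim
    case (elim x)
    show ?case
    proof
      assume "x \<in> ball x0 r"
      from loc[OF this] elim show "gauge_maximal rational_radii f x < \<infinity>"
        unfolding S_def by (auto simp: order.strict_trans1 le_less_trans)
    qed
  qed
  have "(\<integral>\<^sup>+x\<in>ball x0 r. ennreal (enn2real (gauge_maximal S f x) powr p) \<partial>\<nu>)
     \<le> (\<integral>\<^sup>+ x. ennreal (2 powr p) * (ennreal (enn2real (gauge_maximal S' g x) powr p) + ennreal (\<tau> powr p) * indicator (ball x0 r) x) \<partial>\<nu>)"
    using fin
  proof (intro nn_integral_mono_AE, eventually_elim)
    case (elim x)
    show ?case
    proof (cases "x \<in> ball x0 r")
      case True
      define a where "a = enn2real (gauge_maximal S' g x)"
      have a: "gauge_maximal S' g x = ennreal a" "a \<ge> 0" using elim by (auto simp: a_def)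
      have "gauge_maximal S f x \<le> ennreal (a + \<tau>)"
        using loc[OF True] a \<tau>0 by simp
      then have "enn2real (gauge_maximal S f x) \<le> a + \<tau>"
        using a \<tau>0 by (intro enn2real_leI) auto
      then have "enn2real (gauge_maximal S f x) powr p \<le> (a + \<tau>) powr p"
        using p by (intro powr_mono2) auto
      also have "\<dots> \<le> 2 powr p * (a powr p + \<tau> powr p)" using a \<tau>0 p by (intro powr_add_le) auto
      finally show ?thesis using True
        by (simp add: a_def[symmetric] ennreal_plus[symmetric] ennreal_mult[symmetric] ennreal_leI del: ennreal_plus)
    qed auto
  qed
  also have "\<dots> = ennreal (2 powr p) * ((\<integral>\<^sup>+ x. ennreal (enn2real (gauge_maximal S' g x) powr p) \<partial>\<nu>) + ennreal (\<tau> powr p) * emeasure \<nu> (ball x0 r))"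
    by (subst nn_integral_cmult, simp, subst nn_integral_add) (auto simp: nn_integral_cmult_indicator)
  also have "\<dots> \<le> ennreal (2 powr p) * (ennreal (strong_type_const p) * ennreal (A * V x0 r * (B * (D * \<phi> r)) powr p) + ennreal (\<tau> powr p) * ennreal (A * V x0 r))"
  proof (intro mult_left_mono add_mono emeasure_ball_le r)
    have "(\<integral>\<^sup>+ x. ennreal (enn2real (gauge_maximal S' g x) powr p) \<partial>\<nu>) \<le> ennreal (strong_type_const p) * (\<integral>\<^sup>+ x. ennreal (g x powr p) \<partial>\<nu>)"
      by (rule strong_type[OF S' g g0 p])
    also have "(\<integral>\<^sup>+ x. ennreal (g x powr p) \<partial>\<nu>) = (\<integral>\<^sup>+z\<in>ball x0 (2 * r). ennreal (f z powr p) \<partial>\<nu>)"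
      using p by (intro nn_integral_cong) (auto simp: g_def indicator_def)
    also have "\<dots> \<le> ennreal (V x0 (2 * r) * (D * \<phi> (2 * r)) powr p)"
      using r by (intro I) auto
    also have "\<dots> \<le> ennreal (A * V x0 r * (B * (D * \<phi> r)) powr p)"
    proof (rule ennreal_leI, rule mult_mono[OF _ powr_mono2])
      show "V x0 (2 * r) \<le> A * V x0 r"
        using V_mono[of "2 * r" "5 * r" x0] V_doubling[of r x0] r by simp
      show "D * \<phi> (2 * r) \<le> B * (D * \<phi> r)"
        using \<phi>[of r "2 * r"] r D by (simp add: mult.left_commute[of B])
    qed (use p D r A_pos B \<phi>0[of "2 * r"] V_pos[of r x0] in auto)
    finally show "(\<integral>\<^sup>+ x. ennreal (enn2real (gauge_maximal S' g x) powr p) \<partial>\<nu>) \<le> ennreal (strong_type_const p) * ennreal (A * V x0 r * (B * (D * \<phi> r)) powr p)"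
      by (simp add: mult_left_mono)
  qed auto
  also have "\<dots> = ennreal (2 powr p * (strong_type_const p * (A * V x0 r * (B * (D * \<phi> r)) powr p) + \<tau> powr p * (A * V x0 r)))"
    using p A_pos V_pos[OF r, of x0] by (simp add: ennreal_plus[symmetric] ennreal_mult[symmetric] strong_type_const_def del: ennreal_plus)
  also have "2 powr p * (strong_type_const p * (A * V x0 r * (B * (D * \<phi> r)) powr p) + \<tau> powr p * (A * V x0 r))
     = morrey_const p B * V x0 r * (D * \<phi> r) powr p"
  proof -
    have "(B * (D * \<phi> r)) powr p = B powr p * (D * \<phi> r) powr p"
      using B D \<phi>0[OF r] by (subst powr_mult) auto
    moreover have "\<tau> powr p = ((A + 1) * B) powr p * (D * \<phi> r) powr p"
      unfolding \<tau>_def using A_pos B D \<phi>0[OF r] by (subst powr_mult) auto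
    ultimately show ?thesis by (simp add: morrey_const_def algebra_simps)
  qed
  finally show "(\<integral>\<^sup>+x\<in>ball x0 r. ennreal (enn2real (gauge_maximal rational_radii f x) powr p) \<partial>\<nu>)
       \<le> ennreal (morrey_const p B * V x0 r * (D * \<phi> r) powr p)"
    by (simp add: S_def)
qed

end

section \<open>The Dunkl measure\<close>

definition dunkl_norm_const :: "real \<Rightarrow> real" where
  "dunkl_norm_const \<alpha> = 1 / (2 powr (\<alpha> + 1) * Gamma (\<alpha> + 1))"

definition dunkl_weight :: "real \<Rightarrow> real \<Rightarrow> real" where
  "dunkl_weight \<alpha> y = dunkl_norm_const \<alpha> * \<bar>y\<bar> powr (2 * \<alpha> + 1)"

text \<open>
  The Dunkl measure restricted to Borel sets.  Tonelli's and Fubini's theorems are applied to this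
  measure; the Dunkl measure itself is its completion.
\<close>

definition dunkl_borel :: "real \<Rightarrow> real measure" where
  "dunkl_borel \<alpha> = density lborel (\<lambda>y. ennreal (dunkl_weight \<alpha> y))"

lemma dunkl_norm_const_pos: "- 1 / 2 \<le> \<alpha> \<Longrightarrow> 0 < dunkl_norm_const \<alpha>"
  unfolding dunkl_norm_const_def by (auto intro!: divide_pos_pos mult_pos_pos Gamma_real_pos)

lemma dunkl_weight_measurable [measurable]: "dunkl_weight \<alpha> \<in> borel_measurable borel"
  unfolding dunkl_weight_def[abs_def] by measurable

lemma dunkl_weight_nonneg: "- 1 / 2 \<le> \<alpha> \<Longrightarrow> 0 \<le> dunkl_weight \<alpha> y"
  using dunkl_norm_const_pos[of \<alpha>] by (simp add: dunkl_weight_def)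

lemma dunkl_weight_pos: "- 1 / 2 \<le> \<alpha> \<Longrightarrow> y \<noteq> 0 \<Longrightarrow> 0 < dunkl_weight \<alpha> y"
  using dunkl_norm_const_pos[of \<alpha>] by (simp add: dunkl_weight_def)

lemma dunkl_weight_minus [simp]: "dunkl_weight \<alpha> (- y) = dunkl_weight \<alpha> y"
  by (simp add: dunkl_weight_def)

lemma sets_dunkl_borel [measurable_cong, simp]: "sets (dunkl_borel \<alpha>) = sets borel"
  by (simp add: dunkl_borel_def)

lemma space_dunkl_borel [simp]: "space (dunkl_borel \<alpha>) = UNIV"
  by (simp add: dunkl_borel_def)

lemma measurable_dunkl_borel [simp]: "measurable (dunkl_borel \<alpha>) N = measurable borel N"
  by (rule measurable_cong_sets) auto

lemma dunkl_measure_eq_completion: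
  assumes "- 1 / 2 \<le> \<alpha>"
  shows "dunkl_measure \<alpha> = completion (dunkl_borel \<alpha>)"
proof -
  have "AE x in lborel. 0 < ennreal (dunkl_weight \<alpha> x)"
    using AE_lborel_singleton[of 0] by eventually_elim (use assms in \<open>auto intro: dunkl_weight_pos\<close>)
  then have "completion (dunkl_borel \<alpha>) = density lebesgue (\<lambda>x. ennreal (dunkl_weight \<alpha> x))"
    unfolding dunkl_borel_def by (intro completion_density_eq) auto
  then show ?thesis
    by (simp add: dunkl_measure_def dunkl_weight_def dunkl_norm_const_def)
qed

lemma AE_dunkl_borel_iff:
  assumes "- 1 / 2 \<le> \<alpha>"
  shows "(AE y in dunkl_borel \<alpha>. P y) \<longleftrightarrow> (AE y in lborel. P y)"
proof -
  have "(AE y in dunkl_borel \<alpha>. P y) \<longleftrightarrow> (AE y in lborel. 0 < ennreal (dunkl_weight \<alpha> y) \<longrightarrow> P y)"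
    unfolding dunkl_borel_def by (subst AE_density) auto
  also have "\<dots> \<longleftrightarrow> (AE y in lborel. P y)"
  proof
    assume "AE y in lborel. 0 < ennreal (dunkl_weight \<alpha> y) \<longrightarrow> P y"
    with AE_lborel_singleton[of 0] show "AE y in lborel. P y"
      by eventually_elim (use assms dunkl_weight_pos in auto)
  qed auto
  finally show ?thesis .
qed

lemma sigma_finite_dunkl_borel: "sigma_finite_measure (dunkl_borel \<alpha>)"
  unfolding dunkl_borel_def
  by (subst sigma_finite_measure.sigma_finite_iff_density_finite) (auto intro: sigma_finite_lborel)

section \<open>The angular measure of the translation formula\<close>

text \<open>
  The extra factor \<open>cos \<theta>\<close> makes the integrand an exact derivative for every \<open>\<alpha>\<close>.  Near 0 the cosine
  is comparable with 1, so this evaluates integrals of \<open>sin \<theta> powr (2 * \<alpha>)\<close> over small angles up to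
  constants, for either sign of \<open>\<alpha>\<close>.
\<close>

lemma nn_integral_sin_cos:
  assumes "- 1 / 2 < \<alpha>" "0 \<le> t" "t \<le> pi / 2"
  shows "(\<integral>\<^sup>+\<theta>\<in>{0..t}. ennreal (sin \<theta> powr (2 * \<alpha>) * cos \<theta>) \<partial>lborel)
       = ennreal (sin t powr (2 * \<alpha> + 1) / (2 * \<alpha> + 1))"
proof -
  have a: "0 < 2 * \<alpha> + 1" using assms by simp
  have s: "0 \<le> sin \<theta>" "0 \<le> cos \<theta>" if "\<theta> \<in> {0..t}" for \<theta>
    using that assms by (auto intro!: sin_ge_zero cos_ge_zero)
  have "((\<lambda>\<theta>. sin \<theta> powr (2 * \<alpha>) * cos \<theta>) has_integral
      (sin t powr (2 * \<alpha> + 1) / (2 * \<alpha> + 1) - sin 0 powr (2 * \<alpha> + 1) / (2 * \<alpha> + 1))) {0..t}"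
  proof (rule fundamental_theorem_of_calculus_interior)
    show "continuous_on {0..t} (\<lambda>\<theta>. sin \<theta> powr (2 * \<alpha> + 1) / (2 * \<alpha> + 1))"
      using s a by (intro continuous_intros continuous_on_powr') auto
    fix \<theta> assume \<theta>: "\<theta> \<in> {0<..<t}"
    then have "0 < sin \<theta>" using assms by (intro sin_gt_zero) auto
    then have "((\<lambda>\<theta>. sin \<theta> powr (2 * \<alpha> + 1) / (2 * \<alpha> + 1)) has_real_derivative sin \<theta> powr (2 * \<alpha>) * cos \<theta>) (at \<theta>)"
      using a by (auto intro!: derivative_eq_intros DERIV_cdivide[THEN DERIV_cong] DERIV_fun_powr)
    then show "((\<lambda>\<theta>. sin \<theta> powr (2 * \<alpha> + 1) / (2 * \<alpha> + 1)) has_vector_derivative sin \<theta> powr (2 * \<alpha>) * cos \<theta>) (at \<theta>)"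
      by (simp add: has_real_derivative_iff_has_vector_derivative)
  qed (use assms in auto)
  then have "((\<lambda>\<theta>. sin \<theta> powr (2 * \<alpha>) * cos \<theta> * indicator {0..t} \<theta>) has_integral (sin t powr (2 * \<alpha> + 1) / (2 * \<alpha> + 1))) UNIV"
    by (subst (asm) has_integral_restrict_UNIV[symmetric])
       (auto elim!: has_integral_eq[rotated] simp: indicator_def)
  then have "(\<integral>\<^sup>+ \<theta>. ennreal (sin \<theta> powr (2 * \<alpha>) * cos \<theta> * indicator {0..t} \<theta>) \<partial>lborel) = ennreal (sin t powr (2 * \<alpha> + 1) / (2 * \<alpha> + 1))"
    using s by (intro nn_integral_has_integral_lborel) (auto simp: indicator_def)
  also have "(\<integral>\<^sup>+ \<theta>. ennreal (sin \<theta> powr (2 * \<alpha>) * cos \<theta> * indicator {0..t} \<theta>) \<partial>lborel)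
      = (\<integral>\<^sup>+\<theta>\<in>{0..t}. ennreal (sin \<theta> powr (2 * \<alpha>) * cos \<theta>) \<partial>lborel)"
    by (intro nn_integral_cong) (auto simp: indicator_def)
  finally show ?thesis .
qed

lemma nn_integral_sin_reflect:
  assumes [measurable]: "F \<in> borel_measurable borel"
  shows "(\<integral>\<^sup>+\<theta>\<in>{0..pi}. F \<theta> \<partial>lborel) = (\<integral>\<^sup>+\<theta>\<in>{0..pi}. F (pi - \<theta>) \<partial>lborel)"
  by (subst nn_integral_real_affine[where c = "-1" and t = pi]) (auto intro!: nn_integral_cong simp: indicator_def)

text \<open>
  For negative \<open>\<alpha>\<close> the integrand is singular at both ends.  By symmetry only the left half matters:
  where \<open>cos \<theta> \<ge> 1 / 2\<close> the exact derivative of the previous lemma dominates, and elsewhere the sine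
  is bounded below.
\<close>

lemma nn_integral_sin_powr_finite:
  assumes "- 1 / 2 < \<alpha>"
  shows "(\<integral>\<^sup>+\<theta>\<in>{0..pi}. ennreal (sin \<theta> powr (2 * \<alpha>)) \<partial>lborel) < \<infinity>"
proof -
  define K where "K = max 1 ((3 / 4) powr \<alpha>)"
  have K: "K \<ge> 0" by (simp add: K_def)
  have bd: "sin \<theta> powr (2 * \<alpha>) \<le> 2 * (sin \<theta> powr (2 * \<alpha>) * cos \<theta>) + K" if "\<theta> \<in> {0..pi/2}" for \<theta>
  proof -
    have s: "0 \<le> sin \<theta>" "0 \<le> cos \<theta>" using that by (auto intro!: sin_ge_zero cos_ge_zero)
    show ?thesis
    proof (cases "cos \<theta> \<ge> 1 / 2")
      case True
      then have "sin \<theta> powr (2 * \<alpha>) * 1 \<le> sin \<theta> powr (2 * \<alpha>) * (2 * cos \<theta>)"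
        by (intro mult_left_mono) auto
      with K show ?thesis by simp
    next
      case False
      then have "(cos \<theta>)\<^sup>2 \<le> (1 / 2)\<^sup>2" using s by (intro power_mono) auto
      then have q: "(sin \<theta>)\<^sup>2 \<ge> 3 / 4" using sin_squared_eq[of \<theta>] by (simp add: power2_eq_square)
      then have s0: "0 < sin \<theta>" using s by (cases "sin \<theta> = 0") auto
      have "sin \<theta> powr (2 * \<alpha>) = (sin \<theta> powr 2) powr \<alpha>" by (simp add: powr_powr)
      also have "sin \<theta> powr 2 = (sin \<theta>)\<^sup>2" using s0 by simp
      also have "((sin \<theta>)\<^sup>2) powr \<alpha> \<le> K"
      proof (cases "\<alpha> \<ge> 0")
        case True
        have "((sin \<theta>)\<^sup>2) powr \<alpha> \<le> 1 powr \<alpha>" using True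
          by (intro powr_mono2) (auto simp: abs_square_le_1)
        then show ?thesis by (simp add: K_def)
      next
        case False
        have "((sin \<theta>)\<^sup>2) powr \<alpha> \<le> (3 / 4) powr \<alpha>" using False q by (intro powr_mono2') auto
        then show ?thesis by (simp add: K_def)
      qed
      finally show ?thesis using s by (simp add: add_increasing)
    qed
  qed
  have half: "(\<integral>\<^sup>+\<theta>\<in>{0..pi/2}. ennreal (sin \<theta> powr (2 * \<alpha>)) \<partial>lborel) < \<infinity>"
  proof -
    have "(\<integral>\<^sup>+\<theta>\<in>{0..pi/2}. ennreal (sin \<theta> powr (2 * \<alpha>)) \<partial>lborel)
      \<le> (\<integral>\<^sup>+ \<theta>. 2 * (ennreal (sin \<theta> powr (2 * \<alpha>) * cos \<theta>) * indicator {0..pi/2} \<theta>) + ennreal K * indicator {0..pi/2} \<theta> \<partial>lborel)"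
    proof (intro nn_integral_mono)
      fix \<theta>
      have "ennreal (sin \<theta> powr (2 * \<alpha>)) \<le> 2 * ennreal (sin \<theta> powr (2 * \<alpha>) * cos \<theta>) + ennreal K" if "\<theta> \<in> {0..pi/2}"
      proof -
        have "0 \<le> cos \<theta>" using that by (intro cos_ge_zero) auto
        then have "2 * ennreal (sin \<theta> powr (2 * \<alpha>) * cos \<theta>) + ennreal K = ennreal (2 * (sin \<theta> powr (2 * \<alpha>) * cos \<theta>) + K)"
          using K by (simp add: ennreal_plus ennreal_mult'')
        with bd[OF that] show ?thesis by (metis ennreal_leI)
      qed
      then show "ennreal (sin \<theta> powr (2 * \<alpha>)) * indicator {0..pi/2} \<theta> \<le> 2 * (ennreal (sin \<theta> powr (2 * \<alpha>) * cos \<theta>) * indicator {0..pi/2} \<theta>) + ennreal K * indicator {0..pi/2} \<theta>"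
        by (auto simp: indicator_def)
    qed
    also have "\<dots> = 2 * ennreal (sin (pi/2) powr (2 * \<alpha> + 1) / (2 * \<alpha> + 1)) + ennreal K * emeasure lborel {0..pi/2}"
      using assms by (subst nn_integral_add, simp, simp)
       (subst nn_integral_cmult, simp, subst nn_integral_sin_cos, auto simp: nn_integral_cmult_indicator)
    also have "\<dots> < \<infinity>"
      by (auto simp: ennreal_mult_less_top)
    finally show ?thesis .
  qed
  have "(\<integral>\<^sup>+\<theta>\<in>{0..pi}. ennreal (sin \<theta> powr (2 * \<alpha>)) \<partial>lborel)
     \<le> (\<integral>\<^sup>+ \<theta>. ennreal (sin \<theta> powr (2 * \<alpha>)) * indicator {0..pi/2} \<theta> + ennreal (sin \<theta> powr (2 * \<alpha>)) * indicator {pi/2..pi} \<theta> \<partial>lborel)"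
    by (intro nn_integral_mono) (auto simp: indicator_def)
  also have "\<dots> = (\<integral>\<^sup>+\<theta>\<in>{0..pi/2}. ennreal (sin \<theta> powr (2 * \<alpha>)) \<partial>lborel) + (\<integral>\<^sup>+\<theta>\<in>{pi/2..pi}. ennreal (sin \<theta> powr (2 * \<alpha>)) \<partial>lborel)"
    by (subst nn_integral_add) auto
  also have "(\<integral>\<^sup>+\<theta>\<in>{pi/2..pi}. ennreal (sin \<theta> powr (2 * \<alpha>)) \<partial>lborel)
     = (\<integral>\<^sup>+\<theta>\<in>{0..pi/2}. ennreal (sin \<theta> powr (2 * \<alpha>)) \<partial>lborel)"
    by (subst nn_integral_real_affine[where c = "-1" and t = pi]) (auto intro!: nn_integral_cong simp: indicator_def)
  finally show ?thesis by (rule le_less_trans) (use half in auto)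
qed

text \<open>
  The probability measure on angles behind the translation formula.
\<close>

definition angle_measure :: "real \<Rightarrow> real measure" where
  "angle_measure \<alpha> = density lborel (\<lambda>\<theta>. ennreal (c_dunkl \<alpha> * (sin \<theta> powr (2 * \<alpha>) * indicator {0..pi} \<theta>)))"

lemma sets_angle_measure [measurable_cong, simp]: "sets (angle_measure \<alpha>) = sets borel"
  by (simp add: angle_measure_def)

lemma space_angle_measure [simp]: "space (angle_measure \<alpha>) = UNIV"
  by (simp add: angle_measure_def)

lemma measurable_angle_measure [simp]: "measurable (angle_measure \<alpha>) N = measurable borel N"
  by (rule measurable_cong_sets) auto

lemma c_dunkl_normalization:
  assumes "- 1 / 2 < \<alpha>"
  shows "0 < c_dunkl \<alpha>"
    and "(\<integral>\<^sup>+\<theta>\<in>{0..pi}. ennreal (sin \<theta> powr (2 * \<alpha>)) \<partial>lborel) = ennreal (1 / c_dunkl \<alpha>)"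
proof -
  define J where "J = (\<integral>\<^sup>+\<theta>\<in>{0..pi}. ennreal (sin \<theta> powr (2 * \<alpha>)) \<partial>lborel)"
  have J_eq: "J = (\<integral>\<^sup>+ \<theta>. ennreal (indicator {0..pi} \<theta> * sin \<theta> powr (2 * \<alpha>)) \<partial>lborel)"
    unfolding J_def by (intro nn_integral_cong) (auto simp: indicator_def)
  have "(LINT \<theta>:{0..pi}|lebesgue. sin \<theta> powr (2 * \<alpha>)) = (LINT \<theta>|lborel. indicator {0..pi} \<theta> * sin \<theta> powr (2 * \<alpha>))"
    unfolding set_lebesgue_integral_def by (subst integral_completion) auto
  also have "\<dots> = enn2real J"
    unfolding J_eq by (intro integral_eq_nn_integral) auto
  finally have c: "c_dunkl \<alpha> = inverse (enn2real J)" by (simp add: c_dunkl_def)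
  have "ennreal (1 / (2 * \<alpha> + 1)) = (\<integral>\<^sup>+\<theta>\<in>{0..pi/2}. ennreal (sin \<theta> powr (2 * \<alpha>) * cos \<theta>) \<partial>lborel)"
    using assms by (subst nn_integral_sin_cos) auto
  also have "\<dots> \<le> J" unfolding J_def
    by (intro nn_integral_mono) (auto simp: indicator_def intro!: ennreal_leI mult_left_le)
  finally have J1: "ennreal (1 / (2 * \<alpha> + 1)) \<le> J" .
  have J2: "J < \<infinity>" unfolding J_def by (rule nn_integral_sin_powr_finite) fact
  then obtain j where j: "J = ennreal j" "j \<ge> 0" by (cases J) auto
  with J1 have "1 / (2 * \<alpha> + 1) \<le> j" by simp
  moreover have "0 < 1 / (2 * \<alpha> + 1)" using assms by simp
  ultimately have "0 < j" by linarith
  then show "0 < c_dunkl \<alpha>" using j by (simp add: c)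
  show "(\<integral>\<^sup>+\<theta>\<in>{0..pi}. ennreal (sin \<theta> powr (2 * \<alpha>)) \<partial>lborel) = ennreal (1 / c_dunkl \<alpha>)"
    using j \<open>0 < j\<close> by (simp add: c J_def[symmetric] inverse_eq_divide)
qed

lemma nn_integral_angle:
  assumes "- 1 / 2 < \<alpha>" and [measurable]: "F \<in> borel_measurable borel"
  shows "(\<integral>\<^sup>+ \<theta>. F \<theta> \<partial>angle_measure \<alpha>) = ennreal (c_dunkl \<alpha>) * (\<integral>\<^sup>+\<theta>\<in>{0..pi}. ennreal (sin \<theta> powr (2 * \<alpha>)) * F \<theta> \<partial>lborel)"
  unfolding angle_measure_def using c_dunkl_normalization(1)[OF assms(1)]
  by (subst nn_integral_density, simp, simp, subst nn_integral_cmult[symmetric])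
     (auto intro!: nn_integral_cong simp: indicator_def ennreal_mult ac_simps)

lemma emeasure_angle_UNIV:
  assumes "- 1 / 2 < \<alpha>"
  shows "emeasure (angle_measure \<alpha>) UNIV = 1"
proof -
  have "emeasure (angle_measure \<alpha>) UNIV = (\<integral>\<^sup>+ \<theta>. 1 \<partial>angle_measure \<alpha>)"
    by (subst nn_integral_const) auto
  also have "\<dots> = 1"
    using c_dunkl_normalization[OF assms] by (subst nn_integral_angle[OF assms]) (auto simp: ennreal_mult[symmetric])
  finally show ?thesis .
qed

lemma angle_measure_reflect:
  assumes "- 1 / 2 < \<alpha>"
  shows "distr (angle_measure \<alpha>) borel (\<lambda>\<theta>. pi - \<theta>) = angle_measure \<alpha>"
proof (rule measure_eqI)
  fix B assume "B \<in> sets (distr (angle_measure \<alpha>) borel (\<lambda>\<theta>. pi - \<theta>))"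
  then have B [measurable]: "B \<in> sets borel" by simp
  have "emeasure (distr (angle_measure \<alpha>) borel (\<lambda>\<theta>. pi - \<theta>)) B = (\<integral>\<^sup>+ \<theta>. indicator B (pi - \<theta>) \<partial>angle_measure \<alpha>)"
    by (subst nn_integral_indicator[symmetric], simp, subst nn_integral_distr) auto
  also have "\<dots> = ennreal (c_dunkl \<alpha>) * (\<integral>\<^sup>+ \<theta>. ennreal (sin \<theta> powr (2 * \<alpha>)) * indicator B (pi - \<theta>) * indicator {0..pi} \<theta> \<partial>lborel)"
    by (rule nn_integral_angle[OF assms]) measurable
  also have "\<dots> = ennreal (c_dunkl \<alpha>) * (\<integral>\<^sup>+ \<theta>. ennreal (sin \<theta> powr (2 * \<alpha>)) * indicator B \<theta> * indicator {0..pi} \<theta> \<partial>lborel)"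
    by (subst nn_integral_sin_reflect) auto
  also have "\<dots> = (\<integral>\<^sup>+ \<theta>. indicator B \<theta> \<partial>angle_measure \<alpha>)"
    by (rule nn_integral_angle[OF assms, symmetric]) measurable
  finally show "emeasure (distr (angle_measure \<alpha>) borel (\<lambda>\<theta>. pi - \<theta>)) B = emeasure (angle_measure \<alpha>) B"
    by simp
qed simp

section \<open>The kernel of the Dunkl translation\<close>

text \<open>
  Sixteen times the squared area of a triangle with sides \<open>\<bar>x\<bar>\<close>, \<open>\<bar>y\<bar>\<close>, \<open>\<bar>z\<bar>\<close> (Heron's formula).  It is
  positive exactly if such a nondegenerate triangle exists, and it is symmetric in its three arguments.
\<close>

definition area_form :: "real \<Rightarrow> real \<Rightarrow> real \<Rightarrow> real" where
  "area_form x y z = 4 * x\<^sup>2 * y\<^sup>2 - (x\<^sup>2 + y\<^sup>2 - z\<^sup>2)\<^sup>2"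

lemma area_form_abs_factor:
  "area_form x y z = (z\<^sup>2 - (\<bar>x\<bar> - \<bar>y\<bar>)\<^sup>2) * ((\<bar>x\<bar> + \<bar>y\<bar>)\<^sup>2 - z\<^sup>2)"
proof -
  have "(\<bar>x\<bar> - \<bar>y\<bar>)\<^sup>2 = x\<^sup>2 + y\<^sup>2 - 2 * \<bar>x * y\<bar>" "(\<bar>x\<bar> + \<bar>y\<bar>)\<^sup>2 = x\<^sup>2 + y\<^sup>2 + 2 * \<bar>x * y\<bar>"
    by (auto simp: power2_eq_square algebra_simps abs_mult)
  moreover have "4 * x\<^sup>2 * y\<^sup>2 = (2 * \<bar>x * y\<bar>)\<^sup>2" by (simp add: power_mult_distrib)
  ultimately show ?thesis by (simp add: area_form_def power2_eq_square algebra_simps)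
qed

lemma area_form_swap: "area_form (- x) z y = area_form x y z"
  by (simp add: area_form_def power2_eq_square algebra_simps)

lemma area_form_abs [simp]: "area_form x y \<bar>z\<bar> = area_form x y z"
  by (simp add: area_form_def)

lemma area_form_abs2: "area_form \<bar>x\<bar> \<bar>y\<bar> z = area_form x y z"
  by (simp add: area_form_def)

lemma area_form_posD:
  assumes "0 < area_form x y z"
  shows "x \<noteq> 0" "y \<noteq> 0" "z \<noteq> 0" "\<bar>z\<bar> < \<bar>x\<bar> + \<bar>y\<bar>" "\<bar>\<bar>x\<bar> - \<bar>y\<bar>\<bar> < \<bar>z\<bar>"
proof -
  show "x \<noteq> 0" "y \<noteq> 0" using assms by (auto simp: area_form_def not_less)
  have "(\<bar>x\<bar> - \<bar>y\<bar>)\<^sup>2 \<le> (\<bar>x\<bar> + \<bar>y\<bar>)\<^sup>2" by (rule power2_le_iff_abs_le[THEN iffD2]) auto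
  then have "(\<bar>x\<bar> - \<bar>y\<bar>)\<^sup>2 < z\<^sup>2 \<and> z\<^sup>2 < (\<bar>x\<bar> + \<bar>y\<bar>)\<^sup>2"
    using assms unfolding area_form_abs_factor zero_less_mult_iff by linarith
  then have "\<bar>z\<bar>\<^sup>2 < (\<bar>x\<bar> + \<bar>y\<bar>)\<^sup>2" "\<bar>\<bar>x\<bar> - \<bar>y\<bar>\<bar>\<^sup>2 < \<bar>z\<bar>\<^sup>2"
    by simp_all
  then show "\<bar>z\<bar> < \<bar>x\<bar> + \<bar>y\<bar>" "\<bar>\<bar>x\<bar> - \<bar>y\<bar>\<bar> < \<bar>z\<bar>"
    by (metis abs_ge_zero abs_triangle_ineq2_sym add_nonneg_nonneg power2_less_imp_less)+
  then show "z \<noteq> 0" by auto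
qed

text \<open>
  The Lebesgue density of \<open>dunkl_dist x y \<theta>\<close> for a random angle \<open>\<theta>\<close>: by the law of cosines the sine is
  determined by the area of the triangle with sides \<open>\<bar>x\<bar>\<close>, \<open>\<bar>y\<bar>\<close>, \<open>z\<close>.
\<close>

definition distance_density :: "real \<Rightarrow> real \<Rightarrow> real \<Rightarrow> real \<Rightarrow> real" where
  "distance_density \<alpha> x y z = (if 0 < z \<and> 0 < area_form x y z
     then c_dunkl \<alpha> * (area_form x y z / (4 * x\<^sup>2 * y\<^sup>2)) powr (\<alpha> - 1 / 2) * (z / \<bar>x * y\<bar>) else 0)"

lemma area_form_measurable [measurable]:
  assumes [measurable]: "a \<in> borel_measurable M" "b \<in> borel_measurable M" "c \<in> borel_measurable M"
  shows "(\<lambda>v. area_form (a v) (b v) (c v)) \<in> borel_measurable M"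
  unfolding area_form_def by measurable

lemma distance_density_measurable [measurable]: "distance_density \<alpha> x y \<in> borel_measurable borel"
  unfolding distance_density_def[abs_def] by measurable

lemma distance_density_nonneg: "- 1 / 2 < \<alpha> \<Longrightarrow> 0 \<le> distance_density \<alpha> x y z"
  using c_dunkl_normalization(1)[of \<alpha>] by (simp add: distance_density_def)

lemma dunkl_dist_measurable [measurable]:
  assumes [measurable]: "a \<in> borel_measurable M" "b \<in> borel_measurable M" "c \<in> borel_measurable M"
  shows "(\<lambda>v. dunkl_dist (a v) (b v) (c v)) \<in> borel_measurable M"
  unfolding dunkl_dist_def by measurable

lemma dunkl_dist_sq: "(dunkl_dist x y \<theta>)\<^sup>2 = x\<^sup>2 + y\<^sup>2 - 2 * x * y * cos \<theta>"
proof -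
  have "\<bar>2 * x * y * cos \<theta>\<bar> \<le> \<bar>2 * x * y\<bar>" using mult_left_mono[of "\<bar>cos \<theta>\<bar>" 1 "\<bar>2 * x * y\<bar>"] by (simp add: abs_mult)
  moreover have "\<bar>2 * x * y\<bar> \<le> x\<^sup>2 + y\<^sup>2"
    using zero_le_power2[of "x - y"] zero_le_power2[of "x + y"] by (simp add: power2_eq_square algebra_simps)
  ultimately show ?thesis by (simp add: dunkl_dist_def)
qed

lemma dunkl_dist_nonneg: "0 \<le> dunkl_dist x y \<theta>"
  by (smt (verit) dunkl_dist_def real_sqrt_ge_0_iff dunkl_dist_sq zero_le_power2)

lemma area_form_dunkl_dist: "area_form x y (dunkl_dist x y \<theta>) = 4 * x\<^sup>2 * y\<^sup>2 * (sin \<theta>)\<^sup>2"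
  unfolding area_form_def dunkl_dist_sq sin_squared_eq
  by (simp add: power2_eq_square algebra_simps)

text \<open>
  This is the change of variables from the angle to the opposite side \<open>z\<close> of the triangle, with
  \<open>z * dz = x * y * sin \<theta> * d\<theta>\<close>.  The condition \<open>x \<noteq> y\<close> keeps \<open>z\<close> away from 0, where the square root in
  \<open>dunkl_dist\<close> is not differentiable.
\<close>

lemma distr_dunkl_dist_pos:
  assumes \<alpha>: "- 1 / 2 < \<alpha>" and xy: "0 < x" "0 < y" "x \<noteq> y"
  shows "distr (angle_measure \<alpha>) borel (dunkl_dist x y) = density lborel (\<lambda>z. ennreal (distance_density \<alpha> x y z))"
proof (rule measure_eqI)
  fix B assume "B \<in> sets (distr (angle_measure \<alpha>) borel (dunkl_dist x y))"
  then have B [measurable]: "B \<in> sets borel" by simp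
  define \<rho> where "\<rho> = dunkl_dist x y"
  have [measurable]: "\<rho> \<in> borel_measurable borel" unfolding \<rho>_def by measurable
  define \<rho>' where "\<rho>' \<theta> = x * y * sin \<theta> / \<rho> \<theta>" for \<theta>
  have pos: "0 < \<rho> \<theta>" for \<theta>
  proof -
    have "0 < (x - y)\<^sup>2" using xy by simp
    also have "\<dots> \<le> (\<rho> \<theta>)\<^sup>2"
      using xy mult_left_mono[of "cos \<theta>" 1 "2 * x * y"] unfolding \<rho>_def dunkl_dist_sq
      by (simp add: power2_eq_square algebra_simps)
    finally show ?thesis using dunkl_dist_nonneg[of x y \<theta>] by (auto simp: \<rho>_def less_le)
  qed
  have sq: "(\<rho> \<theta>)\<^sup>2 = x\<^sup>2 + y\<^sup>2 - 2 * x * y * cos \<theta>" for \<theta>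
    by (simp add: \<rho>_def dunkl_dist_sq)
  have der: "(\<rho> has_real_derivative \<rho>' \<theta>) (at \<theta>)" for \<theta>
  proof -
    have "0 < x\<^sup>2 + y\<^sup>2 - 2 * x * y * cos \<theta>" using pos[of \<theta>] sq[of \<theta>] by (metis zero_less_power)
    then have "((\<lambda>\<theta>. sqrt (x\<^sup>2 + y\<^sup>2 - 2 * x * y * cos \<theta>)) has_real_derivative
        (2 * x * y * sin \<theta>) * (inverse (sqrt (x\<^sup>2 + y\<^sup>2 - 2 * x * y * cos \<theta>)) / 2)) (at \<theta>)"
      by (auto intro!: derivative_eq_intros)
    then show ?thesis
      by (simp add: \<rho>_def \<rho>'_def dunkl_dist_def[abs_def] field_simps)
  qed
  have cont: "continuous_on {0..pi} \<rho>'"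
  proof -
    have "continuous_on {0..pi} \<rho>"
      by (rule DERIV_continuous_on, rule has_field_derivative_at_within, rule der)
    moreover have "\<forall>\<theta>\<in>{0..pi}. \<rho> \<theta> \<noteq> 0" using pos by (metis less_irrefl)
    ultimately show ?thesis unfolding \<rho>'_def by (intro continuous_intros)
  qed
  have \<rho>0: "\<rho> 0 = \<bar>x - y\<bar>" unfolding \<rho>_def dunkl_dist_def
    by (simp add: power2_eq_square algebra_simps flip: real_sqrt_abs)
  have \<rho>pi: "\<rho> pi = x + y"
  proof -
    have "\<rho> pi = sqrt ((x + y)\<^sup>2)" unfolding \<rho>_def dunkl_dist_def by (simp add: power2_eq_square algebra_simps)
    then show ?thesis using xy by simp
  qed
  define D where "D = distance_density \<alpha> x y"
  have [measurable]: "D \<in> borel_measurable borel" unfolding D_def by measurable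
  have D0: "D z \<ge> 0" for z unfolding D_def by (rule distance_density_nonneg[OF \<alpha>])
  have "emeasure (distr (angle_measure \<alpha>) borel \<rho>) B = (\<integral>\<^sup>+ \<theta>. indicator B (\<rho> \<theta>) \<partial>angle_measure \<alpha>)"
    by (subst nn_integral_indicator[symmetric], simp, subst nn_integral_distr) auto
  also have "\<dots> = (\<integral>\<^sup>+ \<theta>. ennreal (c_dunkl \<alpha> * (sin \<theta> powr (2 * \<alpha>) * indicator {0..pi} \<theta>)) * indicator B (\<rho> \<theta>) \<partial>lborel)"
    unfolding angle_measure_def by (rule nn_integral_density) auto
  also have "\<dots> = (\<integral>\<^sup>+ \<theta>. ennreal (D (\<rho> \<theta>) * indicator B (\<rho> \<theta>) * \<rho>' \<theta> * indicator {0..pi} \<theta>) \<partial>lborel)"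
  proof (intro nn_integral_cong)
    fix \<theta> :: real
    have "c_dunkl \<alpha> * sin \<theta> powr (2 * \<alpha>) = D (\<rho> \<theta>) * \<rho>' \<theta>" if "\<theta> \<in> {0..pi}"
    proof (cases "sin \<theta> = 0")
      case False
      then have s: "0 < sin \<theta>" using that sin_ge_zero[of \<theta>] by auto
      have T: "area_form x y (\<rho> \<theta>) = 4 * x\<^sup>2 * y\<^sup>2 * (sin \<theta>)\<^sup>2"
        by (simp add: \<rho>_def area_form_dunkl_dist)
      have "D (\<rho> \<theta>) = c_dunkl \<alpha> * ((sin \<theta>)\<^sup>2) powr (\<alpha> - 1 / 2) * (\<rho> \<theta> / \<bar>x * y\<bar>)"
        using s xy pos[of \<theta>] by (simp add: D_def distance_density_def T)
      also have "((sin \<theta>)\<^sup>2) powr (\<alpha> - 1 / 2) = sin \<theta> powr (2 * \<alpha> - 1)"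
        using s by (simp add: powr_powr algebra_simps flip: powr_numeral)
      also have "\<dots> = sin \<theta> powr (2 * \<alpha>) / sin \<theta>" using s by (simp add: powr_diff)
      finally show ?thesis using s xy pos[of \<theta>] by (simp add: \<rho>'_def)
    qed (auto simp: \<rho>'_def)
    then show "ennreal (c_dunkl \<alpha> * (sin \<theta> powr (2 * \<alpha>) * indicator {0..pi} \<theta>)) * indicator B (\<rho> \<theta>)
       = ennreal (D (\<rho> \<theta>) * indicator B (\<rho> \<theta>) * \<rho>' \<theta> * indicator {0..pi} \<theta>)"
      by (auto simp: indicator_def)
  qed
  also have "\<dots> = (\<integral>\<^sup>+ z. ennreal (D z * indicator B z * indicator {\<rho> 0..\<rho> pi} z) \<partial>lborel)"
  proof (rule nn_integral_substitution[symmetric, OF _ der cont])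
    show "set_borel_measurable borel {\<rho> 0..\<rho> pi} (\<lambda>z. D z * indicator B z)"
      unfolding set_borel_measurable_def by measurable
    show "0 \<le> \<rho>' \<theta>" if "\<theta> \<in> {0..pi}" for \<theta>
      using that xy pos[of \<theta>] sin_ge_zero[of \<theta>] by (simp add: \<rho>'_def)
  qed auto
  also have "\<dots> = (\<integral>\<^sup>+ z. ennreal (D z) * indicator B z \<partial>lborel)"
  proof (intro nn_integral_cong)
    fix z
    have "D z = 0" if "z \<notin> {\<rho> 0..\<rho> pi}"
      using that area_form_posD(4,5)[of x y z] xy unfolding D_def distance_density_def \<rho>0 \<rho>pi by auto
    then show "ennreal (D z * indicator B z * indicator {\<rho> 0..\<rho> pi} z) = ennreal (D z) * indicator B z"
      by (auto simp: indicator_def)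
  qed
  also have "\<dots> = emeasure (density lborel (\<lambda>z. ennreal (D z))) B"
    by (subst emeasure_density) auto
  finally show "emeasure (distr (angle_measure \<alpha>) borel (dunkl_dist x y)) B
     = emeasure (density lborel (\<lambda>z. ennreal (distance_density \<alpha> x y z))) B"
    by (simp add: \<rho>_def D_def)
qed simp

text \<open>
  Changing the sign of one of \<open>x\<close> and \<open>y\<close> amounts to reflecting the angle, which preserves the
  angular measure.
\<close>

lemma distr_dunkl_dist:
  assumes \<alpha>: "- 1 / 2 < \<alpha>" and xy: "x \<noteq> 0" "y \<noteq> 0" "\<bar>x\<bar> \<noteq> \<bar>y\<bar>"
  shows "distr (angle_measure \<alpha>) borel (dunkl_dist x y) = density lborel (\<lambda>z. ennreal (distance_density \<alpha> x y z))"
proof -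
  have D: "distance_density \<alpha> \<bar>x\<bar> \<bar>y\<bar> = distance_density \<alpha> x y"
    unfolding distance_density_def[abs_def] by (simp only: abs_mult abs_idempotent power2_abs area_form_abs2)
  have "distr (angle_measure \<alpha>) borel (dunkl_dist x y) = distr (angle_measure \<alpha>) borel (dunkl_dist \<bar>x\<bar> \<bar>y\<bar>)"
  proof (cases "0 < x * y")
    case True
    then have "dunkl_dist x y = dunkl_dist \<bar>x\<bar> \<bar>y\<bar>"
      by (auto simp: dunkl_dist_def[abs_def] zero_less_mult_iff)
    then show ?thesis by simp
  next
    case False
    with xy have "x * y < 0" by (simp add: not_less le_less)
    then have eq: "dunkl_dist \<bar>x\<bar> \<bar>y\<bar> = dunkl_dist x y \<circ> (\<lambda>\<theta>. pi - \<theta>)"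
      by (auto simp: dunkl_dist_def[abs_def] fun_eq_iff mult_less_0_iff)
    have "distr (angle_measure \<alpha>) borel (dunkl_dist \<bar>x\<bar> \<bar>y\<bar>) = distr (distr (angle_measure \<alpha>) borel (\<lambda>\<theta>. pi - \<theta>)) borel (dunkl_dist x y)"
      unfolding eq by (subst distr_distr) auto
    then show ?thesis unfolding angle_measure_reflect[OF \<alpha>] by simp
  qed
  then show ?thesis using distr_dunkl_dist_pos[OF \<alpha>, of "\<bar>x\<bar>" "\<bar>y\<bar>"] xy D by simp
qed

text \<open>
  The kernel of the product formula of the rank-one Dunkl transform (Roesler), relative to the Dunkl
  measure.  The cubic factor divided by \<open>2 * x * y * z\<close> is the factor
  \<open>(1 + (x + y) / z) * (1 - cos \<theta>)\<close> in the definition of the translation.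
\<close>

definition roesler_kernel :: "real \<Rightarrow> real \<Rightarrow> real \<Rightarrow> real \<Rightarrow> real" where
  "roesler_kernel \<alpha> x y z = (if 0 < area_form x y z
     then c_dunkl \<alpha> / (2 powr (2 * \<alpha> + 1) * dunkl_norm_const \<alpha>) * sgn (x * y * z)
       * ((x + y + z) * (z - x + y) * (z + x - y)) * area_form x y z powr (\<alpha> - 1 / 2)
       / \<bar>x * y * z\<bar> powr (2 * \<alpha> + 1)
     else 0)"

text \<open>
  This symmetry is the reason why translation by \<open>- x\<close> is adjoint to translation by \<open>x\<close>: the area
  form is symmetric, and the sign and the cubic factor both change sign.
\<close>

lemma roesler_kernel_swap: "roesler_kernel \<alpha> (- x) z y = roesler_kernel \<alpha> x y z"
proof -
  have s: "sgn (- x * z * y) = - sgn (x * y * z)" by (simp add: sgn_mult)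
  have m: "\<bar>- x * z * y\<bar> = \<bar>x * y * z\<bar>" by (simp add: abs_mult)
  have "(- x + z + y) * (y - - x + z) * (y + - x - z) = - ((x + y + z) * (z - x + y) * (z + x - y))"
    by (simp add: algebra_simps)
  then show ?thesis unfolding roesler_kernel_def area_form_swap s m by simp
qed

lemma roesler_kernel_measurable [measurable]:
  assumes [measurable]: "a \<in> borel_measurable M" "b \<in> borel_measurable M" "c \<in> borel_measurable M"
  shows "(\<lambda>v. roesler_kernel \<alpha> (a v) (b v) (c v)) \<in> borel_measurable M"
  unfolding roesler_kernel_def by measurable

text \<open>
  With \<open>z = dunkl_dist x y \<theta>\<close> the second factor is \<open>1 - cos \<theta>\<close>.  A negative \<open>z\<close> encodes the terms of
  the translation formula in which the function is evaluated at the negative distance.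
\<close>

definition dunkl_factor :: "real \<Rightarrow> real \<Rightarrow> real \<Rightarrow> real" where
  "dunkl_factor x y z = (1 + (x + y) / z) * (1 - (x\<^sup>2 + y\<^sup>2 - z\<^sup>2) / (2 * x * y))"

lemma weighted_roesler_kernel:
  assumes \<alpha>: "- 1 / 2 < \<alpha>"
  shows "dunkl_weight \<alpha> z * roesler_kernel \<alpha> x y z = 1 / 2 * dunkl_factor x y z * distance_density \<alpha> x y \<bar>z\<bar>"
proof (cases "0 < area_form x y z")
  case True
  note nz = area_form_posD[OF True]
  define T where "T = area_form x y z powr (\<alpha> - 1 / 2)"
  define P where "P = (x + y + z) * (z - x + y) * (z + x - y)"
  define w where "w = \<bar>x * y\<bar>"
  have w: "w > 0" using nz by (simp add: w_def)
  define Q where "Q = 2 powr (2 * \<alpha> + 1) * w powr (2 * \<alpha> + 1)"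
  have Q: "Q > 0" using w by (simp add: Q_def)
  have pw: "\<bar>x * y * z\<bar> powr (2 * \<alpha> + 1) = w powr (2 * \<alpha> + 1) * \<bar>z\<bar> powr (2 * \<alpha> + 1)"
    unfolding w_def abs_mult[of "x * y" z] by (rule powr_mult)
  have "dunkl_weight \<alpha> z * roesler_kernel \<alpha> x y z = c_dunkl \<alpha> * sgn (x * y * z) * P * T / Q"
    using True nz dunkl_norm_const_pos[of \<alpha>] \<alpha>
    by (simp add: dunkl_weight_def roesler_kernel_def pw Q_def P_def[symmetric] T_def[symmetric])
  moreover have "distance_density \<alpha> x y \<bar>z\<bar> = c_dunkl \<alpha> * (4 * w\<^sup>2 * T / Q) * (\<bar>z\<bar> / w)"
  proof -
    have "(area_form x y z / (4 * x\<^sup>2 * y\<^sup>2)) powr (\<alpha> - 1 / 2) = T / ((2 * w)\<^sup>2) powr (\<alpha> - 1 / 2)"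
      using True by (simp add: T_def powr_divide w_def power_mult_distrib mult.assoc)
    also have "((2 * w)\<^sup>2) powr (\<alpha> - 1 / 2) = ((2 * w) powr 2) powr (\<alpha> - 1 / 2)"
      using w by (subst powr_numeral) auto
    also have "\<dots> = (2 * w) powr (2 * \<alpha> - 1)"
      by (simp add: powr_powr algebra_simps)
    also have "\<dots> = (2 * w) powr (2 * \<alpha> + 1 - 2)" by simp
    also have "\<dots> = (2 * w) powr (2 * \<alpha> + 1) / (2 * w)\<^sup>2"
      using w by (subst powr_diff) simp
    also have "(2 * w) powr (2 * \<alpha> + 1) = Q" using w by (simp add: Q_def powr_mult)
    finally show ?thesis using True nz by (simp add: distance_density_def w_def power2_eq_square mult_ac)
  qed
  moreover have "dunkl_factor x y z = P / (2 * x * y * z)"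
    using nz by (simp add: dunkl_factor_def P_def field_simps power2_eq_square)
  moreover have "\<bar>z\<bar> * w = sgn (x * y * z) * (x * y * z)"
  proof -
    have "\<bar>z\<bar> * w = \<bar>x * y * z\<bar>" by (simp add: w_def abs_mult)
    then show ?thesis by (metis abs_sgn mult.commute)
  qed
  ultimately show ?thesis
  proof -
    assume 1: "dunkl_weight \<alpha> z * roesler_kernel \<alpha> x y z = c_dunkl \<alpha> * sgn (x * y * z) * P * T / Q"
      and 2: "distance_density \<alpha> x y \<bar>z\<bar> = c_dunkl \<alpha> * (4 * w\<^sup>2 * T / Q) * (\<bar>z\<bar> / w)"
      and 3: "dunkl_factor x y z = P / (2 * x * y * z)"
      and 4: "\<bar>z\<bar> * w = sgn (x * y * z) * (x * y * z)"
    have "1 / 2 * dunkl_factor x y z * distance_density \<alpha> x y \<bar>z\<bar> = P / (x * y * z) * c_dunkl \<alpha> * T / Q * (\<bar>z\<bar> * w)"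
      unfolding 2 3 using w by (simp add: power2_eq_square mult_ac)
    also have "\<dots> = c_dunkl \<alpha> * sgn (x * y * z) * P * T / Q"
      unfolding 4 using nz by simp
    finally show ?thesis using 1 by simp
  qed
qed (simp add: roesler_kernel_def distance_density_def)

text \<open>
  The quotient \<open>(x + y) / z\<close> is unbounded, but it is large only if \<open>x\<close> and \<open>y\<close> have the same sign and
  the cosine \<open>u\<close> is close to 1, and then \<open>1 - u\<close> compensates: \<open>((x + y) * (1 - u))\<^sup>2\<close> is at most
  \<open>5 * z\<^sup>2\<close>.
\<close>

lemma dunkl_factor_bound:
  assumes T: "0 < area_form x y z"
  shows "\<bar>dunkl_factor x y z\<bar> \<le> 5"
proof -
  note nz = area_form_posD[OF T]
  define u where "u = (x\<^sup>2 + y\<^sup>2 - z\<^sup>2) / (2 * x * y)"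
  have z2: "z\<^sup>2 = x\<^sup>2 + y\<^sup>2 - 2 * x * y * u" using nz by (simp add: u_def)
  have "x\<^sup>2 + y\<^sup>2 - z\<^sup>2 = 2 * x * y * u" using nz by (simp add: u_def)
  then have "area_form x y z = 4 * x\<^sup>2 * y\<^sup>2 * (1 - u\<^sup>2)"
    by (simp add: area_form_def power_mult_distrib right_diff_distrib)
  moreover have "0 < 4 * x\<^sup>2 * y\<^sup>2" using nz by simp
  ultimately have "0 < 1 - u\<^sup>2" using T zero_less_mult_pos by metis
  then have "u\<^sup>2 < 1" by simp
  then have u: "\<bar>u\<bar> < 1" by (simp add: abs_square_less_1)
  have "((x + y) * (1 - u))\<^sup>2 = z\<^sup>2 * (1 - u)\<^sup>2 + (z\<^sup>2 - (x - y)\<^sup>2) * (1 - u\<^sup>2)"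
    unfolding z2 by (simp add: power2_eq_square algebra_simps)
  also have "\<dots> \<le> z\<^sup>2 * 4 + z\<^sup>2 * 1"
  proof (rule add_mono)
    have "(1 - u)\<^sup>2 \<le> 2\<^sup>2" using u by (intro power_mono) auto
    then show "z\<^sup>2 * (1 - u)\<^sup>2 \<le> z\<^sup>2 * 4" by (intro mult_left_mono) auto
    have "(z\<^sup>2 - (x - y)\<^sup>2) * (1 - u\<^sup>2) \<le> z\<^sup>2 * (1 - u\<^sup>2)"
      using \<open>u\<^sup>2 < 1\<close> by (intro mult_right_mono) auto
    also have "\<dots> \<le> z\<^sup>2 * 1" by (intro mult_left_mono) auto
    finally show "(z\<^sup>2 - (x - y)\<^sup>2) * (1 - u\<^sup>2) \<le> z\<^sup>2 * 1" .
  qed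
  also have "\<dots> \<le> (3 * z)\<^sup>2" by (simp add: power_mult_distrib)
  finally have "\<bar>(x + y) * (1 - u)\<bar> \<le> \<bar>3 * z\<bar>" by (simp only: abs_le_square_iff)
  then have "\<bar>(x + y) * (1 - u)\<bar> \<le> 3 * \<bar>z\<bar>" by (simp only: abs_mult abs_numeral)
  then have "\<bar>(x + y) * (1 - u) / z\<bar> \<le> 3" using nz by (simp add: field_simps)
  moreover have "dunkl_factor x y z = (1 - u) + (x + y) * (1 - u) / z"
    unfolding dunkl_factor_def u_def[symmetric] by (simp add: algebra_simps add_divide_distrib diff_divide_distrib)
  ultimately show ?thesis using u by linarith
qed

lemma nn_integral_distance_density:
  assumes \<alpha>: "- 1 / 2 < \<alpha>" and xy: "x \<noteq> 0" "y \<noteq> 0" "\<bar>x\<bar> \<noteq> \<bar>y\<bar>"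
  shows "(\<integral>\<^sup>+ z. ennreal (distance_density \<alpha> x y z) \<partial>lborel) = 1"
proof -
  have "(\<integral>\<^sup>+ z. ennreal (distance_density \<alpha> x y z) \<partial>lborel) = emeasure (density lborel (\<lambda>z. ennreal (distance_density \<alpha> x y z))) UNIV"
    by (subst emeasure_density) auto
  also have "\<dots> = emeasure (angle_measure \<alpha>) UNIV"
    unfolding distr_dunkl_dist[OF assms, symmetric] by (subst emeasure_distr) auto
  finally show ?thesis using emeasure_angle_UNIV[OF \<alpha>] by simp
qed

text \<open>
  Up to the bounded factor, the weighted kernel is the density of the distance, extended evenly to
  negative \<open>z\<close>, and this density has total mass 1.  The uniform bound is what Fubini's theorem needs.
\<close>

lemma nn_integral_abs_roesler_kernel_le:
  assumes \<alpha>: "- 1 / 2 < \<alpha>" and xy: "x \<noteq> 0" "y \<noteq> 0" "\<bar>x\<bar> \<noteq> \<bar>y\<bar>"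
  shows "(\<integral>\<^sup>+ z. ennreal \<bar>roesler_kernel \<alpha> x y z\<bar> \<partial>dunkl_borel \<alpha>) \<le> 5"
proof -
  let ?D = "distance_density \<alpha> x y"
  have D0: "0 \<le> ?D z" for z by (rule distance_density_nonneg[OF \<alpha>])
  have w0: "0 \<le> dunkl_weight \<alpha> z" for z using \<alpha> by (intro dunkl_weight_nonneg) auto
  have "(\<integral>\<^sup>+ z. ennreal \<bar>roesler_kernel \<alpha> x y z\<bar> \<partial>dunkl_borel \<alpha>)
      = (\<integral>\<^sup>+ z. ennreal \<bar>dunkl_weight \<alpha> z * roesler_kernel \<alpha> x y z\<bar> \<partial>lborel)"
    unfolding dunkl_borel_def using w0
    by (subst nn_integral_density) (auto simp: abs_mult ennreal_mult)
  also have "\<dots> \<le> (\<integral>\<^sup>+ z. ennreal (5 / 2) * ennreal (?D z) + ennreal (5 / 2) * ennreal (?D (- z)) \<partial>lborel)"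
  proof (intro nn_integral_mono)
    fix z
    have "\<bar>dunkl_weight \<alpha> z * roesler_kernel \<alpha> x y z\<bar> \<le> 5 / 2 * ?D \<bar>z\<bar>"
    proof (cases "0 < area_form x y z")
      case True
      then show ?thesis unfolding weighted_roesler_kernel[OF \<alpha>] abs_mult
        using dunkl_factor_bound[OF True] D0[of "\<bar>z\<bar>"] by (auto intro!: mult_right_mono)
    qed (simp add: roesler_kernel_def distance_density_def)
    also have "\<dots> \<le> 5 / 2 * ?D z + 5 / 2 * ?D (- z)"
      using D0[of z] D0[of "-z"] by (auto simp: abs_if)
    finally show "ennreal \<bar>dunkl_weight \<alpha> z * roesler_kernel \<alpha> x y z\<bar> \<le> ennreal (5 / 2) * ennreal (?D z) + ennreal (5 / 2) * ennreal (?D (- z))"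
      using D0 by (simp add: ennreal_mult'[symmetric] ennreal_plus[symmetric] ennreal_leI del: ennreal_plus)
  qed
  also have "\<dots> = ennreal (5 / 2) * (\<integral>\<^sup>+ z. ennreal (?D z) \<partial>lborel) + ennreal (5 / 2) * (\<integral>\<^sup>+ z. ennreal (?D (- z)) \<partial>lborel)"
    by (subst nn_integral_add) (auto simp: nn_integral_cmult)
  also have "(\<integral>\<^sup>+ z. ennreal (?D (- z)) \<partial>lborel) = (\<integral>\<^sup>+ z. ennreal (?D z) \<partial>lborel)"
    by (subst (2) nn_integral_real_affine[where c = "-1" and t = 0]) auto
  also have "ennreal (5 / 2) * (\<integral>\<^sup>+ z. ennreal (?D z) \<partial>lborel) + ennreal (5 / 2) * (\<integral>\<^sup>+ z. ennreal (?D z) \<partial>lborel) = 5"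
    unfolding nn_integral_distance_density[OF assms] by (simp flip: ennreal_plus)
  finally show ?thesis .
qed

section \<open>Dunkl translations as integral operators\<close>

lemma borel_measurable_completion_AE_cong:
  fixes f f' :: "'a \<Rightarrow> 'b::topological_space"
  assumes ae: "AE x in M. f x = f' x" and f': "f' \<in> borel_measurable M"
  shows "f \<in> borel_measurable (completion M)"
proof (rule measurableI)
  fix B :: "'b set" assume B: "B \<in> sets borel"
  have "AE x in completion M. x \<in> f' -` B \<inter> space (completion M) \<longleftrightarrow> x \<in> f -` B \<inter> space (completion M)"
    using AE_completion[OF ae] by eventually_elim auto
  moreover have "f' -` B \<inter> space (completion M) \<in> sets (completion M)"
    using measurable_sets[OF measurable_completion[OF f'] B] .
  ultimately show "f -` B \<inter> space (completion M) \<in> sets (completion M)"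
    by (rule completion.in_sets_AE) auto
qed simp

lemma integral_completion_AE_cong:
  fixes f f' :: "'a \<Rightarrow> 'b::{banach, second_countable_topology}"
  assumes ae: "AE x in M. f x = f' x" and f': "f' \<in> borel_measurable M"
  shows "integral\<^sup>L (completion M) f = integral\<^sup>L M f'"
    and "integrable (completion M) f \<longleftrightarrow> integrable M f'"
proof -
  note m = borel_measurable_completion_AE_cong[OF ae f'] measurable_completion[OF f']
  show "integral\<^sup>L (completion M) f = integral\<^sup>L M f'"
    using integral_cong_AE[OF m AE_completion[OF ae]] integral_completion[OF f'] by simp
  show "integrable (completion M) f \<longleftrightarrow> integrable M f'"
    using integrable_cong_AE[OF m AE_completion[OF ae]] integrable_completion[OF f'] by simp
qed

lemma AE_lborel_uminus:
  assumes "AE z in lborel. P (z :: real)"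
  shows "AE z in lborel. P (- z)"
proof (rule AE_distrD[where M' = borel and f = uminus])
  show "AE z in distr lborel borel uminus. P z" unfolding lborel_distr_uminus by (rule assms)
qed simp

definition dunkl_integrand :: "(real \<Rightarrow> real) \<Rightarrow> real \<Rightarrow> real \<Rightarrow> real \<Rightarrow> real" where
  "dunkl_integrand g x y \<theta> = (g (dunkl_dist x y \<theta>) + g (- dunkl_dist x y \<theta>)
             + (x + y) / dunkl_dist x y \<theta>
                 * (g (dunkl_dist x y \<theta>) - g (- dunkl_dist x y \<theta>))) * (1 - cos \<theta>)"

lemma dunkl_integrand_measurable [measurable]:
  assumes [measurable]: "g \<in> borel_measurable borel"
    "a \<in> borel_measurable M" "b \<in> borel_measurable M" "c \<in> borel_measurable M"
  shows "(\<lambda>v. dunkl_integrand g (a v) (b v) (c v)) \<in> borel_measurable M"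
  unfolding dunkl_integrand_def by measurable

lemma dunkl_translation_eq_integral_lebesgue:
  assumes "- 1 / 2 < \<alpha>"
  shows "dunkl_translation \<alpha> x g y = c_dunkl \<alpha> / 2 *
    (LINT \<theta>|lebesgue. indicator {0..pi} \<theta> * (dunkl_integrand g x y \<theta> * sin \<theta> powr (2 * \<alpha>)))"
  using assms by (simp add: dunkl_translation_def dunkl_integrand_def set_lebesgue_integral_def)

lemma integral_angle:
  fixes F :: "real \<Rightarrow> real"
  assumes "- 1 / 2 < \<alpha>" and [measurable]: "F \<in> borel_measurable borel"
  shows "(LINT \<theta>|angle_measure \<alpha>. F \<theta>) = c_dunkl \<alpha> * (LINT \<theta>|lborel. indicator {0..pi} \<theta> * (F \<theta> * sin \<theta> powr (2 * \<alpha>)))"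
  unfolding angle_measure_def using c_dunkl_normalization(1)[OF assms(1)]
  by (subst integral_density) (auto simp: mult_ac simp flip: integral_mult_right_zero intro!: Bochner_Integration.integral_cong)

lemma dunkl_translation_eq_integral_angle:
  assumes \<alpha>: "- 1 / 2 < \<alpha>" and [measurable]: "g \<in> borel_measurable borel"
  shows "dunkl_translation \<alpha> x g y = 1 / 2 * (LINT \<theta>|angle_measure \<alpha>. dunkl_integrand g x y \<theta>)"
  unfolding dunkl_translation_eq_integral_lebesgue[OF \<alpha>]
  by (subst integral_angle[OF \<alpha>], simp) (subst integral_completion, auto)

lemma AE_angle_measure:
  assumes \<alpha>: "- 1 / 2 < \<alpha>" and "AE \<theta> in angle_measure \<alpha>. P \<theta>"
  shows "AE \<theta> in lborel. \<theta> \<in> {0..pi} \<longrightarrow> P \<theta>"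
proof -
  have "AE \<theta> in lborel. 0 < ennreal (c_dunkl \<alpha> * (sin \<theta> powr (2 * \<alpha>) * indicator {0..pi} \<theta>)) \<longrightarrow> P \<theta>"
    using assms(2) unfolding angle_measure_def by (subst (asm) AE_density) auto
  with AE_lborel_singleton[of 0] AE_lborel_singleton[of pi] show ?thesis
  proof eventually_elim
    case (elim \<theta>)
    then show ?case using sin_gt_zero[of \<theta>] c_dunkl_normalization(1)[OF \<alpha>] by (auto simp: less_le)
  qed
qed

text \<open>
  Changing \<open>g\<close> on a null set changes its values at the distances only for a null set of angles, since
  the distance has a density.  Thus a Borel representative may be used inside the translation.
\<close>

lemma dunkl_translation_cong_AE:
  assumes \<alpha>: "- 1 / 2 < \<alpha>" and xy: "x \<noteq> 0" "y \<noteq> 0" "\<bar>x\<bar> \<noteq> \<bar>y\<bar>"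
    and ae: "AE z in lborel. g z = g' z" and [measurable]: "g' \<in> borel_measurable borel"
  shows "dunkl_translation \<alpha> x g y = dunkl_translation \<alpha> x g' y"
proof -
  have "AE z in lborel. g z = g' z \<and> g (- z) = g' (- z)"
    using ae AE_lborel_uminus[OF ae] by eventually_elim auto
  then have "AE z in density lborel (\<lambda>z. ennreal (distance_density \<alpha> x y z)). g z = g' z \<and> g (- z) = g' (- z)"
    by (subst AE_density) auto
  then have "AE \<theta> in angle_measure \<alpha>. g (dunkl_dist x y \<theta>) = g' (dunkl_dist x y \<theta>) \<and> g (- dunkl_dist x y \<theta>) = g' (- dunkl_dist x y \<theta>)"
    unfolding distr_dunkl_dist[OF \<alpha> xy, symmetric] by (rule AE_distrD[rotated]) measurable
  then have "AE \<theta> in lborel. indicator {0..pi} \<theta> * (dunkl_integrand g x y \<theta> * sin \<theta> powr (2 * \<alpha>))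
      = indicator {0..pi} \<theta> * (dunkl_integrand g' x y \<theta> * sin \<theta> powr (2 * \<alpha>))"
    by (rule AE_angle_measure[OF \<alpha>, THEN AE_mp]) (auto intro!: AE_I2 simp: dunkl_integrand_def indicator_def)
  from integral_completion_AE_cong(1)[OF this] show ?thesis
    unfolding dunkl_translation_eq_integral_lebesgue[OF \<alpha>] by (simp add: integral_completion)
qed

text \<open>
  Roesler's product formula.  The terms of the translation formula with positive and with negative
  distance become the two halves of an integral over the whole line.
\<close>

lemma dunkl_translation_eq_kernel_integral:
  assumes \<alpha>: "- 1 / 2 < \<alpha>" and xy: "x \<noteq> 0" "y \<noteq> 0" "\<bar>x\<bar> \<noteq> \<bar>y\<bar>"
    and g [measurable]: "g \<in> borel_measurable borel"
    and int: "integrable (dunkl_borel \<alpha>) (\<lambda>z. g z * roesler_kernel \<alpha> x y z)"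
  shows "dunkl_translation \<alpha> x g y = (LINT z|dunkl_borel \<alpha>. g z * roesler_kernel \<alpha> x y z)"
proof -
  let ?D = "distance_density \<alpha> x y"
  have D0: "0 \<le> ?D z" for z by (rule distance_density_nonneg[OF \<alpha>])
  have w0: "0 \<le> dunkl_weight \<alpha> z" for z using \<alpha> by (intro dunkl_weight_nonneg) auto
  define H where "H z = (g z + g (- z) + (x + y) / z * (g z - g (- z))) * (1 - (x\<^sup>2 + y\<^sup>2 - z\<^sup>2) / (2 * x * y))" for z
  have [measurable]: "H \<in> borel_measurable borel" unfolding H_def[abs_def] by measurable
  have H: "dunkl_integrand g x y \<theta> = H (dunkl_dist x y \<theta>)" for \<theta>
  proof -
    have "cos \<theta> = (x\<^sup>2 + y\<^sup>2 - (dunkl_dist x y \<theta>)\<^sup>2) / (2 * x * y)"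
      using xy by (simp add: dunkl_dist_sq)
    then show ?thesis by (simp add: dunkl_integrand_def H_def)
  qed
  define G where "G z = dunkl_weight \<alpha> z * (g z * roesler_kernel \<alpha> x y z)" for z
  have [measurable]: "G \<in> borel_measurable borel" unfolding G_def[abs_def] by measurable
  have G_int: "integrable lborel G"
    using int w0 unfolding dunkl_borel_def G_def by (subst (asm) integrable_density) auto
  have int_p: "integrable lborel (\<lambda>z. indicator {0<..} z * G z)"
    using integrable_mult_indicator[of "{0<..}", OF _ G_int] by simp
  have int_m: "integrable lborel (\<lambda>z. indicator {..<0} z * G z)"
    using integrable_mult_indicator[of "{..<0}", OF _ G_int] by simp
  have int_m': "integrable lborel (\<lambda>z. indicator {0<..} z * G (- z))"
  proof -
    have "integrable lborel (\<lambda>z. indicator {..<0} (0 + (-1) * z) * G (0 + (-1) * z))"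
      by (rule lborel_integrable_real_affine[OF int_m]) simp
    also have "(\<lambda>z. indicator {..<0} (0 + (-1) * z) * G (0 + (-1) * z)) = (\<lambda>z. indicator {0<..} z * G (- z))"
      by (auto simp: indicator_def fun_eq_iff)
    finally show ?thesis .
  qed
  have G_eq: "G z = 1 / 2 * (g z * dunkl_factor x y z * ?D \<bar>z\<bar>)" for z
    using weighted_roesler_kernel[OF \<alpha>, of z x y] by (simp add: G_def algebra_simps)
  have key: "indicator {0<..} z * G z + indicator {0<..} z * G (- z) = 1 / 2 * (?D z * H z)" for z
  proof (cases "0 < z")
    case True
    define e t where "e = 1 - (x\<^sup>2 + y\<^sup>2 - z\<^sup>2) / (2 * x * y)" and "t = (x + y) / z"
    have fac: "dunkl_factor x y z = (1 + t) * e" "dunkl_factor x y (- z) = (1 - t) * e"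
      by (simp_all add: dunkl_factor_def e_def t_def)
    have "g z * dunkl_factor x y z + g (- z) * dunkl_factor x y (- z) = (g z + g (- z) + t * (g z - g (- z))) * e"
      unfolding fac by (simp add: algebra_simps)
    also have "\<dots> = H z" by (simp add: H_def e_def t_def)
    finally have "g z * dunkl_factor x y z + g (- z) * dunkl_factor x y (- z) = H z" .
    moreover have "indicator {0<..} z * G z + indicator {0<..} z * G (- z)
        = 1 / 2 * (?D z * (g z * dunkl_factor x y z + g (- z) * dunkl_factor x y (- z)))"
      using True by (simp add: G_eq algebra_simps)
    ultimately show ?thesis by simp
  qed (auto simp: distance_density_def)
  have "(LINT z|dunkl_borel \<alpha>. g z * roesler_kernel \<alpha> x y z) = (LINT z|lborel. G z)"
    unfolding dunkl_borel_def G_def using w0 by (subst integral_density) auto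
  also have "\<dots> = (LINT z|lborel. indicator {0<..} z * G z + indicator {..<0} z * G z)"
    using AE_lborel_singleton[of 0]
    by (intro integral_cong_AE, simp, simp, eventually_elim) (auto simp: indicator_def)
  also have "\<dots> = (LINT z|lborel. indicator {0<..} z * G z) + (LINT z|lborel. indicator {..<0} z * G z)"
    by (rule Bochner_Integration.integral_add[OF int_p int_m])
  also have "(LINT z|lborel. indicator {..<0} z * G z) = (LINT z|lborel. indicator {0<..} z * G (- z))"
    by (subst lborel_integral_real_affine[where c = "-1" and t = 0])
       (auto simp: indicator_def intro!: Bochner_Integration.integral_cong)
  also have "(LINT z|lborel. indicator {0<..} z * G z) + (LINT z|lborel. indicator {0<..} z * G (- z))
      = (LINT z|lborel. indicator {0<..} z * G z + indicator {0<..} z * G (- z))"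
    by (rule Bochner_Integration.integral_add[OF int_p int_m', symmetric])
  also have "\<dots> = 1 / 2 * (LINT z|lborel. ?D z * H z)"
    unfolding key by simp
  also have "(LINT z|lborel. ?D z * H z) = (LINT z|density lborel (\<lambda>z. ennreal (?D z)). H z)"
    using D0 by (subst integral_density) auto
  also have "\<dots> = (LINT \<theta>|angle_measure \<alpha>. H (dunkl_dist x y \<theta>))"
    unfolding distr_dunkl_dist[OF \<alpha> xy, symmetric] by (rule integral_distr) measurable
  finally show ?thesis
    unfolding dunkl_translation_eq_integral_angle[OF \<alpha> g] H by simp
qed

text \<open>
  The Morrey norm and the maximal function integrate a translate over \<open>(-r, r)\<close>; this is the weight
  obtained when the translation is moved to the indicator of that interval.
\<close>

definition interval_kernel :: "real \<Rightarrow> real \<Rightarrow> real \<Rightarrow> real \<Rightarrow> real" where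
  "interval_kernel \<alpha> r x z = dunkl_translation \<alpha> (- x) (indicator {-r<..<r}) z"

lemma sigma_finite_angle_measure: "- 1 / 2 < \<alpha> \<Longrightarrow> sigma_finite_measure (angle_measure \<alpha>)"
  by (intro finite_measure.axioms finite_measureI) (simp add: emeasure_angle_UNIV)

lemma interval_kernel_measurable [measurable]:
  assumes [measurable]: "a \<in> borel_measurable M" "b \<in> borel_measurable M"
    and \<alpha>: "- 1 / 2 \<le> \<alpha>"
  shows "(\<lambda>v. interval_kernel \<alpha> r (a v) (b v)) \<in> borel_measurable M"
proof (cases "\<alpha> = - 1 / 2")
  case True
  have ind: "indicator {-r<..<r} (- a v + b v) = (if - r < b v - a v \<and> b v - a v < r then 1 else 0 :: real)" for v
    by (auto simp: indicator_def)
  show ?thesis using True unfolding interval_kernel_def dunkl_translation_def by (simp add: ind)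
next
  case False
  with \<alpha> have \<alpha>': "- 1 / 2 < \<alpha>" by simp
  interpret sigma_finite_measure "angle_measure \<alpha>" by (rule sigma_finite_angle_measure[OF \<alpha>'])
  show ?thesis
    unfolding interval_kernel_def by (subst dunkl_translation_eq_integral_angle[OF \<alpha>']) auto
qed

lemma AE_dunkl_borel_ne:
  assumes "- 1 / 2 \<le> \<alpha>"
  shows "AE z in dunkl_borel \<alpha>. z \<noteq> 0 \<and> \<bar>x\<bar> \<noteq> \<bar>z\<bar>"
  unfolding AE_dunkl_borel_iff[OF assms]
  using AE_lborel_singleton[of 0] AE_lborel_singleton[of x] AE_lborel_singleton[of "- x"]
  by eventually_elim (auto simp: abs_if split: if_splits)

lemma interval_kernel_eq_kernel_integral:
  assumes \<alpha>: "- 1 / 2 < \<alpha>" and xz: "x \<noteq> 0" "z \<noteq> 0" "\<bar>x\<bar> \<noteq> \<bar>z\<bar>"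
  shows "interval_kernel \<alpha> r x z = (LINT y|dunkl_borel \<alpha>. indicator {-r<..<r} y * roesler_kernel \<alpha> x y z)"
proof -
  have "(\<integral>\<^sup>+ y. ennreal (norm (indicator {-r<..<r} y * roesler_kernel \<alpha> (- x) z y)) \<partial>dunkl_borel \<alpha>)
     \<le> (\<integral>\<^sup>+ y. ennreal \<bar>roesler_kernel \<alpha> (- x) z y\<bar> \<partial>dunkl_borel \<alpha>)"
    by (intro nn_integral_mono) (auto simp: indicator_def)
  also have "\<dots> \<le> 5"
    using xz by (intro nn_integral_abs_roesler_kernel_le[OF \<alpha>]) auto
  also have "5 < (\<infinity> :: ennreal)" by simp
  finally have "integrable (dunkl_borel \<alpha>) (\<lambda>y. indicator {-r<..<r} y * roesler_kernel \<alpha> (- x) z y)"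
    by (intro integrableI_bounded) auto
  then show ?thesis
    unfolding interval_kernel_def using xz
    by (subst dunkl_translation_eq_kernel_integral[OF \<alpha>]) (auto simp: roesler_kernel_swap)
qed

text \<open>
  For \<open>y\<close> in \<open>(-r, r)\<close> the kernel vanishes unless \<open>\<bar>z\<bar> < \<bar>x\<bar> + r\<close>, so the local integrability of \<open>g\<close>
  and the uniform bound on the kernel make the double integral absolutely convergent.  Fubini's theorem
  and the symmetry of the kernel give the claim.
\<close>

lemma dunkl_adjoint_borel:
  assumes \<alpha>: "- 1 / 2 < \<alpha>" and x: "x \<noteq> 0" and g [measurable]: "g \<in> borel_measurable borel"
    and int: "\<And>R. integrable (dunkl_borel \<alpha>) (\<lambda>z. indicator {-R..R} z * g z)"
  shows "AE y in dunkl_borel \<alpha>. indicator {-r<..<r} y * dunkl_translation \<alpha> x g y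
      = (LINT z|dunkl_borel \<alpha>. indicator {-r<..<r} y * (g z * roesler_kernel \<alpha> x y z))"
    and "(LINT y|dunkl_borel \<alpha>. LINT z|dunkl_borel \<alpha>. indicator {-r<..<r} y * (g z * roesler_kernel \<alpha> x y z))
      = (LINT z|dunkl_borel \<alpha>. g z * interval_kernel \<alpha> r x z)"
proof -
  have \<alpha>': "- 1 / 2 \<le> \<alpha>" using \<alpha> by simp
  interpret D: sigma_finite_measure "dunkl_borel \<alpha>" by (rule sigma_finite_dunkl_borel)
  interpret DD: pair_sigma_finite "dunkl_borel \<alpha>" "dunkl_borel \<alpha>" ..
  define q where "q y z = indicator {-r<..<r} y * (g z * roesler_kernel \<alpha> x y z)" for y z
  have q_meas [measurable]: "case_prod q \<in> borel_measurable (dunkl_borel \<alpha> \<Otimes>\<^sub>M dunkl_borel \<alpha>)"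
    unfolding q_def[abs_def] by measurable
  define R where "R = \<bar>x\<bar> + r"
  have q_int: "integrable (dunkl_borel \<alpha> \<Otimes>\<^sub>M dunkl_borel \<alpha>) (case_prod q)"
  proof (rule integrableI_bounded)
    have "(\<integral>\<^sup>+ v. ennreal (norm (case_prod q v)) \<partial>(dunkl_borel \<alpha> \<Otimes>\<^sub>M dunkl_borel \<alpha>))
      = (\<integral>\<^sup>+ z. (\<integral>\<^sup>+ y. ennreal (norm (case_prod q (y, z))) \<partial>dunkl_borel \<alpha>) \<partial>dunkl_borel \<alpha>)"
      by (rule DD.nn_integral_snd[symmetric]) measurable
    also have "\<dots> \<le> (\<integral>\<^sup>+ z. 5 * ennreal (norm (indicator {-R..R} z * g z)) \<partial>dunkl_borel \<alpha>)"
    proof (rule nn_integral_mono_AE)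
      show "AE z in dunkl_borel \<alpha>. (\<integral>\<^sup>+ y. ennreal (norm (case_prod q (y, z))) \<partial>dunkl_borel \<alpha>) \<le> 5 * ennreal (norm (indicator {-R..R} z * g z))"
        using AE_dunkl_borel_ne[OF \<alpha>', of x]
      proof eventually_elim
        case (elim z)
        have "(\<integral>\<^sup>+ y. ennreal (norm (case_prod q (y, z))) \<partial>dunkl_borel \<alpha>)
           \<le> (\<integral>\<^sup>+ y. ennreal (norm (indicator {-R..R} z * g z)) * ennreal \<bar>roesler_kernel \<alpha> (- x) z y\<bar> \<partial>dunkl_borel \<alpha>)"
        proof (rule nn_integral_mono)
          fix y
          have "norm (case_prod q (y, z)) \<le> norm (indicator {-R..R} z * g z) * \<bar>roesler_kernel \<alpha> (- x) z y\<bar>"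
          proof (cases "y \<in> {-r<..<r} \<and> 0 < area_form x y z")
            case True
            then have "z \<in> {-R..R}" using area_form_posD(4)[of x y z] by (auto simp: R_def abs_if split: if_splits)
            then show ?thesis by (auto simp: q_def roesler_kernel_swap indicator_def abs_mult)
          next
            case False
            then have "q y z = 0" by (auto simp: q_def roesler_kernel_def)
            then show ?thesis by simp
          qed
          then show "ennreal (norm (case_prod q (y, z))) \<le> ennreal (norm (indicator {-R..R} z * g z)) * ennreal \<bar>roesler_kernel \<alpha> (- x) z y\<bar>"
            by (simp add: ennreal_mult[symmetric] ennreal_leI)
        qed
        also have "\<dots> = ennreal (norm (indicator {-R..R} z * g z)) * (\<integral>\<^sup>+ y. ennreal \<bar>roesler_kernel \<alpha> (- x) z y\<bar> \<partial>dunkl_borel \<alpha>)"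
          by (rule nn_integral_cmult) measurable
        also have "\<dots> \<le> ennreal (norm (indicator {-R..R} z * g z)) * 5"
          using x elim by (intro mult_left_mono nn_integral_abs_roesler_kernel_le[OF \<alpha>]) auto
        finally show ?case by (simp add: mult.commute)
      qed
    qed
    also have "\<dots> = 5 * (\<integral>\<^sup>+ z. ennreal (norm (indicator {-R..R} z * g z)) \<partial>dunkl_borel \<alpha>)"
      by (rule nn_integral_cmult) measurable
    also have "\<dots> < \<infinity>"
      using int[of R] by (simp add: integrable_iff_bounded ennreal_mult_less_top)
    finally show "(\<integral>\<^sup>+ v. ennreal (norm (case_prod q v)) \<partial>(dunkl_borel \<alpha> \<Otimes>\<^sub>M dunkl_borel \<alpha>)) < \<infinity>" .
  qed measurable
  have ae: "AE y in dunkl_borel \<alpha>. integrable (dunkl_borel \<alpha>) (q y)"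
    using DD.AE_integrable_fst'[OF q_int] by simp
  show "AE y in dunkl_borel \<alpha>. indicator {-r<..<r} y * dunkl_translation \<alpha> x g y
      = (LINT z|dunkl_borel \<alpha>. indicator {-r<..<r} y * (g z * roesler_kernel \<alpha> x y z))"
    using ae AE_dunkl_borel_ne[OF \<alpha>', of x]
  proof eventually_elim
    case (elim y)
    show ?case
    proof (cases "y \<in> {-r<..<r}")
      case True
      then have "q y = (\<lambda>z. g z * roesler_kernel \<alpha> x y z)" by (simp add: q_def fun_eq_iff)
      with elim(1) have "integrable (dunkl_borel \<alpha>) (\<lambda>z. g z * roesler_kernel \<alpha> x y z)"
        by simp
      with True x elim(2) show ?thesis
        by (subst dunkl_translation_eq_kernel_integral[OF \<alpha>]) auto
    qed simp
  qed
  have "(LINT y|dunkl_borel \<alpha>. LINT z|dunkl_borel \<alpha>. q y z) = (LINT z|dunkl_borel \<alpha>. LINT y|dunkl_borel \<alpha>. q y z)"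
    using DD.Fubini_integral[OF q_int] by simp
  also have "\<dots> = (LINT z|dunkl_borel \<alpha>. g z * interval_kernel \<alpha> r x z)"
  proof -
    have "AE z in dunkl_borel \<alpha>. g z * interval_kernel \<alpha> r x z = (LINT y|dunkl_borel \<alpha>. q y z)"
      using AE_dunkl_borel_ne[OF \<alpha>', of x]
    proof eventually_elim
      case (elim z)
      have "(LINT y|dunkl_borel \<alpha>. q y z) = g z * (LINT y|dunkl_borel \<alpha>. indicator {-r<..<r} y * roesler_kernel \<alpha> x y z)"
        unfolding q_def by (subst integral_mult_right_zero[symmetric]) (simp add: mult_ac)
      then show ?case using interval_kernel_eq_kernel_integral[OF \<alpha> x] elim by simp
    qed
    then show ?thesis
      using \<alpha>' unfolding q_def by (intro integral_cong_AE) (auto intro!: borel_measurable_times interval_kernel_measurable D.borel_measurable_lebesgue_integral)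
  qed
  finally show "(LINT y|dunkl_borel \<alpha>. LINT z|dunkl_borel \<alpha>. indicator {-r<..<r} y * (g z * roesler_kernel \<alpha> x y z))
      = (LINT z|dunkl_borel \<alpha>. g z * interval_kernel \<alpha> r x z)"
    by (simp add: q_def)
qed

section \<open>The size of a translated interval\<close>

text \<open>
  For an even function the difference terms of the translation formula cancel, which leaves a
  nonnegative integrand.  The reflection of the angle is built in, so that \<open>z\<close> near \<open>x\<close> corresponds to
  small angles.
\<close>

lemma ennreal_interval_kernel:
  assumes \<alpha>: "- 1 / 2 < \<alpha>" and r: "0 < r"
  shows "ennreal (interval_kernel \<alpha> r x z)
    = (\<integral>\<^sup>+\<theta>\<in>{\<theta>. x\<^sup>2 + z\<^sup>2 - 2 * x * z * cos \<theta> < r\<^sup>2}. ennreal (1 + cos \<theta>) \<partial>angle_measure \<alpha>)"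
    and "0 \<le> interval_kernel \<alpha> r x z"
proof -
  interpret finite_measure "angle_measure \<alpha>"
    by (rule finite_measureI) (simp add: emeasure_angle_UNIV[OF \<alpha>])
  define F where "F \<theta> = (1 + cos \<theta>) * indicator {\<theta>. x\<^sup>2 + z\<^sup>2 - 2 * x * z * cos \<theta> < r\<^sup>2} \<theta>" for \<theta>
  have [measurable]: "F \<in> borel_measurable borel" unfolding F_def[abs_def] by measurable
  have F0: "0 \<le> F \<theta>" "F \<theta> \<le> 2" for \<theta>
    using cos_ge_minus_one[of \<theta>] cos_le_one[of \<theta>] by (auto simp: F_def indicator_def simp del: cos_ge_minus_one cos_le_one)
  have F_int: "integrable (angle_measure \<alpha>) F"
    using F0 by (intro integrable_const_bound[where B = 2]) (auto simp: abs_of_nonneg)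
  have eq: "1 / 2 * dunkl_integrand (indicator {-r<..<r}) (- x) z (pi - \<theta>) = F \<theta>" for \<theta>
  proof -
    have "(dunkl_dist (- x) z (pi - \<theta>) < r) \<longleftrightarrow> (dunkl_dist (- x) z (pi - \<theta>))\<^sup>2 < r\<^sup>2"
      using r dunkl_dist_nonneg by (meson less_imp_le power2_less_imp_less power_strict_mono pos2)
    then have "dunkl_dist (- x) z (pi - \<theta>) < r \<longleftrightarrow> x\<^sup>2 + z\<^sup>2 - 2 * x * z * cos \<theta> < r\<^sup>2"
      by (simp add: dunkl_dist_sq)
    moreover have "- r < dunkl_dist (- x) z (pi - \<theta>)" using r dunkl_dist_nonneg[of "- x" z "pi - \<theta>"] by linarith
    ultimately show ?thesis by (auto simp: dunkl_integrand_def F_def indicator_def)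
  qed
  have "interval_kernel \<alpha> r x z = (LINT \<theta>|angle_measure \<alpha>. 1 / 2 * dunkl_integrand (indicator {-r<..<r}) (- x) z \<theta>)"
    unfolding interval_kernel_def by (subst dunkl_translation_eq_integral_angle[OF \<alpha>]) auto
  also have "\<dots> = (LINT \<theta>|distr (angle_measure \<alpha>) borel (\<lambda>\<theta>. pi - \<theta>). 1 / 2 * dunkl_integrand (indicator {-r<..<r}) (- x) z \<theta>)"
    unfolding angle_measure_reflect[OF \<alpha>] ..
  also have "\<dots> = (LINT \<theta>|angle_measure \<alpha>. F \<theta>)"
    unfolding eq[symmetric] by (rule integral_distr) measurable
  finally have K: "interval_kernel \<alpha> r x z = (LINT \<theta>|angle_measure \<alpha>. F \<theta>)" .
  show "0 \<le> interval_kernel \<alpha> r x z" unfolding K using F0 by simp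
  have "ennreal (interval_kernel \<alpha> r x z) = (\<integral>\<^sup>+ \<theta>. ennreal (F \<theta>) \<partial>angle_measure \<alpha>)"
    unfolding K using F0 by (intro nn_integral_eq_integral[symmetric] F_int) auto
  also have "\<dots> = (\<integral>\<^sup>+\<theta>\<in>{\<theta>. x\<^sup>2 + z\<^sup>2 - 2 * x * z * cos \<theta> < r\<^sup>2}. ennreal (1 + cos \<theta>) \<partial>angle_measure \<alpha>)"
    by (intro nn_integral_cong) (auto simp: F_def indicator_def)
  finally show "ennreal (interval_kernel \<alpha> r x z)
    = (\<integral>\<^sup>+\<theta>\<in>{\<theta>. x\<^sup>2 + z\<^sup>2 - 2 * x * z * cos \<theta> < r\<^sup>2}. ennreal (1 + cos \<theta>) \<partial>angle_measure \<alpha>)" .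
qed

lemma sin_arccos_one_minus_sq:
  assumes "0 < \<delta>" "\<delta> \<le> 1"
  shows "\<delta> \<le> sin (arccos (1 - \<delta>\<^sup>2))" "sin (arccos (1 - \<delta>\<^sup>2)) \<le> 2 * \<delta>"
proof -
  have d: "0 < \<delta>\<^sup>2" "\<delta>\<^sup>2 \<le> 1" using assms by (auto simp: power_le_one)
  have s: "sin (arccos (1 - \<delta>\<^sup>2)) = sqrt (1 - (1 - \<delta>\<^sup>2)\<^sup>2)"
    by (rule sin_arccos) (use d in linarith)+
  have e: "1 - (1 - \<delta>\<^sup>2)\<^sup>2 = \<delta>\<^sup>2 * (2 - \<delta>\<^sup>2)" by (simp add: power2_eq_square algebra_simps)
  have "\<delta>\<^sup>2 * 1 \<le> \<delta>\<^sup>2 * (2 - \<delta>\<^sup>2)" using d by (intro mult_left_mono) auto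
  then show "\<delta> \<le> sin (arccos (1 - \<delta>\<^sup>2))" unfolding s e by (intro real_le_rsqrt) simp
  have "\<delta>\<^sup>2 * (2 - \<delta>\<^sup>2) \<le> \<delta>\<^sup>2 * 4" by (rule mult_left_mono; use d in linarith)
  also have "\<dots> = (2 * \<delta>)\<^sup>2" by (simp add: power_mult_distrib)
  finally show "sin (arccos (1 - \<delta>\<^sup>2)) \<le> 2 * \<delta>" unfolding s e using assms by (intro real_le_lsqrt) auto
qed

text \<open>
  The cap is contained in \<open>[0, t]\<close> with \<open>cos t = 1 - \<delta>\<^sup>2\<close>.  There \<open>cos \<theta> \<ge> 1 / 2\<close>, so the exact
  derivative of \<open>nn_integral_sin_cos\<close> dominates, and \<open>sin t \<le> 2 * \<delta>\<close>.
\<close>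

lemma emeasure_angle_cap_le:
  assumes \<alpha>: "- 1 / 2 < \<alpha>" and \<delta>: "0 < \<delta>" "\<delta> \<le> 1 / 2"
  shows "emeasure (angle_measure \<alpha>) {\<theta>. 1 - cos \<theta> < \<delta>\<^sup>2} \<le> ennreal (c_dunkl \<alpha> * (2 * (2 * \<delta>) powr (2 * \<alpha> + 1) / (2 * \<alpha> + 1)))"
proof -
  note c = c_dunkl_normalization(1)[OF \<alpha>]
  define t where "t = arccos (1 - \<delta>\<^sup>2)"
  have d: "0 < \<delta>\<^sup>2" "\<delta>\<^sup>2 \<le> 1 / 4" using \<delta> power_mono[of \<delta> "1/2" 2] by (auto simp: power2_eq_square)
  have t: "0 \<le> t" "t \<le> pi / 2" unfolding t_def by (rule arccos_lbound arccos_le_pi2; use d in linarith)+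
  have cos_t: "cos t = 1 - \<delta>\<^sup>2" unfolding t_def by (rule cos_arccos) (use d in linarith)+
  have sin_t: "0 \<le> sin t" "sin t \<le> 2 * \<delta>"
    using sin_arccos_one_minus_sq[of \<delta>] \<delta> by (auto simp: t_def)
  have "emeasure (angle_measure \<alpha>) {\<theta>. 1 - cos \<theta> < \<delta>\<^sup>2} = (\<integral>\<^sup>+ \<theta>. indicator {\<theta>. 1 - cos \<theta> < \<delta>\<^sup>2} \<theta> \<partial>angle_measure \<alpha>)"
    by (subst nn_integral_indicator) auto
  also have "\<dots> = ennreal (c_dunkl \<alpha>) * (\<integral>\<^sup>+ \<theta>. ennreal (sin \<theta> powr (2 * \<alpha>)) * indicator {\<theta>. 1 - cos \<theta> < \<delta>\<^sup>2} \<theta> * indicator {0..pi} \<theta> \<partial>lborel)"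
    by (rule nn_integral_angle[OF \<alpha>]) measurable
  also have "\<dots> \<le> ennreal (c_dunkl \<alpha>) * (\<integral>\<^sup>+ \<theta>. 2 * (ennreal (sin \<theta> powr (2 * \<alpha>) * cos \<theta>) * indicator {0..t} \<theta>) \<partial>lborel)"
  proof (intro mult_left_mono nn_integral_mono)
    fix \<theta>
    show "ennreal (sin \<theta> powr (2 * \<alpha>)) * indicator {\<theta>. 1 - cos \<theta> < \<delta>\<^sup>2} \<theta> * indicator {0..pi} \<theta>
       \<le> 2 * (ennreal (sin \<theta> powr (2 * \<alpha>) * cos \<theta>) * indicator {0..t} \<theta>)"
    proof (cases "\<theta> \<in> {0..pi} \<and> 1 - cos \<theta> < \<delta>\<^sup>2")
      case True
      then have "cos t < cos \<theta>" using cos_t by simp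
      then have "\<theta> \<le> t" using True t by (intro leI notI) (auto dest: cos_monotone_0_pi)
      have "1 / 2 \<le> cos \<theta>" using True d by simp
      then have "sin \<theta> powr (2 * \<alpha>) * 1 \<le> sin \<theta> powr (2 * \<alpha>) * (2 * cos \<theta>)"
        by (intro mult_left_mono) auto
      then have "ennreal (sin \<theta> powr (2 * \<alpha>)) \<le> ennreal (2 * (sin \<theta> powr (2 * \<alpha>) * cos \<theta>))"
        by (intro ennreal_leI) simp
      then show ?thesis using True \<open>\<theta> \<le> t\<close> \<open>1 / 2 \<le> cos \<theta>\<close> by (simp add: ennreal_mult''[of _ 2] ennreal_mult')
    qed auto
  qed simp
  also have "\<dots> = ennreal (c_dunkl \<alpha>) * (2 * ennreal (sin t powr (2 * \<alpha> + 1) / (2 * \<alpha> + 1)))"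
    by (subst nn_integral_cmult, simp, subst nn_integral_sin_cos[OF \<alpha> t]) auto
  also have "\<dots> = ennreal (c_dunkl \<alpha> * (2 * (sin t powr (2 * \<alpha> + 1) / (2 * \<alpha> + 1))))"
  proof -
    define q where "q = sin t powr (2 * \<alpha> + 1) / (2 * \<alpha> + 1)"
    have "0 \<le> q" using \<alpha> by (simp add: q_def)
    then show ?thesis unfolding q_def[symmetric] using c by (simp add: ennreal_mult)
  qed
  also have "\<dots> \<le> ennreal (c_dunkl \<alpha> * (2 * (2 * \<delta>) powr (2 * \<alpha> + 1) / (2 * \<alpha> + 1)))"
    using c \<alpha> sin_t by (intro ennreal_leI mult_left_mono) (auto intro!: divide_right_mono powr_mono2)
  finally show ?thesis .
qed

lemma emeasure_angle_cap_reflect: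
  assumes \<alpha>: "- 1 / 2 < \<alpha>"
  shows "emeasure (angle_measure \<alpha>) {\<theta>. 1 + cos \<theta> < s} = emeasure (angle_measure \<alpha>) {\<theta>. 1 - cos \<theta> < s}"
proof -
  have "emeasure (angle_measure \<alpha>) {\<theta>. 1 + cos \<theta> < s} = emeasure (distr (angle_measure \<alpha>) borel (\<lambda>\<theta>. pi - \<theta>)) {\<theta>. 1 + cos \<theta> < s}"
    unfolding angle_measure_reflect[OF \<alpha>] ..
  also have "\<dots> = emeasure (angle_measure \<alpha>) ((\<lambda>\<theta>. pi - \<theta>) -` {\<theta>. 1 + cos \<theta> < s} \<inter> space (angle_measure \<alpha>))"
    by (rule emeasure_distr) measurable
  also have "(\<lambda>\<theta>. pi - \<theta>) -` {\<theta>. 1 + cos \<theta> < s} \<inter> space (angle_measure \<alpha>) = {\<theta>. 1 - cos \<theta> < s}"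
    by auto
  finally show ?thesis .
qed

lemma interval_kernel_minus_half:
  "interval_kernel (- 1 / 2) r x z = indicator (ball x r) z"
  by (auto simp: interval_kernel_def dunkl_translation_def indicator_def dist_real_def abs_if)

lemma interval_kernel_nonneg:
  assumes "- 1 / 2 \<le> \<alpha>" "0 < r"
  shows "0 \<le> interval_kernel \<alpha> r x z"
proof (cases "\<alpha> = - 1 / 2")
  case True
  then show ?thesis by (simp only: interval_kernel_minus_half) simp
next
  case False
  with assms show ?thesis by (intro ennreal_interval_kernel) auto
qed

lemma interval_kernel_eq_0:
  assumes \<alpha>: "- 1 / 2 \<le> \<alpha>" and r: "0 < r" and xz: "r \<le> \<bar>\<bar>x\<bar> - \<bar>z\<bar>\<bar>"
  shows "interval_kernel \<alpha> r x z = 0"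
proof (cases "\<alpha> = - 1 / 2")
  case True
  have "r \<le> \<bar>x - z\<bar>" using xz by linarith
  then show ?thesis using True by (simp only: interval_kernel_minus_half) (auto simp: indicator_def dist_real_def)
next
  case False
  with \<alpha> have \<alpha>': "- 1 / 2 < \<alpha>" by simp
  have "r\<^sup>2 \<le> x\<^sup>2 + z\<^sup>2 - 2 * x * z * cos \<theta>" for \<theta>
  proof -
    have "r\<^sup>2 \<le> (\<bar>x\<bar> - \<bar>z\<bar>)\<^sup>2" using power_mono[OF xz, of 2] r by simp
    also have "\<dots> = x\<^sup>2 + z\<^sup>2 - 2 * \<bar>x * z\<bar>" by (simp add: power2_eq_square algebra_simps abs_mult)
    also have "\<dots> \<le> x\<^sup>2 + z\<^sup>2 - 2 * x * z * cos \<theta>"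
    proof -
      have "x * z * cos \<theta> \<le> \<bar>x * z\<bar> * \<bar>cos \<theta>\<bar>" by (metis abs_ge_self abs_mult)
      also have "\<dots> \<le> \<bar>x * z\<bar> * 1" by (intro mult_left_mono) auto
      finally show ?thesis by simp
    qed
    finally show ?thesis .
  qed
  then have "ennreal (interval_kernel \<alpha> r x z) = 0"
    unfolding ennreal_interval_kernel(1)[OF \<alpha>' r] by (auto simp: not_less nn_integral_0_iff_AE)
  then show ?thesis using interval_kernel_nonneg[OF \<alpha> r, of x z] by (simp add: ennreal_eq_0_iff)
qed

lemma interval_kernel_le_2:
  assumes \<alpha>: "- 1 / 2 \<le> \<alpha>" and r: "0 < r"
  shows "interval_kernel \<alpha> r x z \<le> 2"
proof (cases "\<alpha> = - 1 / 2")
  case True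
  then show ?thesis by (simp only: interval_kernel_minus_half) (simp add: indicator_def)
next
  case False
  with \<alpha> have \<alpha>': "- 1 / 2 < \<alpha>" by simp
  have "ennreal (interval_kernel \<alpha> r x z) \<le> (\<integral>\<^sup>+ \<theta>. 2 \<partial>angle_measure \<alpha>)"
    unfolding ennreal_interval_kernel(1)[OF \<alpha>' r]
  proof (intro nn_integral_mono)
    fix \<theta> :: real
    have "ennreal (1 + cos \<theta>) \<le> ennreal 2" by (intro ennreal_leI) simp
    then show "ennreal (1 + cos \<theta>) * indicator {\<theta>. x\<^sup>2 + z\<^sup>2 - 2 * x * z * cos \<theta> < r\<^sup>2} \<theta> \<le> 2"
      by (simp add: indicator_def)
  qed
  also have "\<dots> = ennreal 2" using emeasure_angle_UNIV[OF \<alpha>'] by simp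
  finally show ?thesis by (subst (asm) ennreal_le_iff) simp
qed

text \<open>
  In the plane, a disc of radius \<open>r\<close> whose centre has distance \<open>\<bar>x\<bar>\<close> from the origin is seen from the
  origin under an angle of this order.
\<close>

definition relative_radius :: "real \<Rightarrow> real \<Rightarrow> real" where
  "relative_radius x r = r / max \<bar>x\<bar> r"

lemma relative_radius_bounds:
  assumes "0 < r"
  shows "0 < relative_radius x r" "relative_radius x r \<le> 1"
  using assms by (auto simp: relative_radius_def divide_le_eq less_max_iff_disj)

text \<open>
  If \<open>\<bar>x\<bar> < 2 * r\<close>, the relative radius is at least \<open>1 / 2\<close> and the trivial bound 2 suffices.  Otherwise
  the kernel vanishes unless \<open>\<bar>z\<bar> \<ge> \<bar>x\<bar> / 2\<close>, and then the admissible angles lie in a cap of radius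
  \<open>r / \<bar>x\<bar>\<close> about 0 or about \<open>pi\<close>, according to the sign of \<open>x * z\<close>.
\<close>

lemma interval_kernel_upper:
  assumes \<alpha>: "- 1 / 2 \<le> \<alpha>"
  shows "\<exists>C>0. \<forall>r>0. \<forall>x z. interval_kernel \<alpha> r x z \<le> C * relative_radius x r powr (2 * \<alpha> + 1)"
proof (cases "\<alpha> = - 1 / 2")
  case True
  then have e: "2 * \<alpha> + 1 = 0" by simp
  have "interval_kernel \<alpha> r x z \<le> 2 * relative_radius x r powr (2 * \<alpha> + 1)" if "0 < r" for r x z
    using interval_kernel_le_2[OF \<alpha> that, of x z] relative_radius_bounds[OF that, of x] by (simp add: e)
  then show ?thesis by (intro exI[of _ 2]) auto
next
  case False
  with \<alpha> have \<alpha>': "- 1 / 2 < \<alpha>" by simp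
  note c = c_dunkl_normalization(1)[OF \<alpha>']
  define b where "b = 2 * \<alpha> + 1"
  have b: "b > 0" using \<alpha>' by (simp add: b_def)
  define C where "C = (2 + 8 * c_dunkl \<alpha> / b) * 2 powr b"
  have C: "C > 0" using c b by (auto simp: C_def intro!: mult_pos_pos add_pos_pos)
  have "interval_kernel \<alpha> r x z \<le> C * relative_radius x r powr b" if r: "0 < r" for r x z
  proof (cases "\<bar>x\<bar> < 2 * r")
    case True
    define s where "s = relative_radius x r"
    have s: "1 / 2 \<le> s" using True r by (auto simp: s_def relative_radius_def divide_simps)
    have "interval_kernel \<alpha> r x z \<le> 2" by (rule interval_kernel_le_2[OF \<alpha> r])
    also have "\<dots> = 2 * 1 powr b" by simp
    also have "\<dots> \<le> 2 * (2 * s) powr b" using s b by (intro mult_left_mono powr_mono2) auto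
    also have "\<dots> = 2 * 2 powr b * s powr b" using s by (subst powr_mult) auto
    also have "\<dots> \<le> C * s powr b" using c b by (intro mult_right_mono) (auto simp: C_def)
    finally show ?thesis by (simp add: s_def)
  next
    case False
    define \<delta> where "\<delta> = r / \<bar>x\<bar>"
    have x: "\<bar>x\<bar> > 0" using False r by linarith
    have \<delta>: "0 < \<delta>" "\<delta> \<le> 1 / 2" using False r x by (auto simp: \<delta>_def field_simps)
    have rr: "relative_radius x r = \<delta>" using False r by (simp add: relative_radius_def \<delta>_def max_def)
    have sub: "{\<theta>. x\<^sup>2 + z\<^sup>2 - 2 * x * z * cos \<theta> < r\<^sup>2} \<subseteq> {\<theta>. 1 - cos \<theta> < \<delta>\<^sup>2} \<union> {\<theta>. 1 + cos \<theta> < \<delta>\<^sup>2}"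
      if z: "\<bar>x\<bar> \<le> 2 * \<bar>z\<bar>"
    proof
      fix \<theta> assume "\<theta> \<in> {\<theta>. x\<^sup>2 + z\<^sup>2 - 2 * x * z * cos \<theta> < r\<^sup>2}"
      then have \<theta>: "x\<^sup>2 + z\<^sup>2 - 2 * x * z * cos \<theta> < r\<^sup>2" by simp
      have xz: "x\<^sup>2 \<le> 2 * \<bar>x * z\<bar>"
        using mult_left_mono[OF z, of "\<bar>x\<bar>"] by (simp add: power2_eq_square abs_mult[symmetric] mult.left_commute)
      have key: "1 - u < \<delta>\<^sup>2" if u: "u \<le> 1" "x\<^sup>2 + z\<^sup>2 - 2 * \<bar>x * z\<bar> * u < r\<^sup>2" for u
      proof -
        have "x\<^sup>2 * (1 - u) \<le> 2 * \<bar>x * z\<bar> * (1 - u)" using u by (intro mult_right_mono xz) auto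
        also have "\<dots> \<le> (\<bar>x\<bar> - \<bar>z\<bar>)\<^sup>2 + 2 * \<bar>x * z\<bar> * (1 - u)" by simp
        also have "\<dots> = x\<^sup>2 + z\<^sup>2 - 2 * \<bar>x * z\<bar> * u" by (simp add: power2_eq_square algebra_simps abs_mult)
        also have "\<dots> < r\<^sup>2" by (rule u)
        finally show ?thesis using x by (simp add: \<delta>_def power_divide field_simps)
      qed
      show "\<theta> \<in> {\<theta>. 1 - cos \<theta> < \<delta>\<^sup>2} \<union> {\<theta>. 1 + cos \<theta> < \<delta>\<^sup>2}"
      proof (cases "0 \<le> x * z")
        case True
        then show ?thesis using key[of "cos \<theta>"] \<theta> by (simp add: mult.assoc)
      next
        case False
        then show ?thesis using key[of "- cos \<theta>"] \<theta> by (simp add: mult.assoc)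
      qed
    qed
    show ?thesis
    proof (cases "\<bar>x\<bar> \<le> 2 * \<bar>z\<bar>")
      case False
      then have "r \<le> \<bar>\<bar>x\<bar> - \<bar>z\<bar>\<bar>" using \<open>\<not> \<bar>x\<bar> < 2 * r\<close> by linarith
      from interval_kernel_eq_0[OF \<alpha> r this] C show ?thesis by simp
    next
      case True
      let ?A = "{\<theta>. 1 - cos \<theta> < \<delta>\<^sup>2}" and ?B = "{\<theta>. 1 + cos \<theta> < \<delta>\<^sup>2}"
      have "ennreal (interval_kernel \<alpha> r x z) \<le> (\<integral>\<^sup>+ \<theta>. 2 * indicator (?A \<union> ?B) \<theta> \<partial>angle_measure \<alpha>)"
        unfolding ennreal_interval_kernel(1)[OF \<alpha>' r]
      proof (intro nn_integral_mono)
        fix \<theta> :: real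
        have "ennreal (1 + cos \<theta>) \<le> ennreal 2" by (intro ennreal_leI) simp
        then show "ennreal (1 + cos \<theta>) * indicator {\<theta>. x\<^sup>2 + z\<^sup>2 - 2 * x * z * cos \<theta> < r\<^sup>2} \<theta> \<le> 2 * indicator (?A \<union> ?B) \<theta>"
          using sub[OF True] by (auto simp: indicator_def)
      qed
      also have "\<dots> = 2 * emeasure (angle_measure \<alpha>) (?A \<union> ?B)"
        by (rule nn_integral_cmult_indicator) measurable
      also have "\<dots> \<le> 2 * (emeasure (angle_measure \<alpha>) ?A + emeasure (angle_measure \<alpha>) ?B)"
        by (intro mult_left_mono emeasure_subadditive) auto
      also have "\<dots> = 4 * emeasure (angle_measure \<alpha>) ?A"
        unfolding emeasure_angle_cap_reflect[OF \<alpha>'] by (simp add: mult_2[symmetric] mult.assoc[symmetric])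
      also have "\<dots> \<le> 4 * ennreal (c_dunkl \<alpha> * (2 * (2 * \<delta>) powr (2 * \<alpha> + 1) / (2 * \<alpha> + 1)))"
        by (intro mult_left_mono emeasure_angle_cap_le[OF \<alpha>' \<delta>]) auto
      also have "\<dots> = ennreal (4 * (c_dunkl \<alpha> * (2 * (2 * \<delta>) powr b / b)))"
        using c b by (subst ennreal_mult) (auto simp: b_def)
      finally have "interval_kernel \<alpha> r x z \<le> 4 * (c_dunkl \<alpha> * (2 * (2 * \<delta>) powr b / b))"
        using c b by (subst (asm) ennreal_le_iff) auto
      also have "\<dots> = 8 * c_dunkl \<alpha> / b * 2 powr b * \<delta> powr b" using \<delta> by (simp add: powr_mult)
      also have "\<dots> \<le> C * \<delta> powr b" unfolding C_def using c b by (intro mult_right_mono) auto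
      finally show ?thesis by (simp add: rr)
    qed
  qed
  then show ?thesis using C unfolding b_def by blast
qed

text \<open>
  If \<open>\<bar>x - z\<bar> < r\<close>, all angles up to the order of the relative radius satisfy the constraint
  \<open>x\<^sup>2 + z\<^sup>2 - 2 * x * z * cos \<theta> < (2 * r)\<^sup>2\<close>, because \<open>x * z \<le> 2 * m\<^sup>2\<close>.  On this range
  the weight \<open>1 + cos \<theta>\<close> is bounded below by \<open>cos \<theta>\<close>.
\<close>

lemma interval_kernel_lower:
  assumes \<alpha>: "- 1 / 2 \<le> \<alpha>"
  shows "\<exists>c>0. \<forall>r>0. \<forall>x z. \<bar>x - z\<bar> < r \<longrightarrow> c * relative_radius x r powr (2 * \<alpha> + 1) \<le> interval_kernel \<alpha> (2 * r) x z"
proof (cases "\<alpha> = - 1 / 2")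
  case True
  then have e: "2 * \<alpha> + 1 = 0" by simp
  have "1 * relative_radius x r powr (2 * \<alpha> + 1) \<le> interval_kernel \<alpha> (2 * r) x z" if "0 < r" "\<bar>x - z\<bar> < r" for r x z
    unfolding e unfolding True interval_kernel_minus_half using relative_radius_bounds[OF that(1), of x] that by (auto simp: indicator_def dist_real_def)
  then show ?thesis by (intro exI[of _ 1]) auto
next
  case False
  with \<alpha> have \<alpha>': "- 1 / 2 < \<alpha>" by simp
  note c = c_dunkl_normalization(1)[OF \<alpha>']
  define b where "b = 2 * \<alpha> + 1"
  have b: "b > 0" using \<alpha>' by (simp add: b_def)
  define C where "C = c_dunkl \<alpha> / b * (1 / 2) powr b"
  have C: "C > 0" using c b by (auto simp: C_def)
  have "C * relative_radius x r powr b \<le> interval_kernel \<alpha> (2 * r) x z" if r: "0 < r" and xz: "\<bar>x - z\<bar> < r" for r x z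
  proof -
    define m where "m = max \<bar>x\<bar> r"
    have m: "\<bar>x\<bar> \<le> m" "r \<le> m" "0 < m" using r by (auto simp: m_def)
    define \<delta> where "\<delta> = 1 / 2 * relative_radius x r"
    have \<delta>: "0 < \<delta>" "\<delta> \<le> 1 / 2" using relative_radius_bounds[OF r, of x] by (auto simp: \<delta>_def)
    have d: "0 < \<delta>\<^sup>2" "\<delta>\<^sup>2 \<le> 1 / 4" using \<delta> power_mono[of \<delta> "1/2" 2] by (auto simp: power2_eq_square)
    \<comment> \<open>The factor 1/2 in the definition of \<open>\<delta>\<close> is chosen to make this an equality.\<close>
    have dm: "4 * m\<^sup>2 * \<delta>\<^sup>2 = r\<^sup>2" using m by (simp add: \<delta>_def relative_radius_def m_def[symmetric] power2_eq_square)
    define t where "t = arccos (1 - \<delta>\<^sup>2)"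
    have t: "0 \<le> t" "t \<le> pi / 2" unfolding t_def by (rule arccos_lbound arccos_le_pi2; use d in linarith)+
    have cos_t: "cos t = 1 - \<delta>\<^sup>2" unfolding t_def by (rule cos_arccos) (use d in linarith)+
    have sin_t: "\<delta> \<le> sin t" using sin_arccos_one_minus_sq[of \<delta>] \<delta> by (auto simp: t_def)
    have in_set: "x\<^sup>2 + z\<^sup>2 - 2 * x * z * cos \<theta> < (2 * r)\<^sup>2" if \<theta>: "\<theta> \<in> {0..t}" for \<theta>
    proof -
      have "cos t \<le> cos \<theta>" using \<theta> t by (intro cos_monotone_0_pi_le) auto
      then have u: "0 \<le> 1 - cos \<theta>" "1 - cos \<theta> \<le> \<delta>\<^sup>2" using cos_t by auto
      have "\<bar>z\<bar> \<le> 2 * m" using xz m by linarith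
      have "x * z \<le> \<bar>x\<bar> * \<bar>z\<bar>" by (metis abs_ge_self abs_mult)
      also have "\<dots> \<le> m * (2 * m)" using m \<open>\<bar>z\<bar> \<le> 2 * m\<close> by (intro mult_mono) auto
      finally have "x * z \<le> 2 * m\<^sup>2" by (simp add: power2_eq_square)
      then have "2 * (x * z) * (1 - cos \<theta>) \<le> 2 * (2 * m\<^sup>2) * (1 - cos \<theta>)" using u by (intro mult_right_mono) auto
      also have "\<dots> \<le> 2 * (2 * m\<^sup>2) * \<delta>\<^sup>2" using u by (intro mult_left_mono) auto
      also have "\<dots> = r\<^sup>2" using dm by simp
      finally have 1: "2 * (x * z) * (1 - cos \<theta>) \<le> r\<^sup>2" .
      have "\<bar>x - z\<bar>\<^sup>2 < r\<^sup>2" using xz by (intro power_strict_mono) auto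
      then have "(x - z)\<^sup>2 < r\<^sup>2" by simp
      with 1 have "(x - z)\<^sup>2 + 2 * (x * z) * (1 - cos \<theta>) < 4 * r\<^sup>2" using zero_le_power2[of r] by linarith
      then show ?thesis by (simp add: power2_eq_square algebra_simps)
    qed
    have "ennreal (c_dunkl \<alpha> * (sin t powr b / b)) = ennreal (c_dunkl \<alpha>) * ennreal (sin t powr (2 * \<alpha> + 1) / (2 * \<alpha> + 1))"
      using c b unfolding b_def by (intro ennreal_mult) auto
    also have "\<dots> = ennreal (c_dunkl \<alpha>) * (\<integral>\<^sup>+\<theta>\<in>{0..t}. ennreal (sin \<theta> powr (2 * \<alpha>) * cos \<theta>) \<partial>lborel)"
      by (subst nn_integral_sin_cos[OF \<alpha>' t]) simp
    also have "\<dots> \<le> ennreal (c_dunkl \<alpha>) * (\<integral>\<^sup>+ \<theta>. ennreal (sin \<theta> powr (2 * \<alpha>)) * (ennreal (1 + cos \<theta>) * indicator {\<theta>. x\<^sup>2 + z\<^sup>2 - 2 * x * z * cos \<theta> < (2 * r)\<^sup>2} \<theta>) * indicator {0..pi} \<theta> \<partial>lborel)"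
    proof (intro mult_left_mono nn_integral_mono)
      fix \<theta>
      show "ennreal (sin \<theta> powr (2 * \<alpha>) * cos \<theta>) * indicator {0..t} \<theta>
        \<le> ennreal (sin \<theta> powr (2 * \<alpha>)) * (ennreal (1 + cos \<theta>) * indicator {\<theta>. x\<^sup>2 + z\<^sup>2 - 2 * x * z * cos \<theta> < (2 * r)\<^sup>2} \<theta>) * indicator {0..pi} \<theta>"
      proof (cases "\<theta> \<in> {0..t}")
        case True
        then have "0 \<le> cos \<theta>" using t by (intro cos_ge_zero) auto
        moreover have "\<theta> \<le> pi" using True t by auto
        ultimately show ?thesis using in_set[OF True] True
          by (simp add: ennreal_mult[symmetric] del: ennreal_plus) (intro ennreal_leI mult_left_mono, auto)
      qed auto
    qed simp
    also have "\<dots> = ennreal (interval_kernel \<alpha> (2 * r) x z)"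
      using r by (subst ennreal_interval_kernel(1)[OF \<alpha>'], simp, subst nn_integral_angle[OF \<alpha>']) auto
    finally have "c_dunkl \<alpha> * (sin t powr b / b) \<le> interval_kernel \<alpha> (2 * r) x z"
      using interval_kernel_nonneg[OF \<alpha>, of "2 * r" x z] r by (subst (asm) ennreal_le_iff) auto
    moreover have "C * relative_radius x r powr b = c_dunkl \<alpha> * (\<delta> powr b / b)"
      using relative_radius_bounds[OF r, of x] unfolding C_def \<delta>_def by (subst powr_mult) auto
    moreover have "\<dots> \<le> c_dunkl \<alpha> * (sin t powr b / b)"
      using c b \<delta> sin_t by (intro mult_left_mono divide_right_mono powr_mono2) auto
    ultimately show ?thesis by simp
  qed
  then show ?thesis using C unfolding b_def by blast
qed

section \<open>Adjointness of the Dunkl translation\<close>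

lemma integral_one_minus_cos_angle:
  assumes \<alpha>: "- 1 / 2 < \<alpha>"
  shows "(LINT \<theta>|angle_measure \<alpha>. 1 - cos \<theta>) = 1"
proof -
  interpret finite_measure "angle_measure \<alpha>"
    by (rule finite_measureI) (simp add: emeasure_angle_UNIV[OF \<alpha>])
  have i: "integrable (angle_measure \<alpha>) cos"
    by (intro integrable_const_bound[where B = 1]) auto
  have "(LINT \<theta>|angle_measure \<alpha>. cos \<theta>) = (LINT \<theta>|distr (angle_measure \<alpha>) borel (\<lambda>\<theta>. pi - \<theta>). cos \<theta>)"
    unfolding angle_measure_reflect[OF \<alpha>] ..
  also have "\<dots> = (LINT \<theta>|angle_measure \<alpha>. cos (pi - \<theta>))"
    by (rule integral_distr) measurable
  also have "\<dots> = - (LINT \<theta>|angle_measure \<alpha>. cos \<theta>)" by simp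
  finally have "(LINT \<theta>|angle_measure \<alpha>. cos \<theta>) = 0" by simp
  then show ?thesis
    using i emeasure_angle_UNIV[OF \<alpha>] by (subst Bochner_Integration.integral_diff) (auto simp: measure_def)
qed

lemma dunkl_translation_0:
  assumes \<alpha>: "- 1 / 2 \<le> \<alpha>" and y: "y \<noteq> 0"
  shows "dunkl_translation \<alpha> 0 g y = g y"
proof (cases "\<alpha> = - 1 / 2")
  case False
  with \<alpha> have \<alpha>': "- 1 / 2 < \<alpha>" by simp
  have "dunkl_integrand g 0 y \<theta> = 2 * g y * (1 - cos \<theta>)" for \<theta>
    using y by (auto simp: dunkl_integrand_def dunkl_dist_def abs_if)
  then have "indicator {0..pi} \<theta> * (dunkl_integrand g 0 y \<theta> * sin \<theta> powr (2 * \<alpha>))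
      = 2 * g y * (indicator {0..pi} \<theta> * ((1 - cos \<theta>) * sin \<theta> powr (2 * \<alpha>)))" for \<theta>
    by (simp only: mult_ac)
  then have "dunkl_translation \<alpha> 0 g y = c_dunkl \<alpha> / 2 * (LINT \<theta>|lebesgue. 2 * g y * (indicator {0..pi} \<theta> * ((1 - cos \<theta>) * sin \<theta> powr (2 * \<alpha>))))"
    unfolding dunkl_translation_eq_integral_lebesgue[OF \<alpha>'] by (simp only:)
  also have "\<dots> = g y * (c_dunkl \<alpha> * (LINT \<theta>|lborel. indicator {0..pi} \<theta> * ((1 - cos \<theta>) * sin \<theta> powr (2 * \<alpha>))))"
    by (subst integral_completion) auto
  also have "\<dots> = g y"
    by (subst integral_angle[OF \<alpha>', symmetric]) (auto simp: integral_one_minus_cos_angle[OF \<alpha>'])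
  finally show ?thesis .
qed (simp add: dunkl_translation_def)

lemma dunkl_borel_minus_half:
  "dunkl_borel (- 1 / 2) = density lborel (\<lambda>_. ennreal (dunkl_norm_const (- 1 / 2)))"
  unfolding dunkl_borel_def
proof (rule density_cong)
  show "AE y in lborel. ennreal (dunkl_weight (- 1 / 2) y) = ennreal (dunkl_norm_const (- 1 / 2))"
    using AE_lborel_singleton[of 0] by eventually_elim (simp add: dunkl_weight_def)
qed auto

text \<open>
  For \<open>\<alpha> = - 1 / 2\<close> this is the translation invariance of Lebesgue measure, and translation by 0 is
  the identity; the remaining cases come from the product formula.
\<close>

lemma dunkl_adjoint:
  assumes \<alpha>: "- 1 / 2 \<le> \<alpha>" and g' [measurable]: "g' \<in> borel_measurable borel"
    and ae: "AE z in dunkl_borel \<alpha>. g z = g' z"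
    and int: "\<And>R. integrable (dunkl_borel \<alpha>) (\<lambda>z. indicator {-R..R} z * g' z)"
  shows "(LINT y:{-r<..<r}|dunkl_measure \<alpha>. dunkl_translation \<alpha> x g y)
       = (LINT z|dunkl_borel \<alpha>. g' z * interval_kernel \<alpha> r x z)"
proof -
  interpret D: sigma_finite_measure "dunkl_borel \<alpha>" by (rule sigma_finite_dunkl_borel)
  have ae': "AE z in lborel. g z = g' z" using ae AE_dunkl_borel_iff[OF \<alpha>] by simp
  have via: "(LINT y:{-r<..<r}|dunkl_measure \<alpha>. dunkl_translation \<alpha> x g y) = (LINT y|dunkl_borel \<alpha>. F y)"
    if "AE y in dunkl_borel \<alpha>. indicator {-r<..<r} y * dunkl_translation \<alpha> x g y = F y" "F \<in> borel_measurable borel" for F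
    unfolding set_lebesgue_integral_def dunkl_measure_eq_completion[OF \<alpha>]
    using that by (intro integral_completion_AE_cong(1)) auto
  consider "\<alpha> = - 1 / 2" | "- 1 / 2 < \<alpha>" "x = 0" | "- 1 / 2 < \<alpha>" "x \<noteq> 0" using \<alpha> by linarith
  then show ?thesis
  proof cases
    case 1
    have [measurable]: "ball x r \<in> sets borel" by simp
    have c: "0 \<le> dunkl_norm_const (- 1 / 2)" using dunkl_norm_const_pos[of "- 1 / 2"] by simp
    have shift: "AE y in lborel. g (x + y) = g' (x + y)"
    proof (rule AE_distrD[where M' = borel and f = "\<lambda>y. x + y"])
      show "AE z in distr lborel borel ((+) x). g z = g' z" unfolding lborel_distr_plus by (rule ae')
    qed simp
    have "(LINT y:{-r<..<r}|dunkl_measure \<alpha>. dunkl_translation \<alpha> x g y) = (LINT y|dunkl_borel \<alpha>. indicator {-r<..<r} y * g' (x + y))"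
      using shift by (intro via) (auto simp: AE_dunkl_borel_iff[OF \<alpha>] dunkl_translation_def 1 elim!: eventually_mono)
    also have "\<dots> = dunkl_norm_const (- 1 / 2) * (LINT y|lborel. indicator {-r<..<r} y * g' (x + y))"
      unfolding 1 dunkl_borel_minus_half using c by (subst integral_density) auto
    also have "(LINT y|lborel. indicator {-r<..<r} y * g' (x + y)) = (LINT z|lborel. g' z * indicator (ball x r) z)"
      by (subst (2) lborel_integral_real_affine[where c = 1 and t = x])
         (auto intro!: Bochner_Integration.integral_cong simp: indicator_def dist_real_def abs_if)
    also have "dunkl_norm_const (- 1 / 2) * \<dots> = (LINT z|dunkl_borel \<alpha>. g' z * interval_kernel \<alpha> r x z)"
      unfolding 1 dunkl_borel_minus_half interval_kernel_minus_half using c by (subst integral_density) auto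
    finally show ?thesis .
  next
    case 2
    have "AE y in dunkl_borel \<alpha>. indicator {-r<..<r} y * dunkl_translation \<alpha> x g y = g' y * interval_kernel \<alpha> r x y"
      using ae AE_dunkl_borel_ne[OF \<alpha>, of 0]
      by eventually_elim (use \<alpha> in \<open>auto simp: 2(2) interval_kernel_def dunkl_translation_0\<close>)
    then show ?thesis
      using \<alpha> by (intro via) (auto intro!: borel_measurable_times interval_kernel_measurable)
  next
    case 3
    let ?F = "\<lambda>y. LINT z|dunkl_borel \<alpha>. indicator {-r<..<r} y * (g' z * roesler_kernel \<alpha> x y z)"
    have "AE y in dunkl_borel \<alpha>. indicator {-r<..<r} y * dunkl_translation \<alpha> x g y = ?F y"
      using dunkl_adjoint_borel(1)[OF 3 g' int, of r] AE_dunkl_borel_ne[OF \<alpha>, of x]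
      by eventually_elim (use 3 ae' g' in \<open>simp add: dunkl_translation_cong_AE[of \<alpha> x _ g g']\<close>)
    then have "(LINT y:{-r<..<r}|dunkl_measure \<alpha>. dunkl_translation \<alpha> x g y) = (LINT y|dunkl_borel \<alpha>. ?F y)"
      by (intro via) (auto intro!: D.borel_measurable_lebesgue_integral)
    then show ?thesis using dunkl_adjoint_borel(2)[OF 3 g' int] by simp
  qed
qed

text \<open>
  The form used for Morrey norms and maximal functions.  The kernel is at most 2 and has bounded
  support, so the right-hand side is finite for locally integrable functions.
\<close>

lemma dunkl_adjoint_nonneg:
  assumes \<alpha>: "- 1 / 2 \<le> \<alpha>" and r: "0 < r" and g' [measurable]: "g' \<in> borel_measurable borel"
    and g0: "\<And>z. 0 \<le> g' z"
    and ae: "AE z in dunkl_borel \<alpha>. g z = g' z"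
    and int: "\<And>R. (\<integral>\<^sup>+z\<in>{-R..R}. ennreal (g' z) \<partial>dunkl_borel \<alpha>) < \<infinity>"
  shows "ennreal (LINT y:{-r<..<r}|dunkl_measure \<alpha>. dunkl_translation \<alpha> x g y)
       = (\<integral>\<^sup>+ z. ennreal (g' z) * ennreal (interval_kernel \<alpha> r x z) \<partial>dunkl_borel \<alpha>)"
    and "0 \<le> (LINT y:{-r<..<r}|dunkl_measure \<alpha>. dunkl_translation \<alpha> x g y)"
proof -
  note K0 = interval_kernel_nonneg[OF \<alpha> r]
  note [measurable] = interval_kernel_measurable[OF _ _ \<alpha>]
  have "integrable (dunkl_borel \<alpha>) (\<lambda>z. indicator {-R..R} z * g' z)" for R
  proof (rule integrableI_bounded)
    have "(\<integral>\<^sup>+ z. ennreal (norm (indicator {-R..R} z * g' z)) \<partial>dunkl_borel \<alpha>) = (\<integral>\<^sup>+z\<in>{-R..R}. ennreal (g' z) \<partial>dunkl_borel \<alpha>)"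
      using g0 by (intro nn_integral_cong) (auto simp: indicator_def)
    then show "(\<integral>\<^sup>+ z. ennreal (norm (indicator {-R..R} z * g' z)) \<partial>dunkl_borel \<alpha>) < \<infinity>" using int[of R] by simp
  qed auto
  note eq = dunkl_adjoint[OF \<alpha> g' ae this, of r x]
  show "0 \<le> (LINT y:{-r<..<r}|dunkl_measure \<alpha>. dunkl_translation \<alpha> x g y)"
    unfolding eq using g0 K0 by simp
  define R where "R = \<bar>x\<bar> + r"
  have "integrable (dunkl_borel \<alpha>) (\<lambda>z. g' z * interval_kernel \<alpha> r x z)"
  proof (rule integrableI_bounded)
    have "(\<integral>\<^sup>+ z. ennreal (norm (g' z * interval_kernel \<alpha> r x z)) \<partial>dunkl_borel \<alpha>)
       \<le> (\<integral>\<^sup>+ z. 2 * (ennreal (g' z) * indicator {-R..R} z) \<partial>dunkl_borel \<alpha>)"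
    proof (intro nn_integral_mono)
      fix z
      show "ennreal (norm (g' z * interval_kernel \<alpha> r x z)) \<le> 2 * (ennreal (g' z) * indicator {-R..R} z)"
      proof (cases "r \<le> \<bar>\<bar>x\<bar> - \<bar>z\<bar>\<bar>")
        case True
        then show ?thesis by (simp add: interval_kernel_eq_0[OF \<alpha> r])
      next
        case False
        then have z: "z \<in> {-R..R}" by (auto simp: R_def)
        have "norm (g' z * interval_kernel \<alpha> r x z) \<le> 2 * g' z"
          using mult_left_mono[OF interval_kernel_le_2[OF \<alpha> r, of x z] g0[of z]] K0[of x z] g0[of z] by (simp add: abs_mult mult.commute)
        then have "ennreal (norm (g' z * interval_kernel \<alpha> r x z)) \<le> ennreal (2 * g' z)" by (rule ennreal_leI)
        also have "\<dots> = 2 * (ennreal (g' z) * indicator {-R..R} z)" using z g0[of z] by (simp add: ennreal_mult)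
        finally show ?thesis .
      qed
    qed
    also have "\<dots> < \<infinity>" using int[of R] by (subst nn_integral_cmult) (auto simp: ennreal_mult_less_top)
    finally show "(\<integral>\<^sup>+ z. ennreal (norm (g' z * interval_kernel \<alpha> r x z)) \<partial>dunkl_borel \<alpha>) < \<infinity>" .
  qed auto
  then have "ennreal (LINT z|dunkl_borel \<alpha>. g' z * interval_kernel \<alpha> r x z) = (\<integral>\<^sup>+ z. ennreal (g' z * interval_kernel \<alpha> r x z) \<partial>dunkl_borel \<alpha>)"
    using g0 K0 by (intro nn_integral_eq_integral[symmetric]) auto
  then show "ennreal (LINT y:{-r<..<r}|dunkl_measure \<alpha>. dunkl_translation \<alpha> x g y)
       = (\<integral>\<^sup>+ z. ennreal (g' z) * ennreal (interval_kernel \<alpha> r x z) \<partial>dunkl_borel \<alpha>)"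
    unfolding eq using g0 K0 by (simp add: ennreal_mult)
qed

section \<open>The gauge of the Dunkl measure\<close>

text \<open>
  The order of magnitude of the Dunkl measure of \<open>(x - r, x + r)\<close>: its length times the largest value
  of the density on it, up to constants.
\<close>

definition dunkl_gauge :: "real \<Rightarrow> real \<Rightarrow> real \<Rightarrow> real" where
  "dunkl_gauge \<alpha> x r = r * max \<bar>x\<bar> r powr (2 * \<alpha> + 1)"

definition gauge_const :: "real \<Rightarrow> real" where
  "gauge_const \<alpha> = 5 * 5 powr (2 * \<alpha> + 1) + 2 * 2 powr (2 * \<alpha> + 1) * dunkl_norm_const \<alpha>"

lemma dunkl_gauge_minus [simp]: "dunkl_gauge \<alpha> (- x) r = dunkl_gauge \<alpha> x r"
  by (simp add: dunkl_gauge_def)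

text \<open>
  This identity links the two normalizations: \<open>r powr d_dim \<alpha>\<close> in the Dunkl-type averages and the
  gauge in averages over intervals.
\<close>

lemma dunkl_gauge_relative_radius:
  assumes "0 < r"
  shows "relative_radius x r powr (2 * \<alpha> + 1) * dunkl_gauge \<alpha> x r = r powr d_dim \<alpha>"
proof -
  have m: "0 < max \<bar>x\<bar> r" using assms by auto
  have "relative_radius x r powr (2 * \<alpha> + 1) = r powr (2 * \<alpha> + 1) / max \<bar>x\<bar> r powr (2 * \<alpha> + 1)"
    using assms m unfolding relative_radius_def by (intro powr_divide)
  moreover have "r powr d_dim \<alpha> = r powr (2 * \<alpha> + 1) * r"
  proof -
    have "r powr d_dim \<alpha> = r powr ((2 * \<alpha> + 1) + 1)" by (simp add: d_dim_def add.commute)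
    also have "\<dots> = r powr (2 * \<alpha> + 1) * r" using assms by (subst powr_add) simp
    finally show ?thesis .
  qed
  ultimately show ?thesis using m by (simp add: dunkl_gauge_def)
qed

lemma nn_integral_dunkl_borel:
  assumes [measurable]: "u \<in> borel_measurable borel"
  shows "(\<integral>\<^sup>+ z. u z \<partial>dunkl_borel \<alpha>) = (\<integral>\<^sup>+ z. ennreal (dunkl_weight \<alpha> z) * u z \<partial>lborel)"
  unfolding dunkl_borel_def by (rule nn_integral_density) auto

lemma nn_integral_dunkl_borel_uminus:
  assumes [measurable]: "u \<in> borel_measurable borel"
  shows "(\<integral>\<^sup>+ z. u (- z) \<partial>dunkl_borel \<alpha>) = (\<integral>\<^sup>+ z. u z \<partial>dunkl_borel \<alpha>)"
  by (subst (1 2) nn_integral_dunkl_borel, simp, simp)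
     (subst (2) nn_integral_real_affine[where c = "-1" and t = 0], auto)

lemma emeasure_dunkl_ball_le:
  assumes \<alpha>: "- 1 / 2 \<le> \<alpha>" and r: "0 < r"
  shows "emeasure (dunkl_borel \<alpha>) (ball x r) \<le> ennreal (2 * 2 powr (2 * \<alpha> + 1) * dunkl_norm_const \<alpha> * dunkl_gauge \<alpha> x r)"
proof -
  note N = dunkl_norm_const_pos[OF \<alpha>]
  define m where "m = max \<bar>x\<bar> r"
  define W where "W = dunkl_norm_const \<alpha> * (2 * m) powr (2 * \<alpha> + 1)"
  have m: "0 < m" using r by (auto simp: m_def)
  have "emeasure (dunkl_borel \<alpha>) (ball x r) = (\<integral>\<^sup>+z\<in>ball x r. ennreal (dunkl_weight \<alpha> z) \<partial>lborel)"
    unfolding dunkl_borel_def by (subst emeasure_density) auto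
  also have "\<dots> \<le> (\<integral>\<^sup>+z\<in>ball x r. ennreal W \<partial>lborel)"
  proof (intro nn_integral_mono)
    fix z
    have "dunkl_weight \<alpha> z \<le> W" if "z \<in> ball x r"
    proof -
      have "\<bar>z\<bar> \<le> 2 * m" using that unfolding m_def by (auto simp: dist_real_def)
      then show ?thesis unfolding dunkl_weight_def W_def using N \<alpha> by (intro mult_left_mono powr_mono2) auto
    qed
    then show "ennreal (dunkl_weight \<alpha> z) * indicator (ball x r) z \<le> ennreal W * indicator (ball x r) z"
      by (auto simp: indicator_def intro: ennreal_leI)
  qed
  also have "\<dots> = ennreal W * emeasure lborel {x - r<..<x + r}"
    by (subst nn_integral_cmult_indicator) (auto simp: ball_eq_greaterThanLessThan)
  also have "\<dots> = ennreal (W * (2 * r))"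
    using r N by (simp add: W_def ennreal_mult)
  also have "W * (2 * r) = 2 * 2 powr (2 * \<alpha> + 1) * dunkl_norm_const \<alpha> * dunkl_gauge \<alpha> x r"
    using m by (simp add: W_def dunkl_gauge_def m_def[symmetric] powr_mult)
  finally show ?thesis .
qed

lemma doubling_gauge_dunkl:
  assumes \<alpha>: "- 1 / 2 \<le> \<alpha>"
  shows "doubling_gauge (dunkl_borel \<alpha>) (dunkl_gauge \<alpha>) (gauge_const \<alpha>)"
proof -
  note N = dunkl_norm_const_pos[OF \<alpha>]
  interpret sigma_finite_measure "dunkl_borel \<alpha>" by (rule sigma_finite_dunkl_borel)
  have V: "0 < dunkl_gauge \<alpha> x r" if "0 < r" for x r
    using that by (auto simp: dunkl_gauge_def)
  show ?thesis
  proof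
    show "0 < gauge_const \<alpha>" using N by (auto simp: gauge_const_def intro!: add_pos_pos)
    fix r :: real and x assume r: "0 < r"
    show "0 < dunkl_gauge \<alpha> x r" by (rule V[OF r])
    show "dunkl_gauge \<alpha> x r \<le> dunkl_gauge \<alpha> x s" if "r \<le> s" for s
      unfolding dunkl_gauge_def using r that \<alpha> by (intro mult_mono powr_mono2) auto
    have "max \<bar>x\<bar> (5 * r) powr (2 * \<alpha> + 1) \<le> (5 * max \<bar>x\<bar> r) powr (2 * \<alpha> + 1)"
      using r \<alpha> by (intro powr_mono2) auto
    also have "\<dots> = 5 powr (2 * \<alpha> + 1) * max \<bar>x\<bar> r powr (2 * \<alpha> + 1)"
      using r by (subst powr_mult) auto
    finally have "dunkl_gauge \<alpha> x (5 * r) \<le> (5 * 5 powr (2 * \<alpha> + 1)) * dunkl_gauge \<alpha> x r"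
      using r by (simp add: dunkl_gauge_def mult_left_mono mult.left_commute)
    also have "\<dots> \<le> gauge_const \<alpha> * dunkl_gauge \<alpha> x r"
      unfolding gauge_const_def using N V[OF r, of x] by (intro mult_right_mono) auto
    finally show "dunkl_gauge \<alpha> x (5 * r) \<le> gauge_const \<alpha> * dunkl_gauge \<alpha> x r" .
    have "emeasure (dunkl_borel \<alpha>) (ball x r) \<le> ennreal (2 * 2 powr (2 * \<alpha> + 1) * dunkl_norm_const \<alpha> * dunkl_gauge \<alpha> x r)"
      by (rule emeasure_dunkl_ball_le[OF \<alpha> r])
    also have "\<dots> \<le> ennreal (gauge_const \<alpha> * dunkl_gauge \<alpha> x r)"
      unfolding gauge_const_def using V[OF r, of x] by (intro ennreal_leI mult_right_mono) auto
    finally show "emeasure (dunkl_borel \<alpha>) (ball x r) \<le> ennreal (gauge_const \<alpha> * dunkl_gauge \<alpha> x r)" .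
  qed (auto simp: dunkl_gauge_def)
qed

definition centered_const :: "real \<Rightarrow> real" where
  "centered_const \<alpha> = dunkl_norm_const \<alpha> / 2 * (1 / 2) powr (2 * \<alpha> + 1)"

lemma centered_const_pos: "- 1 / 2 \<le> \<alpha> \<Longrightarrow> 0 < centered_const \<alpha>"
  using dunkl_norm_const_pos[of \<alpha>] by (simp add: centered_const_def)

text \<open>
  The maximal function divides by this measure, so a lower bound is needed; the right quarter of the
  interval already provides one.
\<close>

lemma emeasure_dunkl_centered:
  assumes \<alpha>: "- 1 / 2 \<le> \<alpha>" and r: "0 < r"
  shows "emeasure (dunkl_borel \<alpha>) {-r<..<r} = ennreal (measure (dunkl_measure \<alpha>) {-r<..<r})"
    and "centered_const \<alpha> * r powr d_dim \<alpha> \<le> measure (dunkl_measure \<alpha>) {-r<..<r}"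
proof -
  note N = dunkl_norm_const_pos[OF \<alpha>]
  define c where "c = centered_const \<alpha>"
  have b: "{-r<..<r} = ball 0 r" by (simp add: ball_eq_greaterThanLessThan)
  have "emeasure (dunkl_borel \<alpha>) {-r<..<r} < \<infinity>"
    unfolding b using emeasure_dunkl_ball_le[OF \<alpha> r, of 0] by (rule le_less_trans) simp
  then show eq: "emeasure (dunkl_borel \<alpha>) {-r<..<r} = ennreal (measure (dunkl_measure \<alpha>) {-r<..<r})"
    unfolding dunkl_measure_eq_completion[OF \<alpha>] by (subst measure_completion) (auto simp: emeasure_eq_ennreal_measure less_top)
  have e: "c * r powr d_dim \<alpha> = dunkl_norm_const \<alpha> * (r / 2) powr (2 * \<alpha> + 1) * (r / 2)"
  proof -
    have "r powr d_dim \<alpha> = r powr ((2 * \<alpha> + 1) + 1)" by (simp add: d_dim_def add.commute)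
    also have "\<dots> = r powr (2 * \<alpha> + 1) * r" using r by (subst powr_add) simp
    finally show ?thesis using r by (simp add: c_def centered_const_def powr_divide)
  qed
  have "ennreal (c * r powr d_dim \<alpha>) = (\<integral>\<^sup>+ z. ennreal (dunkl_norm_const \<alpha> * (r / 2) powr (2 * \<alpha> + 1)) * indicator {r/2<..<r} z \<partial>lborel)"
    unfolding e using r N by (subst nn_integral_cmult_indicator) (auto simp: ennreal_mult[symmetric])
  also have "\<dots> \<le> (\<integral>\<^sup>+z\<in>{-r<..<r}. ennreal (dunkl_weight \<alpha> z) \<partial>lborel)"
  proof (intro nn_integral_mono)
    fix z
    have "dunkl_norm_const \<alpha> * (r / 2) powr (2 * \<alpha> + 1) \<le> dunkl_weight \<alpha> z" if "z \<in> {r/2<..<r}"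
      unfolding dunkl_weight_def using that r N \<alpha> by (intro mult_left_mono powr_mono2) auto
    then show "ennreal (dunkl_norm_const \<alpha> * (r / 2) powr (2 * \<alpha> + 1)) * indicator {r/2<..<r} z \<le> ennreal (dunkl_weight \<alpha> z) * indicator {-r<..<r} z"
      using r by (auto simp: indicator_def intro: ennreal_leI)
  qed
  also have "\<dots> = emeasure (dunkl_borel \<alpha>) {-r<..<r}"
    unfolding dunkl_borel_def by (subst emeasure_density) auto
  finally show "centered_const \<alpha> * r powr d_dim \<alpha> \<le> measure (dunkl_measure \<alpha>) {-r<..<r}"
    unfolding eq c_def by (subst (asm) ennreal_le_iff) auto
qed

lemma nn_integral_interval_kernel_le:
  assumes \<alpha>: "- 1 / 2 \<le> \<alpha>" and r: "0 < r" and C: "0 \<le> C"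
    and K: "\<And>z. interval_kernel \<alpha> r x z \<le> C"
    and [measurable]: "u \<in> borel_measurable borel"
  shows "(\<integral>\<^sup>+ z. u z * ennreal (interval_kernel \<alpha> r x z) \<partial>dunkl_borel \<alpha>)
    \<le> ennreal C * ((\<integral>\<^sup>+z\<in>ball x r. u z \<partial>dunkl_borel \<alpha>) + (\<integral>\<^sup>+z\<in>ball (- x) r. u z \<partial>dunkl_borel \<alpha>))"
proof -
  have [measurable]: "ball a r \<in> sets borel" for a :: real by simp
  have "(\<integral>\<^sup>+ z. u z * ennreal (interval_kernel \<alpha> r x z) \<partial>dunkl_borel \<alpha>)
    \<le> (\<integral>\<^sup>+ z. ennreal C * (u z * indicator (ball x r) z + u z * indicator (ball (- x) r) z) \<partial>dunkl_borel \<alpha>)"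
  proof (intro nn_integral_mono)
    fix z
    show "u z * ennreal (interval_kernel \<alpha> r x z) \<le> ennreal C * (u z * indicator (ball x r) z + u z * indicator (ball (- x) r) z)"
    proof (cases "r \<le> \<bar>\<bar>x\<bar> - \<bar>z\<bar>\<bar>")
      case True
      then show ?thesis by (simp add: interval_kernel_eq_0[OF \<alpha> r])
    next
      case False
      then have "z \<in> ball x r \<or> z \<in> ball (- x) r" by (auto simp: dist_real_def)
      then have "u z \<le> u z * indicator (ball x r) z + u z * indicator (ball (- x) r) z"
        by (auto simp: indicator_def)
      moreover have "ennreal (interval_kernel \<alpha> r x z) \<le> ennreal C" by (intro ennreal_leI K)
      ultimately show ?thesis by (metis mult.commute mult_mono zero_le)
    qed
  qed
  also have "\<dots> = ennreal C * ((\<integral>\<^sup>+z\<in>ball x r. u z \<partial>dunkl_borel \<alpha>) + (\<integral>\<^sup>+z\<in>ball (- x) r. u z \<partial>dunkl_borel \<alpha>))"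
    by (subst nn_integral_cmult, simp, subst nn_integral_add) auto
  finally show ?thesis .
qed

text \<open>
  The constraint on the angle is strict, hence it survives a small decrease of \<open>r\<close>; the rest is Fatou's
  lemma.
\<close>

lemma interval_kernel_liminf:
  assumes \<alpha>: "- 1 / 2 \<le> \<alpha>" and r: "0 < r" and s: "s \<longlonglongrightarrow> r" "\<And>n. 0 < s n"
  shows "ennreal (interval_kernel \<alpha> r x z) \<le> liminf (\<lambda>n. ennreal (interval_kernel \<alpha> (s n) x z))"
proof (cases "\<alpha> = - 1 / 2")
  case True
  show ?thesis
  proof (cases "dist x z < r")
    case t: True
    from order_tendstoD(1)[OF s(1) t] have "eventually (\<lambda>n. 1 \<le> ennreal (interval_kernel \<alpha> (s n) x z)) sequentially"
      by (rule eventually_mono) (simp only: True interval_kernel_minus_half, simp)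
    then have "1 \<le> liminf (\<lambda>n. ennreal (interval_kernel \<alpha> (s n) x z))" by (rule Liminf_bounded)
    then show ?thesis using t by (simp only: True interval_kernel_minus_half) simp
  qed (simp only: True interval_kernel_minus_half, simp)
next
  case False
  with \<alpha> have \<alpha>': "- 1 / 2 < \<alpha>" by simp
  have "(\<integral>\<^sup>+\<theta>\<in>{\<theta>. x\<^sup>2 + z\<^sup>2 - 2 * x * z * cos \<theta> < r\<^sup>2}. ennreal (1 + cos \<theta>) \<partial>angle_measure \<alpha>)
     \<le> (\<integral>\<^sup>+ \<theta>. liminf (\<lambda>n. ennreal (1 + cos \<theta>) * indicator {\<theta>. x\<^sup>2 + z\<^sup>2 - 2 * x * z * cos \<theta> < (s n)\<^sup>2} \<theta>) \<partial>angle_measure \<alpha>)"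
  proof (intro nn_integral_mono)
    fix \<theta> :: real
    show "ennreal (1 + cos \<theta>) * indicator {\<theta>. x\<^sup>2 + z\<^sup>2 - 2 * x * z * cos \<theta> < r\<^sup>2} \<theta>
      \<le> liminf (\<lambda>n. ennreal (1 + cos \<theta>) * indicator {\<theta>. x\<^sup>2 + z\<^sup>2 - 2 * x * z * cos \<theta> < (s n)\<^sup>2} \<theta>)"
    proof (cases "x\<^sup>2 + z\<^sup>2 - 2 * x * z * cos \<theta> < r\<^sup>2")
      case True
      have lim: "(\<lambda>n. (s n)\<^sup>2) \<longlonglongrightarrow> r\<^sup>2" by (intro tendsto_intros s)
      show ?thesis
      proof (rule Liminf_bounded)
        show "\<forall>\<^sub>F n in sequentially. ennreal (1 + cos \<theta>) * indicator {\<theta>. x\<^sup>2 + z\<^sup>2 - 2 * x * z * cos \<theta> < r\<^sup>2} \<theta>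
          \<le> ennreal (1 + cos \<theta>) * indicator {\<theta>. x\<^sup>2 + z\<^sup>2 - 2 * x * z * cos \<theta> < (s n)\<^sup>2} \<theta>"
          using order_tendstoD(1)[OF lim True] by eventually_elim (simp add: True)
      qed
    qed simp
  qed
  also have "\<dots> \<le> liminf (\<lambda>n. \<integral>\<^sup>+\<theta>\<in>{\<theta>. x\<^sup>2 + z\<^sup>2 - 2 * x * z * cos \<theta> < (s n)\<^sup>2}. ennreal (1 + cos \<theta>) \<partial>angle_measure \<alpha>)"
    by (rule nn_integral_liminf) measurable
  finally show ?thesis
    unfolding ennreal_interval_kernel(1)[OF \<alpha>' r] ennreal_interval_kernel(1)[OF \<alpha>' s(2)] .
qed

lemma kernel_average_liminf:
  assumes \<alpha>: "- 1 / 2 \<le> \<alpha>" and r: "0 < r" and s: "s \<longlonglongrightarrow> r" "\<And>n. 0 < s n"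
    and [measurable]: "u \<in> borel_measurable borel"
  shows "(\<integral>\<^sup>+ z. ennreal (u z) * ennreal (interval_kernel \<alpha> r x z) \<partial>dunkl_borel \<alpha>)
     \<le> liminf (\<lambda>n. \<integral>\<^sup>+ z. ennreal (u z) * ennreal (interval_kernel \<alpha> (s n) x z) \<partial>dunkl_borel \<alpha>)"
proof -
  note [measurable] = interval_kernel_measurable[OF _ _ \<alpha>]
  have eq: "(\<integral>\<^sup>+ z. ennreal (u z) * ennreal (interval_kernel \<alpha> t x z) \<partial>dunkl_borel \<alpha>)
    = (\<integral>\<^sup>+ z. ennreal (interval_kernel \<alpha> t x z) \<partial>density (dunkl_borel \<alpha>) (\<lambda>z. ennreal (u z)))" for t
    by (subst nn_integral_density) auto
  have "(\<integral>\<^sup>+ z. ennreal (interval_kernel \<alpha> r x z) \<partial>density (dunkl_borel \<alpha>) (\<lambda>z. ennreal (u z)))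
    \<le> (\<integral>\<^sup>+ z. liminf (\<lambda>n. ennreal (interval_kernel \<alpha> (s n) x z)) \<partial>density (dunkl_borel \<alpha>) (\<lambda>z. ennreal (u z)))"
    by (intro nn_integral_mono interval_kernel_liminf[OF \<alpha> r s])
  also have "\<dots> \<le> liminf (\<lambda>n. \<integral>\<^sup>+ z. ennreal (interval_kernel \<alpha> (s n) x z) \<partial>density (dunkl_borel \<alpha>) (\<lambda>z. ennreal (u z)))"
    by (rule nn_integral_liminf) measurable
  finally show ?thesis unfolding eq .
qed

section \<open>The Dunkl maximal function and Morrey norm on ordinary intervals\<close>

lemma rational_sequence_below:
  assumes "0 < r"
  obtains s where "s \<longlonglongrightarrow> r" "\<And>n. s n \<in> rational_radii" "\<And>n. s n \<le> r"
proof -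
  have "\<exists>t\<in>\<rat>. max 0 (r - 1 / real (Suc n)) < t \<and> t < r" for n
    using assms by (intro Rats_dense_in_real) auto
  then obtain s where s: "\<And>n. s n \<in> \<rat>" "\<And>n. max 0 (r - 1 / real (Suc n)) < s n" "\<And>n. s n < r"
    by metis
  have "(\<lambda>n. r - 1 / real (Suc n)) \<longlonglongrightarrow> r - 0"
    by (intro tendsto_intros) (use LIMSEQ_inverse_real_of_nat in \<open>simp add: inverse_eq_divide\<close>)
  then have l: "(\<lambda>n. r - 1 / real (Suc n)) \<longlonglongrightarrow> r" by simp
  have "s \<longlonglongrightarrow> r"
    by (rule tendsto_sandwich[OF _ _ l tendsto_const])
       (use s in \<open>auto intro!: always_eventually less_imp_le simp del: of_nat_Suc\<close>)
  moreover have "s n \<in> rational_radii" "s n \<le> r" for n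
    using s(1)[of n] s(2)[of n] s(3)[of n] by (auto simp: rational_radii_def)
  ultimately show ?thesis using that by blast
qed

text \<open>
  If rational radii \<open>s n\<close> tend to \<open>r\<close> from below, the integrals at \<open>r\<close> are at most the lower limit of
  those at \<open>s n\<close>, while the measures of \<open>(- s n, s n)\<close> are at most that of \<open>(-r, r)\<close>.  So no quotient
  exceeds the supremum over rational radii.
\<close>

lemma dunkl_maximal_eq:
  fixes f :: "real \<Rightarrow> 'a :: real_normed_vector"
  assumes \<alpha>: "- 1 / 2 \<le> \<alpha>" and u [measurable]: "u \<in> borel_measurable borel" and u0: "\<And>z. 0 \<le> u z"
    and ae: "AE z in dunkl_borel \<alpha>. norm (f z) = u z"
    and int: "\<And>R. (\<integral>\<^sup>+z\<in>{-R..R}. ennreal (u z) \<partial>dunkl_borel \<alpha>) < \<infinity>"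
  shows "dunkl_maximal \<alpha> f x = (SUP r\<in>rational_radii.
    (\<integral>\<^sup>+ z. ennreal (u z) * ennreal (interval_kernel \<alpha> r x z) \<partial>dunkl_borel \<alpha>) / ennreal (measure (dunkl_measure \<alpha>) {-r<..<r}))"
proof -
  define \<Phi> where "\<Phi> r = (\<integral>\<^sup>+ z. ennreal (u z) * ennreal (interval_kernel \<alpha> r x z) \<partial>dunkl_borel \<alpha>)" for r
  define \<mu> where "\<mu> r = measure (dunkl_measure \<alpha>) {-r<..<r}" for r
  have \<mu>: "0 < \<mu> r" if "0 < r" for r
  proof -
    have "0 < centered_const \<alpha> * r powr d_dim \<alpha>"
      using centered_const_pos[OF \<alpha>] that by (intro mult_pos_pos) auto
    also have "\<dots> \<le> \<mu> r" unfolding \<mu>_def by (rule emeasure_dunkl_centered(2)[OF \<alpha> that])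
    finally show ?thesis .
  qed
  have \<mu>_mono: "\<mu> s \<le> \<mu> r" if "0 < s" "s \<le> r" for s r
  proof -
    have "ennreal (\<mu> s) \<le> ennreal (\<mu> r)"
      unfolding \<mu>_def using that
      by (subst (1 2) emeasure_dunkl_centered(1)[OF \<alpha>, symmetric]) (auto intro!: emeasure_mono)
    then show ?thesis using \<mu>[of r] that by (simp add: ennreal_le_iff)
  qed
  have term_eq: "ennreal (1 / \<mu> r * (LINT y:{-r<..<r}|dunkl_measure \<alpha>. dunkl_translation \<alpha> x (\<lambda>z. norm (f z)) y)) = \<Phi> r / ennreal (\<mu> r)"
    if r: "0 < r" for r
  proof -
    note a = dunkl_adjoint_nonneg[OF \<alpha> r u u0 ae int, of x]
    show ?thesis unfolding \<Phi>_def a(1)[symmetric] using \<mu>[OF r] a(2) by (simp add: divide_ennreal)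
  qed
  define S where "S = (SUP r\<in>rational_radii. \<Phi> r / ennreal (\<mu> r))"
  have "dunkl_maximal \<alpha> f x = (SUP r\<in>{0<..}. \<Phi> r / ennreal (\<mu> r))"
    unfolding dunkl_maximal_def \<mu>_def[symmetric] by (intro SUP_cong refl term_eq) auto
  also have "\<dots> = S"
  proof (rule antisym)
    show "S \<le> (SUP r\<in>{0<..}. \<Phi> r / ennreal (\<mu> r))"
      unfolding S_def using countable_rational_radii(2) by (rule SUP_subset_mono) auto
    show "(SUP r\<in>{0<..}. \<Phi> r / ennreal (\<mu> r)) \<le> S"
    proof (rule SUP_least)
      fix r :: real assume "r \<in> {0<..}"
      then have r: "0 < r" by simp
      obtain s where s: "s \<longlonglongrightarrow> r" "\<And>n. s n \<in> rational_radii" "\<And>n. s n \<le> r"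
        using rational_sequence_below[OF r] by blast
      have s0: "0 < s n" for n using s(2)[of n] countable_rational_radii(2) by auto
      have bd: "\<Phi> (s n) \<le> ennreal (\<mu> r) * S" for n
      proof -
        have "\<Phi> (s n) = \<Phi> (s n) / ennreal (\<mu> (s n)) * ennreal (\<mu> (s n))"
          using \<mu>[OF s0[of n]] by (simp add: ennreal_divide_times divide_ennreal)
        also have "\<dots> \<le> S * ennreal (\<mu> r)"
          unfolding S_def using s(2)[of n] \<mu>_mono[OF s0 s(3), of n]
          by (intro mult_mono SUP_upper ennreal_leI) auto
        finally show ?thesis by (simp add: mult.commute)
      qed
      have "\<Phi> r \<le> liminf (\<lambda>n. \<Phi> (s n))"
        unfolding \<Phi>_def by (rule kernel_average_liminf[OF \<alpha> r s(1) s0 u])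
      also have "\<dots> \<le> ennreal (\<mu> r) * S"
        using bd by (intro Liminf_le) auto
      finally show "\<Phi> r / ennreal (\<mu> r) \<le> S"
        using \<mu>[OF r] by (intro divide_le_posI_ennreal) (auto simp: mult.commute)
    qed
  qed
  finally show ?thesis by (simp add: S_def \<Phi>_def \<mu>_def)
qed

lemma dunkl_maximal_measurable:
  fixes f :: "real \<Rightarrow> 'a :: real_normed_vector"
  assumes \<alpha>: "- 1 / 2 \<le> \<alpha>" and u [measurable]: "u \<in> borel_measurable borel" and u0: "\<And>z. 0 \<le> u z"
    and ae: "AE z in dunkl_borel \<alpha>. norm (f z) = u z"
    and int: "\<And>R. (\<integral>\<^sup>+z\<in>{-R..R}. ennreal (u z) \<partial>dunkl_borel \<alpha>) < \<infinity>"
  shows "dunkl_maximal \<alpha> f \<in> borel_measurable borel"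
proof -
  interpret sigma_finite_measure "dunkl_borel \<alpha>" by (rule sigma_finite_dunkl_borel)
  note [measurable] = interval_kernel_measurable[OF _ _ \<alpha>]
  have "dunkl_maximal \<alpha> f = (\<lambda>x. SUP r\<in>rational_radii.
    (\<integral>\<^sup>+ z. ennreal (u z) * ennreal (interval_kernel \<alpha> r x z) \<partial>dunkl_borel \<alpha>) / ennreal (measure (dunkl_measure \<alpha>) {-r<..<r}))"
    using dunkl_maximal_eq[OF assms] by (intro ext)
  also have "\<dots> \<in> borel_measurable borel"
    by (intro borel_measurable_SUP countable_rational_radii(1)) measurable
  finally show ?thesis .
qed

lemma nn_integral_ball_reflect:
  assumes [measurable]: "u \<in> borel_measurable borel"
  shows "(\<integral>\<^sup>+z\<in>ball x r. u (- z) \<partial>dunkl_borel \<alpha>) = (\<integral>\<^sup>+z\<in>ball (- x) r. u z \<partial>dunkl_borel \<alpha>)"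
proof -
  have [measurable]: "ball a r \<in> sets borel" for a :: real by simp
  have "(\<integral>\<^sup>+z\<in>ball x r. u (- z) \<partial>dunkl_borel \<alpha>) = (\<integral>\<^sup>+ z. (\<lambda>z. u z * indicator (ball (- x) r) z) (- z) \<partial>dunkl_borel \<alpha>)"
    by (intro nn_integral_cong) (auto simp: indicator_def dist_real_def)
  also have "\<dots> = (\<integral>\<^sup>+z\<in>ball (- x) r. u z \<partial>dunkl_borel \<alpha>)"
    by (rule nn_integral_dunkl_borel_uminus) measurable
  finally show ?thesis .
qed

text \<open>
  The interval kernel is supported near \<open>x\<close> and near \<open>- x\<close>; reflecting the second part produces
  \<open>u z + u (- z)\<close>.  The powers of \<open>r\<close> and \<open>\<bar>x\<bar>\<close> combine to \<open>1 / dunkl_gauge \<alpha> x r\<close>.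
\<close>

lemma dunkl_maximal_le:
  assumes \<alpha>: "- 1 / 2 \<le> \<alpha>"
    and C: "0 < C" "\<And>r x z. 0 < r \<Longrightarrow> interval_kernel \<alpha> r x z \<le> C * relative_radius x r powr (2 * \<alpha> + 1)"
    and u [measurable]: "u \<in> borel_measurable borel" and u0: "\<And>z. 0 \<le> u z"
    and ae: "AE z in dunkl_borel \<alpha>. norm (f z) = u z"
    and int: "\<And>R. (\<integral>\<^sup>+z\<in>{-R..R}. ennreal (u z) \<partial>dunkl_borel \<alpha>) < \<infinity>"
  shows "dunkl_maximal \<alpha> f x \<le> ennreal (C / centered_const \<alpha>)
    * doubling_gauge.gauge_maximal (dunkl_borel \<alpha>) (dunkl_gauge \<alpha>) rational_radii (\<lambda>z. u z + u (- z)) x"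
proof (subst dunkl_maximal_eq[OF \<alpha> u u0 ae int], rule SUP_least)
  interpret G: doubling_gauge "dunkl_borel \<alpha>" "dunkl_gauge \<alpha>" "gauge_const \<alpha>"
    by (rule doubling_gauge_dunkl[OF \<alpha>])
  define c where "c = centered_const \<alpha>"
  have c: "0 < c" using centered_const_pos[OF \<alpha>] by (simp add: c_def)
  fix r assume rr: "r \<in> rational_radii"
  then have r: "0 < r" using countable_rational_radii(2) by auto
  define F where "F z = u z + u (- z)" for z
  define \<mu> where "\<mu> = measure (dunkl_measure \<alpha>) {-r<..<r}"
  define \<rho> where "\<rho> = relative_radius x r powr (2 * \<alpha> + 1)"
  define V where "V = dunkl_gauge \<alpha> x r"
  have V: "0 < V" unfolding V_def by (rule G.V_pos[OF r])
  have \<rho>: "0 < \<rho>" using relative_radius_bounds[OF r, of x] by (simp add: \<rho>_def)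
  have "c * r powr d_dim \<alpha> \<le> \<mu>" using emeasure_dunkl_centered(2)[OF \<alpha> r] by (simp add: c_def \<mu>_def)
  also have "r powr d_dim \<alpha> = \<rho> * V" using dunkl_gauge_relative_radius[OF r] by (simp add: \<rho>_def V_def)
  finally have \<mu>: "c * (\<rho> * V) \<le> \<mu>" .
  have cV: "0 < c * (\<rho> * V)" using c \<rho> V by simp
  have [measurable]: "ball a r \<in> sets borel" for a :: real by simp
  have "(\<integral>\<^sup>+ z. ennreal (u z) * ennreal (interval_kernel \<alpha> r x z) \<partial>dunkl_borel \<alpha>)
    \<le> ennreal (C * \<rho>) * ((\<integral>\<^sup>+z\<in>ball x r. ennreal (u z) \<partial>dunkl_borel \<alpha>) + (\<integral>\<^sup>+z\<in>ball (- x) r. ennreal (u z) \<partial>dunkl_borel \<alpha>))"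
    using C \<rho> r by (intro nn_integral_interval_kernel_le[OF \<alpha> r]) (auto simp: \<rho>_def)
  also have "(\<integral>\<^sup>+z\<in>ball (- x) r. ennreal (u z) \<partial>dunkl_borel \<alpha>) = (\<integral>\<^sup>+z\<in>ball x r. ennreal (u (- z)) \<partial>dunkl_borel \<alpha>)"
    by (rule nn_integral_ball_reflect[symmetric]) measurable
  also have "(\<integral>\<^sup>+z\<in>ball x r. ennreal (u z) \<partial>dunkl_borel \<alpha>) + \<dots> = (\<integral>\<^sup>+z\<in>ball x r. ennreal (F z) \<partial>dunkl_borel \<alpha>)"
    using u0 by (subst nn_integral_add[symmetric]) (auto simp: F_def ennreal_plus distrib_right intro!: nn_integral_cong)
  also have "\<dots> = ennreal V * G.gauge_average F r x"
    unfolding G.gauge_average_def V_def[symmetric] using V by (simp add: ennreal_times_divide mult.commute[of "ennreal V"] mult_divide_eq_ennreal)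
  finally have le: "(\<integral>\<^sup>+ z. ennreal (u z) * ennreal (interval_kernel \<alpha> r x z) \<partial>dunkl_borel \<alpha>) \<le> ennreal (C * \<rho> * V) * G.gauge_average F r x"
    using C \<rho> V by (simp add: ennreal_mult mult.assoc)
  also have "\<dots> \<le> ennreal (\<mu> * (C / c)) * G.gauge_maximal rational_radii F x"
  proof (rule mult_mono[OF ennreal_leI])
    have "C * \<rho> * V = c * (\<rho> * V) * (C / c)" using c by simp
    also have "\<dots> \<le> \<mu> * (C / c)" using \<mu> C c by (intro mult_right_mono) auto
    finally show "C * \<rho> * V \<le> \<mu> * (C / c)" .
    show "G.gauge_average F r x \<le> G.gauge_maximal rational_radii F x" unfolding G.gauge_maximal_def using rr by (rule SUP_upper)
  qed auto
  also have "\<dots> = ennreal \<mu> * (ennreal (C / c) * G.gauge_maximal rational_radii F x)"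
    using C c cV \<mu> by (subst ennreal_mult) (auto simp: mult.assoc)
  finally show "(\<integral>\<^sup>+ z. ennreal (u z) * ennreal (interval_kernel \<alpha> r x z) \<partial>dunkl_borel \<alpha>) / ennreal (measure (dunkl_measure \<alpha>) {-r<..<r})
     \<le> ennreal (C / centered_const \<alpha>) * G.gauge_maximal rational_radii (\<lambda>z. u z + u (- z)) x"
    using cV \<mu> unfolding \<mu>_def[symmetric] F_def[abs_def] c_def[symmetric]
    by (intro divide_le_posI_ennreal) (auto simp: mult.commute)
qed

lemma powr_mean_le:
  fixes L R q w p :: real
  assumes "0 < p" "0 \<le> L" "0 < R" "0 < w" "0 \<le> q" "1 / w * (1 / R * L) powr (1 / p) \<le> q"
  shows "L \<le> R * (w * q) powr p"
proof -
  have "(L / R) powr (1 / p) \<le> w * q" using assms by (simp add: field_simps)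
  then have "((L / R) powr (1 / p)) powr p \<le> (w * q) powr p"
    using assms by (intro powr_mono2) auto
  then have "L / R \<le> (w * q) powr p" using assms by (simp add: powr_powr)
  then show ?thesis using assms by (simp add: field_simps)
qed

text \<open>
  The lower bound on the kernel of radius \<open>2 * r\<close> recovers the integral over \<open>ball x r\<close> from the term of
  the Morrey norm at \<open>x\<close> and \<open>2 * r\<close>; the inequality for \<open>\<phi>\<close> replaces \<open>\<phi> (2 * r)\<close> by \<open>\<phi> r\<close>.
\<close>

lemma integral_ball_le_morrey_norm:
  assumes \<alpha>: "- 1 / 2 \<le> \<alpha>"
    and c: "0 < c" "\<And>r x z. 0 < r \<Longrightarrow> \<bar>x - z\<bar> < r \<Longrightarrow> c * relative_radius x r powr (2 * \<alpha> + 1) \<le> interval_kernel \<alpha> (2 * r) x z"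
    and p: "1 < p" and u [measurable]: "u \<in> borel_measurable borel" and u0: "\<And>z. 0 \<le> u z"
    and ae: "AE z in dunkl_borel \<alpha>. norm (f z) = u z"
    and int: "\<And>R. (\<integral>\<^sup>+z\<in>{-R..R}. ennreal (u z powr p) \<partial>dunkl_borel \<alpha>) < \<infinity>"
    and \<phi>0: "\<And>r. 0 < r \<Longrightarrow> 0 < \<phi> r" and \<phi>: "\<And>r s. 0 < r \<Longrightarrow> r \<le> s \<Longrightarrow> \<phi> s \<le> B * \<phi> r" and B: "0 < B"
    and q: "0 \<le> q" and Q: "morrey_norm \<alpha> p \<phi> f \<le> ennreal q" and r: "0 < r"
  shows "(\<integral>\<^sup>+z\<in>ball x r. ennreal (u z powr p) \<partial>dunkl_borel \<alpha>)
    \<le> ennreal (2 powr d_dim \<alpha> / c * dunkl_gauge \<alpha> x r * (B * \<phi> r * q) powr p)"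
proof -
  interpret G: doubling_gauge "dunkl_borel \<alpha>" "dunkl_gauge \<alpha>" "gauge_const \<alpha>"
    by (rule doubling_gauge_dunkl[OF \<alpha>])
  note [measurable] = interval_kernel_measurable[OF _ _ \<alpha>]
  have [measurable]: "ball a r \<in> sets borel" for a :: real by simp
  define L where "L = (LINT y:{-(2*r)<..<2*r}|dunkl_measure \<alpha>. dunkl_translation \<alpha> x (\<lambda>z. norm (f z) powr p) y)"
  define \<rho> where "\<rho> = relative_radius x r powr (2 * \<alpha> + 1)"
  define V where "V = dunkl_gauge \<alpha> x r"
  have V: "0 < V" unfolding V_def by (rule G.V_pos[OF r])
  have \<rho>: "0 < \<rho>" using relative_radius_bounds[OF r, of x] by (simp add: \<rho>_def)
  have r2: "0 < 2 * r" using r by simp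
  have aep: "AE z in dunkl_borel \<alpha>. norm (f z) powr p = u z powr p" using ae by eventually_elim simp
  have up: "(\<lambda>z. u z powr p) \<in> borel_measurable borel" by measurable
  note adj = dunkl_adjoint_nonneg[OF \<alpha> r2 up powr_ge_zero aep int, of x, folded L_def]
  have "ennreal (1 / \<phi> (2 * r) * (1 / (2 * r) powr d_dim \<alpha> * L) powr (1 / p)) \<le> morrey_norm \<alpha> p \<phi> f"
    unfolding morrey_norm_def L_def using r2 by (intro SUP_upper2[of "2 * r"] SUP_upper2[of x]) auto
  also have "\<dots> \<le> ennreal q" by (rule Q)
  finally have "1 / \<phi> (2 * r) * (1 / (2 * r) powr d_dim \<alpha> * L) powr (1 / p) \<le> q"
    using q by (simp add: ennreal_le_iff)
  then have "L \<le> (2 * r) powr d_dim \<alpha> * (\<phi> (2 * r) * q) powr p"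
    using p adj(2) r2 \<phi>0[OF r2] q by (intro powr_mean_le) auto
  also have "\<dots> \<le> (2 * r) powr d_dim \<alpha> * (B * \<phi> r * q) powr p"
    using \<phi>[of r "2 * r"] r q p \<phi>0[OF r2] by (intro mult_left_mono powr_mono2 mult_right_mono) auto
  also have "(2 * r) powr d_dim \<alpha> = 2 powr d_dim \<alpha> * (\<rho> * V)"
    using r dunkl_gauge_relative_radius[OF r, of x \<alpha>] by (simp add: powr_mult \<rho>_def V_def)
  finally have L: "L \<le> 2 powr d_dim \<alpha> * (\<rho> * V) * (B * \<phi> r * q) powr p" .
  have "ennreal (c * \<rho>) * (\<integral>\<^sup>+z\<in>ball x r. ennreal (u z powr p) \<partial>dunkl_borel \<alpha>)
     = (\<integral>\<^sup>+ z. ennreal (c * \<rho>) * (ennreal (u z powr p) * indicator (ball x r) z) \<partial>dunkl_borel \<alpha>)"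
    by (rule nn_integral_cmult[symmetric]) measurable
  also have "\<dots> \<le> (\<integral>\<^sup>+ z. ennreal (u z powr p) * ennreal (interval_kernel \<alpha> (2 * r) x z) \<partial>dunkl_borel \<alpha>)"
  proof (intro nn_integral_mono)
    fix z
    have "ennreal (c * \<rho>) \<le> ennreal (interval_kernel \<alpha> (2 * r) x z)" if "z \<in> ball x r"
      using that c(2)[OF r, of x z] by (intro ennreal_leI) (auto simp: \<rho>_def dist_real_def)
    then show "ennreal (c * \<rho>) * (ennreal (u z powr p) * indicator (ball x r) z) \<le> ennreal (u z powr p) * ennreal (interval_kernel \<alpha> (2 * r) x z)"
      by (auto simp: indicator_def mult.commute[of "ennreal (c * \<rho>)"] intro!: mult_left_mono)
  qed
  also have "\<dots> = ennreal L" by (rule adj(1)[symmetric])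
  also have "\<dots> \<le> ennreal (2 powr d_dim \<alpha> * (\<rho> * V) * (B * \<phi> r * q) powr p)" by (rule ennreal_leI[OF L])
  also have "\<dots> = ennreal (c * \<rho>) * ennreal (2 powr d_dim \<alpha> / c * V * (B * \<phi> r * q) powr p)"
    using c \<rho> V by (simp add: ennreal_mult[symmetric] ac_simps)
  finally show ?thesis
    using c \<rho> unfolding V_def by (subst (asm) ennreal_mult_le_mult_iff) auto
qed

text \<open>
  The converse comparison: by the upper bound on the kernel, each term of the Morrey norm is controlled
  by the integrals over \<open>ball x r\<close> and \<open>ball (- x) r\<close>.
\<close>

lemma morrey_norm_le_of_integral_ball:
  assumes \<alpha>: "- 1 / 2 \<le> \<alpha>"
    and C: "0 < C" "\<And>r x z. 0 < r \<Longrightarrow> interval_kernel \<alpha> r x z \<le> C * relative_radius x r powr (2 * \<alpha> + 1)"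
    and p: "1 < p" and h [measurable]: "h \<in> borel_measurable borel" and h0: "\<And>z. 0 \<le> h z"
    and \<phi>0: "\<And>r. 0 < r \<Longrightarrow> 0 < \<phi> r" and E: "0 \<le> E"
    and I: "\<And>x r. 0 < r \<Longrightarrow> (\<integral>\<^sup>+z\<in>ball x r. ennreal (h z powr p) \<partial>dunkl_borel \<alpha>) \<le> ennreal (dunkl_gauge \<alpha> x r * (E * \<phi> r) powr p)"
  shows "locally_p_integrable \<alpha> p h" and "morrey_norm \<alpha> p \<phi> h \<le> ennreal ((2 * C) powr (1 / p) * E)"
proof -
  interpret G: doubling_gauge "dunkl_borel \<alpha>" "dunkl_gauge \<alpha>" "gauge_const \<alpha>"
    by (rule doubling_gauge_dunkl[OF \<alpha>])
  have hp: "(\<lambda>z. h z powr p) \<in> borel_measurable borel" by measurable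
  have int: "(\<integral>\<^sup>+z\<in>{-R..R}. ennreal (h z powr p) \<partial>dunkl_borel \<alpha>) < \<infinity>" for R
  proof -
    have "(\<integral>\<^sup>+z\<in>{-R..R}. ennreal (h z powr p) \<partial>dunkl_borel \<alpha>)
       \<le> (\<integral>\<^sup>+z\<in>ball 0 (\<bar>R\<bar> + 1). ennreal (h z powr p) \<partial>dunkl_borel \<alpha>)"
      by (intro nn_integral_mono) (auto simp: indicator_def dist_real_def)
    also have "\<dots> \<le> ennreal (dunkl_gauge \<alpha> 0 (\<bar>R\<bar> + 1) * (E * \<phi> (\<bar>R\<bar> + 1)) powr p)" by (intro I) auto
    finally show ?thesis by (rule le_less_trans) simp
  qed
  show "locally_p_integrable \<alpha> p h"
    unfolding locally_p_integrable_def dunkl_measure_eq_completion[OF \<alpha>]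
  proof (intro conjI allI impI)
    show "h \<in> borel_measurable (completion (dunkl_borel \<alpha>))" by (intro measurable_completion) auto
    fix K :: "real set" assume K: "compact K"
    then have [measurable]: "K \<in> sets borel" by (simp add: borel_compact)
    obtain R where R: "K \<subseteq> {-R..R}"
      using compact_imp_bounded[OF K] by (auto simp: bounded_iff abs_le_iff) force
    have "integrable (dunkl_borel \<alpha>) (\<lambda>z. indicator K z *\<^sub>R (norm (h z) powr p))"
    proof (rule integrableI_bounded)
      have "(\<integral>\<^sup>+ z. ennreal (norm (indicator K z *\<^sub>R (norm (h z) powr p))) \<partial>dunkl_borel \<alpha>)
        \<le> (\<integral>\<^sup>+z\<in>{-R..R}. ennreal (h z powr p) \<partial>dunkl_borel \<alpha>)"
        using R h0 by (intro nn_integral_mono) (auto simp: indicator_def)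
      then show "(\<integral>\<^sup>+ z. ennreal (norm (indicator K z *\<^sub>R (norm (h z) powr p))) \<partial>dunkl_borel \<alpha>) < \<infinity>"
        using int[of R] by (rule le_less_trans)
    qed auto
    then show "set_integrable (completion (dunkl_borel \<alpha>)) K (\<lambda>x. norm (h x) powr p)"
      unfolding set_integrable_def by (subst integrable_completion) auto
  qed
  show "morrey_norm \<alpha> p \<phi> h \<le> ennreal ((2 * C) powr (1 / p) * E)"
    unfolding morrey_norm_def
  proof (intro SUP_least)
    fix r x :: real assume "r \<in> {0<..}"
    then have r: "0 < r" by simp
    define L where "L = (LINT y:{-r<..<r}|dunkl_measure \<alpha>. dunkl_translation \<alpha> x (\<lambda>z. norm (h z) powr p) y)"
    define \<rho> where "\<rho> = relative_radius x r powr (2 * \<alpha> + 1)"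
    define V where "V = dunkl_gauge \<alpha> x r"
    have V: "0 < V" unfolding V_def by (rule G.V_pos[OF r])
    have \<rho>: "0 < \<rho>" using relative_radius_bounds[OF r, of x] by (simp add: \<rho>_def)
    have rV: "\<rho> * V = r powr d_dim \<alpha>" using dunkl_gauge_relative_radius[OF r] by (simp add: \<rho>_def V_def)
    have "AE z in dunkl_borel \<alpha>. norm (h z) powr p = h z powr p" using h0 by simp
    note adj = dunkl_adjoint_nonneg[OF \<alpha> r hp powr_ge_zero this int, of x, folded L_def]
    have "ennreal L = (\<integral>\<^sup>+ z. ennreal (h z powr p) * ennreal (interval_kernel \<alpha> r x z) \<partial>dunkl_borel \<alpha>)" by (rule adj(1))
    also have "\<dots> \<le> ennreal (C * \<rho>) * ((\<integral>\<^sup>+z\<in>ball x r. ennreal (h z powr p) \<partial>dunkl_borel \<alpha>) + (\<integral>\<^sup>+z\<in>ball (- x) r. ennreal (h z powr p) \<partial>dunkl_borel \<alpha>))"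
      using C \<rho> r by (intro nn_integral_interval_kernel_le[OF \<alpha> r]) (auto simp: \<rho>_def)
    also have "\<dots> \<le> ennreal (C * \<rho>) * (ennreal (V * (E * \<phi> r) powr p) + ennreal (V * (E * \<phi> r) powr p))"
      using I[OF r, of x] I[OF r, of "- x"] by (intro mult_left_mono add_mono) (auto simp: V_def)
    also have "\<dots> = ennreal (C * \<rho> * (V * (E * \<phi> r) powr p + V * (E * \<phi> r) powr p))"
      using C \<rho> V by (simp add: ennreal_mult[symmetric] ennreal_plus[symmetric] del: ennreal_plus)
    also have "C * \<rho> * (V * (E * \<phi> r) powr p + V * (E * \<phi> r) powr p) = 2 * C * (r powr d_dim \<alpha> * (E * \<phi> r) powr p)"
      unfolding rV[symmetric] by (simp add: algebra_simps)
    finally have "L \<le> 2 * C * (r powr d_dim \<alpha> * (E * \<phi> r) powr p)"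
      using C by (subst (asm) ennreal_le_iff) auto
    then have "1 / r powr d_dim \<alpha> * L \<le> 2 * C * (E * \<phi> r) powr p" using r by (simp add: field_simps)
    then have "(1 / r powr d_dim \<alpha> * L) powr (1 / p) \<le> (2 * C * (E * \<phi> r) powr p) powr (1 / p)"
      using p adj(2) by (intro powr_mono2) auto
    also have "\<dots> = (2 * C) powr (1 / p) * (E * \<phi> r)"
      using p C E \<phi>0[OF r] by (subst powr_mult) (auto simp: powr_powr)
    finally have "1 / \<phi> r * (1 / r powr d_dim \<alpha> * L) powr (1 / p) \<le> (2 * C) powr (1 / p) * E"
      using \<phi>0[OF r] by (simp add: field_simps)
    then show "ennreal (1 / \<phi> r * (1 / r powr d_dim \<alpha> * (LINT y:{-r<..<r}|dunkl_measure \<alpha>. dunkl_translation \<alpha> x (\<lambda>z. norm (h z) powr p) y)) powr (1 / p)) \<le> ennreal ((2 * C) powr (1 / p) * E)"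
      unfolding L_def by (rule ennreal_leI)
  qed
qed

section \<open>Boundedness of the maximal operator\<close>

text \<open>
  Besides a Borel representative of the norm, this provides local integrability of the first power,
  which the maximal function needs; it follows from \<open>t \<le> 1 + t powr p\<close>.
\<close>

lemma morrey_space_borel_representative:
  fixes f :: "real \<Rightarrow> 'a :: real_normed_vector"
  assumes \<alpha>: "- 1 / 2 \<le> \<alpha>" and p: "1 < p" and f: "locally_p_integrable \<alpha> p f"
  obtains u where "u \<in> borel_measurable borel" "\<And>z. 0 \<le> u z" "AE z in dunkl_borel \<alpha>. norm (f z) = u z"
    "\<And>R. (\<integral>\<^sup>+z\<in>{-R..R}. ennreal (u z powr p) \<partial>dunkl_borel \<alpha>) < \<infinity>"
    "\<And>R. (\<integral>\<^sup>+z\<in>{-R..R}. ennreal (u z) \<partial>dunkl_borel \<alpha>) < \<infinity>"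
proof -
  have f_meas: "f \<in> borel_measurable (completion (dunkl_borel \<alpha>))"
    and f_int: "\<And>K. compact K \<Longrightarrow> set_integrable (completion (dunkl_borel \<alpha>)) K (\<lambda>x. norm (f x) powr p)"
    using f unfolding locally_p_integrable_def dunkl_measure_eq_completion[OF \<alpha>] by auto
  have "(\<lambda>z. norm (f z)) \<in> borel_measurable (completion (dunkl_borel \<alpha>))" by (rule measurable_compose[OF f_meas borel_measurable_norm])
  from completion_ex_borel_measurable_real[OF this] obtain v
    where v: "v \<in> borel_measurable (dunkl_borel \<alpha>)" "AE z in dunkl_borel \<alpha>. norm (f z) = v z" by blast
  define u where "u z = \<bar>v z\<bar>" for z
  have u [measurable]: "u \<in> borel_measurable borel" using v(1) unfolding u_def by simp
  have u0: "0 \<le> u z" for z by (simp add: u_def)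
  have ae: "AE z in dunkl_borel \<alpha>. norm (f z) = u z"
    using v(2) by eventually_elim (metis u_def abs_norm_cancel)
  have intp: "(\<integral>\<^sup>+z\<in>{-R..R}. ennreal (u z powr p) \<partial>dunkl_borel \<alpha>) < \<infinity>" for R
  proof -
    have "integrable (completion (dunkl_borel \<alpha>)) (\<lambda>x. indicator {-R..R} x *\<^sub>R (norm (f x) powr p))"
      using f_int[of "{-R..R}"] by (simp add: set_integrable_def)
    moreover have "AE z in dunkl_borel \<alpha>. indicator {-R..R} z *\<^sub>R (norm (f z) powr p) = indicator {-R..R} z *\<^sub>R (u z powr p)"
      using ae by eventually_elim simp
    ultimately have "integrable (dunkl_borel \<alpha>) (\<lambda>z. indicator {-R..R} z *\<^sub>R (u z powr p))"
      by (subst integral_completion_AE_cong(2)[symmetric]) auto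
    then have "(\<integral>\<^sup>+ z. ennreal (norm (indicator {-R..R} z *\<^sub>R (u z powr p))) \<partial>dunkl_borel \<alpha>) < \<infinity>"
      by (simp add: integrable_iff_bounded)
    also have "(\<integral>\<^sup>+ z. ennreal (norm (indicator {-R..R} z *\<^sub>R (u z powr p))) \<partial>dunkl_borel \<alpha>)
      = (\<integral>\<^sup>+z\<in>{-R..R}. ennreal (u z powr p) \<partial>dunkl_borel \<alpha>)"
      by (intro nn_integral_cong) (auto simp: indicator_def)
    finally show ?thesis .
  qed
  have int: "(\<integral>\<^sup>+z\<in>{-R..R}. ennreal (u z) \<partial>dunkl_borel \<alpha>) < \<infinity>" for R
  proof -
    have fin: "emeasure (dunkl_borel \<alpha>) {-R..R} < \<infinity>"
    proof -
      have "emeasure (dunkl_borel \<alpha>) {-R..R} \<le> emeasure (dunkl_borel \<alpha>) (ball 0 (\<bar>R\<bar> + 1))"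
        by (intro emeasure_mono) (auto simp: dist_real_def)
      also have "\<dots> < \<infinity>"
        using emeasure_dunkl_ball_le[OF \<alpha>, of "\<bar>R\<bar> + 1" 0] by (rule le_less_trans) auto
      finally show ?thesis .
    qed
    have le: "u z \<le> 1 + u z powr p" for z
    proof (cases "u z \<le> 1")
      case False
      then have "u z powr 1 \<le> u z powr p" using p by (intro powr_mono) auto
      then show ?thesis using False by simp
    qed (simp add: add_increasing2)
    have "(\<integral>\<^sup>+z\<in>{-R..R}. ennreal (u z) \<partial>dunkl_borel \<alpha>)
      \<le> (\<integral>\<^sup>+ z. indicator {-R..R} z + ennreal (u z powr p) * indicator {-R..R} z \<partial>dunkl_borel \<alpha>)"
    proof (intro nn_integral_mono)
      fix z
      have "ennreal (u z) \<le> 1 + ennreal (u z powr p)"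
        using ennreal_leI[OF le[of z]] by (simp add: ennreal_plus)
      then show "ennreal (u z) * indicator {-R..R} z \<le> indicator {-R..R} z + ennreal (u z powr p) * indicator {-R..R} z"
        by (auto simp: indicator_def)
    qed
    also have "\<dots> = emeasure (dunkl_borel \<alpha>) {-R..R} + (\<integral>\<^sup>+z\<in>{-R..R}. ennreal (u z powr p) \<partial>dunkl_borel \<alpha>)"
      by (subst nn_integral_add) auto
    also have "\<dots> < \<infinity>" using fin intp[of R] by simp
    finally show ?thesis .
  qed
  from u u0 ae intp int show ?thesis by (rule that)
qed

theorem theorem3p1:
  fixes \<alpha> p :: real and \<phi> :: "real \<Rightarrow> real"
  assumes "\<alpha> \<ge> - 1 / 2"
    and "1 < p"
    and "\<phi> \<in> borel_measurable (lebesgue_on {0<..})"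
    and "\<And>r. 0 < r \<Longrightarrow> 0 < \<phi> r"
    and "almost_decreasing \<phi>"
    and "almost_increasing (\<lambda>r. r powr (d_dim \<alpha> / p) * \<phi> r)"
  shows "\<exists>C>0. \<forall>f :: real \<Rightarrow> complex. f \<in> morrey_space \<alpha> p \<phi> \<longrightarrow>
           (AE x in dunkl_measure \<alpha>. dunkl_maximal \<alpha> f x < \<infinity>) \<and>
           (\<lambda>x. enn2real (dunkl_maximal \<alpha> f x)) \<in> morrey_space \<alpha> p \<phi> \<and>
           morrey_norm \<alpha> p \<phi> (\<lambda>x. enn2real (dunkl_maximal \<alpha> f x))
             \<le> ennreal C * morrey_norm \<alpha> p \<phi> f"
proof -
  note \<alpha> = assms(1) and p = assms(2) and \<phi>0 = assms(4)
  interpret G: doubling_gauge "dunkl_borel \<alpha>" "dunkl_gauge \<alpha>" "gauge_const \<alpha>"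
    by (rule doubling_gauge_dunkl[OF \<alpha>])
  obtain C0 where C0: "0 < C0" "\<And>r s. 0 < r \<Longrightarrow> r \<le> s \<Longrightarrow> C0 * \<phi> s \<le> \<phi> r"
    using assms(5) unfolding almost_decreasing_def by auto
  define B where "B = 1 / C0"
  have B: "0 < B" using C0 by (simp add: B_def)
  have \<phi>: "\<phi> s \<le> B * \<phi> r" if "0 < r" "r \<le> s" for r s
    using C0(2)[OF that] C0(1) by (simp add: B_def field_simps)
  obtain K where K: "0 < K" "\<And>r x z. 0 < r \<Longrightarrow> interval_kernel \<alpha> r x z \<le> K * relative_radius x r powr (2 * \<alpha> + 1)"
    using interval_kernel_upper[OF \<alpha>] by blast
  obtain k where k: "0 < k" "\<And>r x z. 0 < r \<Longrightarrow> \<bar>x - z\<bar> < r \<Longrightarrow> k * relative_radius x r powr (2 * \<alpha> + 1) \<le> interval_kernel \<alpha> (2 * r) x z"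
    using interval_kernel_lower[OF \<alpha>] by blast
  define Cl where "Cl = 2 powr d_dim \<alpha> / k"
  define Cm where "Cm = K / centered_const \<alpha>"
  define Cu where "Cu = 2 * K"
  have Cl: "0 < Cl" using k by (simp add: Cl_def)
  have Cm: "0 < Cm" using K centered_const_pos[OF \<alpha>] by (simp add: Cm_def)
  have Cu: "0 < Cu" using K by (simp add: Cu_def)
  define C2 where "C2 = (2 powr p * 2 * Cl) powr (1 / p) * B"
  define C4 where "C4 = G.morrey_const p B"
  define C5 where "C5 = Cm * C4 powr (1 / p) * C2"
  define C where "C = Cu powr (1 / p) * C5"
  have C2: "0 < C2" using Cl B by (simp add: C2_def)
  have C4: "0 < C4" unfolding C4_def by (rule G.morrey_const_pos[OF p B])
  have C5: "0 < C5" using Cm C4 C2 by (simp add: C5_def)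
  have C: "0 < C" using Cu C5 by (simp add: C_def)
  \<comment> \<open>The bound on balls is stated for a positive level \<open>q\<close>, so the norm of \<open>f\<close>, which may vanish, is replaced by an upper bound.\<close>
  have main: "(AE x in dunkl_borel \<alpha>. dunkl_maximal \<alpha> f x < \<infinity>) \<and>
      locally_p_integrable \<alpha> p (\<lambda>x. enn2real (dunkl_maximal \<alpha> f x)) \<and>
      morrey_norm \<alpha> p \<phi> (\<lambda>x. enn2real (dunkl_maximal \<alpha> f x)) \<le> ennreal (C * q)"
    if f: "locally_p_integrable \<alpha> p f" and q: "0 < q" and Q: "morrey_norm \<alpha> p \<phi> f \<le> ennreal q"
    for f :: "real \<Rightarrow> complex" and q
  proof -
    have [measurable]: "ball a r \<in> sets borel" for a r :: real by simp
    obtain u where u [measurable]: "u \<in> borel_measurable borel" and u0: "\<And>z. 0 \<le> u z"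
      and ae: "AE z in dunkl_borel \<alpha>. norm (f z) = u z"
      and intp: "\<And>R. (\<integral>\<^sup>+z\<in>{-R..R}. ennreal (u z powr p) \<partial>dunkl_borel \<alpha>) < \<infinity>"
      and int: "\<And>R. (\<integral>\<^sup>+z\<in>{-R..R}. ennreal (u z) \<partial>dunkl_borel \<alpha>) < \<infinity>"
      using morrey_space_borel_representative[OF \<alpha> p f] by blast
    have q0: "0 \<le> q" using q by simp
    have lower: "(\<integral>\<^sup>+z\<in>ball x r. ennreal (u z powr p) \<partial>dunkl_borel \<alpha>) \<le> ennreal (Cl * dunkl_gauge \<alpha> x r * (B * \<phi> r * q) powr p)"
      if "0 < r" for x r
      unfolding Cl_def
      by (rule integral_ball_le_morrey_norm[where f = f]) (fact \<alpha> k p u u0 ae intp \<phi>0 \<phi> B q0 Q that)+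
    define F where "F z = u z + u (- z)" for z
    have F [measurable]: "F \<in> borel_measurable borel" unfolding F_def[abs_def] by measurable
    have F0: "0 \<le> F z" for z using u0 by (simp add: F_def)
    have FI: "(\<integral>\<^sup>+z\<in>ball x r. ennreal (F z powr p) \<partial>dunkl_borel \<alpha>) \<le> ennreal (dunkl_gauge \<alpha> x r * (C2 * q * \<phi> r) powr p)"
      if r: "0 < r" for x r
    proof -
      note V = G.V_pos[OF r, of x]
      have "(\<integral>\<^sup>+z\<in>ball x r. ennreal (F z powr p) \<partial>dunkl_borel \<alpha>)
        \<le> (\<integral>\<^sup>+ z. ennreal (2 powr p) * (ennreal (u z powr p) * indicator (ball x r) z + ennreal (u (- z) powr p) * indicator (ball x r) z) \<partial>dunkl_borel \<alpha>)"
      proof (intro nn_integral_mono)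
        fix z
        have "ennreal (F z powr p) \<le> ennreal (2 powr p * (u z powr p + u (- z) powr p))"
          unfolding F_def using u0 p by (intro ennreal_leI powr_add_le) auto
        also have "\<dots> = ennreal (2 powr p) * (ennreal (u z powr p) + ennreal (u (- z) powr p))"
          by (simp add: ennreal_mult)
        finally show "ennreal (F z powr p) * indicator (ball x r) z \<le> ennreal (2 powr p) * (ennreal (u z powr p) * indicator (ball x r) z + ennreal (u (- z) powr p) * indicator (ball x r) z)"
          by (auto simp: indicator_def)
      qed
      also have "\<dots> = ennreal (2 powr p) * ((\<integral>\<^sup>+z\<in>ball x r. ennreal (u z powr p) \<partial>dunkl_borel \<alpha>) + (\<integral>\<^sup>+z\<in>ball x r. ennreal (u (- z) powr p) \<partial>dunkl_borel \<alpha>))"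
        by (subst nn_integral_cmult, simp, subst nn_integral_add) auto
      also have "(\<integral>\<^sup>+z\<in>ball x r. ennreal (u (- z) powr p) \<partial>dunkl_borel \<alpha>) = (\<integral>\<^sup>+z\<in>ball (- x) r. ennreal (u z powr p) \<partial>dunkl_borel \<alpha>)"
        by (rule nn_integral_ball_reflect) measurable
      also have "ennreal (2 powr p) * ((\<integral>\<^sup>+z\<in>ball x r. ennreal (u z powr p) \<partial>dunkl_borel \<alpha>) + \<dots>)
         \<le> ennreal (2 powr p) * (ennreal (Cl * dunkl_gauge \<alpha> x r * (B * \<phi> r * q) powr p) + ennreal (Cl * dunkl_gauge \<alpha> (- x) r * (B * \<phi> r * q) powr p))"
        using q r by (intro mult_left_mono add_mono lower) auto
      also have "\<dots> = ennreal (2 powr p * (Cl * dunkl_gauge \<alpha> x r * (B * \<phi> r * q) powr p + Cl * dunkl_gauge \<alpha> x r * (B * \<phi> r * q) powr p))"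
        using Cl V by (simp add: ennreal_mult[symmetric] ennreal_plus[symmetric] del: ennreal_plus)
      also have "2 powr p * (Cl * dunkl_gauge \<alpha> x r * (B * \<phi> r * q) powr p + Cl * dunkl_gauge \<alpha> x r * (B * \<phi> r * q) powr p)
         = dunkl_gauge \<alpha> x r * ((2 powr p * 2 * Cl) * (B * \<phi> r * q) powr p)"
        by (simp add: algebra_simps)
      also have "(2 powr p * 2 * Cl) * (B * \<phi> r * q) powr p = (C2 * q * \<phi> r) powr p"
      proof -
        have "C2 * q * \<phi> r = (2 powr p * 2 * Cl) powr (1 / p) * (B * \<phi> r * q)" by (simp add: C2_def)
        then show ?thesis using Cl p B q \<phi>0[OF r] by (simp add: powr_mult powr_powr)
      qed
      finally show ?thesis .
    qed
    define M where "M = G.gauge_maximal rational_radii F"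
    have [measurable]: "M \<in> borel_measurable borel"
      unfolding M_def by (rule G.gauge_maximal_measurable[OF countable_rational_radii(1) F])
    have D: "0 < C2 * q" using C2 q by simp
    note mb = G.morrey_bound[OF F F0 p B D \<phi>0 \<phi> FI, folded M_def C4_def]
    have M_fin: "AE x in dunkl_borel \<alpha>. M x < \<infinity>"
    proof -
      have "AE x in dunkl_borel \<alpha>. \<forall>n. x \<in> ball 0 (real (Suc n)) \<longrightarrow> M x < \<infinity>"
        unfolding AE_all_countable by (intro allI mb(1)) auto
      then show ?thesis
      proof eventually_elim
        case (elim x)
        obtain n where "\<bar>x\<bar> < real n" using reals_Archimedean2 by blast
        then have "x \<in> ball 0 (real (Suc n))" by (auto simp: dist_real_def)
        with elim show ?case by blast
      qed
    qed
    have le: "dunkl_maximal \<alpha> f x \<le> ennreal Cm * M x" for x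
      unfolding M_def F_def[abs_def] Cm_def by (rule dunkl_maximal_le) (fact \<alpha> K u u0 ae int)+
    have fin: "AE x in dunkl_borel \<alpha>. dunkl_maximal \<alpha> f x < \<infinity>"
      using M_fin
    proof eventually_elim
      case (elim x)
      have "ennreal Cm * M x < \<infinity>" using elim by (simp add: ennreal_mult_less_top)
      with le[of x] show ?case by (rule le_less_trans)
    qed
    define h where "h x = enn2real (dunkl_maximal \<alpha> f x)" for x
    have [measurable]: "dunkl_maximal \<alpha> f \<in> borel_measurable borel"
      by (rule dunkl_maximal_measurable[OF \<alpha> u u0 ae int])
    have h [measurable]: "h \<in> borel_measurable borel" unfolding h_def[abs_def] by measurable
    have hI: "(\<integral>\<^sup>+z\<in>ball x r. ennreal (h z powr p) \<partial>dunkl_borel \<alpha>) \<le> ennreal (dunkl_gauge \<alpha> x r * (C5 * q * \<phi> r) powr p)"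
      if r: "0 < r" for x r
    proof -
      note V = G.V_pos[OF r, of x]
      have "(\<integral>\<^sup>+z\<in>ball x r. ennreal (h z powr p) \<partial>dunkl_borel \<alpha>)
        \<le> (\<integral>\<^sup>+ z. ennreal (Cm powr p) * (ennreal (enn2real (M z) powr p) * indicator (ball x r) z) \<partial>dunkl_borel \<alpha>)"
        using M_fin
      proof (intro nn_integral_mono_AE, eventually_elim)
        case (elim z)
        have "h z \<le> Cm * enn2real (M z)"
        proof -
          have "ennreal Cm * M z = ennreal (Cm * enn2real (M z))"
            using elim Cm by (simp add: ennreal_mult)
          with le[of z] show ?thesis unfolding h_def using Cm by (intro enn2real_leI) auto
        qed
        then have "h z powr p \<le> (Cm * enn2real (M z)) powr p" using p by (intro powr_mono2) (auto simp: h_def)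
        also have "\<dots> = Cm powr p * enn2real (M z) powr p" using Cm by (subst powr_mult) auto
        finally have "ennreal (h z powr p) \<le> ennreal (Cm powr p) * ennreal (enn2real (M z) powr p)"
          by (simp add: ennreal_mult[symmetric] ennreal_leI)
        then show ?case by (auto simp: indicator_def)
      qed
      also have "\<dots> = ennreal (Cm powr p) * (\<integral>\<^sup>+z\<in>ball x r. ennreal (enn2real (M z) powr p) \<partial>dunkl_borel \<alpha>)"
        by (rule nn_integral_cmult) auto
      also have "\<dots> \<le> ennreal (Cm powr p) * ennreal (C4 * dunkl_gauge \<alpha> x r * (C2 * q * \<phi> r) powr p)"
        by (intro mult_left_mono mb(2) r) auto
      also have "\<dots> = ennreal (dunkl_gauge \<alpha> x r * (Cm powr p * C4 * (C2 * q * \<phi> r) powr p))"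
        using V C4 by (simp add: ennreal_mult[symmetric] ac_simps)
      also have "Cm powr p * C4 * (C2 * q * \<phi> r) powr p = (C5 * q * \<phi> r) powr p"
      proof -
        have "C5 * q * \<phi> r = Cm * C4 powr (1 / p) * (C2 * q * \<phi> r)" by (simp add: C5_def)
        then show ?thesis using Cm C4 p C2 q \<phi>0[OF r] by (simp add: powr_mult powr_powr)
      qed
      finally show ?thesis .
    qed
    have h0: "0 \<le> h z" for z by (simp add: h_def)
    have E: "0 \<le> C5 * q" using C5 q by simp
    have "locally_p_integrable \<alpha> p h"
      by (rule morrey_norm_le_of_integral_ball(1)) (fact \<alpha> K p h h0 \<phi>0 E hI)+
    moreover have "morrey_norm \<alpha> p \<phi> h \<le> ennreal (Cu powr (1 / p) * (C5 * q))"
      unfolding Cu_def by (rule morrey_norm_le_of_integral_ball(2)) (fact \<alpha> K p h h0 \<phi>0 E hI)+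
    ultimately show ?thesis using fin by (simp add: h_def[abs_def] C_def mult.assoc)
  qed
  show ?thesis
  proof (intro exI[of _ C] conjI C allI impI)
    fix f :: "real \<Rightarrow> complex"
    assume "f \<in> morrey_space \<alpha> p \<phi>"
    then have f: "locally_p_integrable \<alpha> p f" and fin: "morrey_norm \<alpha> p \<phi> f < \<infinity>"
      by (auto simp: morrey_space_def)
    define q where "q = enn2real (morrey_norm \<alpha> p \<phi> f)"
    have q: "0 \<le> q" "morrey_norm \<alpha> p \<phi> f = ennreal q" using fin by (auto simp: q_def)
    \<comment> \<open>Letting \<open>\<epsilon>\<close> tend to 0 also covers the case that the norm of \<open>f\<close> is 0.\<close>
    have m: "(AE x in dunkl_borel \<alpha>. dunkl_maximal \<alpha> f x < \<infinity>) \<and>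
      locally_p_integrable \<alpha> p (\<lambda>x. enn2real (dunkl_maximal \<alpha> f x)) \<and>
      morrey_norm \<alpha> p \<phi> (\<lambda>x. enn2real (dunkl_maximal \<alpha> f x)) \<le> ennreal (C * (q + \<epsilon>))" if "0 < \<epsilon>" for \<epsilon>
      using q that by (intro main f) (auto intro: ennreal_leI simp del: ennreal_plus)
    show "AE x in dunkl_measure \<alpha>. dunkl_maximal \<alpha> f x < \<infinity>"
      unfolding dunkl_measure_eq_completion[OF \<alpha>] using m[of 1] by (intro AE_completion) auto
    show "morrey_norm \<alpha> p \<phi> (\<lambda>x. enn2real (dunkl_maximal \<alpha> f x)) \<le> ennreal C * morrey_norm \<alpha> p \<phi> f"
    proof (rule ennreal_le_epsilon)
      fix e :: real assume e: "0 < e"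
      have "morrey_norm \<alpha> p \<phi> (\<lambda>x. enn2real (dunkl_maximal \<alpha> f x)) \<le> ennreal (C * (q + e / C))"
        using m[of "e / C"] e C by auto
      also have "C * (q + e / C) = C * q + e" using C by (simp add: field_simps)
      also have "ennreal (C * q + e) = ennreal C * morrey_norm \<alpha> p \<phi> f + ennreal e"
        using C q e by (simp add: ennreal_mult)
      finally show "morrey_norm \<alpha> p \<phi> (\<lambda>x. enn2real (dunkl_maximal \<alpha> f x)) \<le> ennreal C * morrey_norm \<alpha> p \<phi> f + ennreal e" .
    qed
    show "(\<lambda>x. enn2real (dunkl_maximal \<alpha> f x)) \<in> morrey_space \<alpha> p \<phi>"
      unfolding morrey_space_def using m[of 1] by (auto intro: le_less_trans)
  qed
qed

end
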